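(* Let $d\ge 1$, $1\le m\le d$, $T\ge 1$, $\alpha>1$, and consider Follow-the-Perturbed-Leader with geometric resampling (as described in the context) in the adversarial size-invariant semi-bandit problem. (i) If the perturbation distribution is the Fréchet distribution $\mathcal{F}_\alpha$ and the learning rate is $$\eta=\sqrt{\frac{\left(\frac{\alpha}{\alpha-1}m^{1-\frac{1}{\alpha}}+\Gamma\left(1-\frac{1}{\alpha}\right)\right)(d+1)^{\frac{1}{\alpha}}+m}{2(\alpha+1)\left(m+\frac{1}{\alpha}\right)^{\frac{1}{\alpha}}\left(m+\frac{\alpha}{\alpha-1}(d-m+1)^{1-1/\alpha}\right)T}},$$ then $$\mathcal{R}(T)\le 2\left(2(\alpha+1)\left(m+\frac{1}{\alpha}\right)^{\frac{1}{\alpha}}\left(m+\frac{\alpha}{\alpha-1}(d-m+1)^{1-1/\alpha}\right)\left(\left(\frac{\alpha}{\alpha-1}m^{1-\frac{1}{\alpha}}+\Gamma\left(1-\frac{1}{\alpha}\right)\right)(d+1)^{\frac{1}{\alpha}}+m\right)T\right)^{1/2},$$ which is of order $O\left(\sqrt{m^2d^{1/\alpha}T}+\sqrt{mdT}\right)$. (ii) If the perturbation distribution is the Pareto distribution $\mathcal{P}_\alpha$ and the learning rate is $$\eta=\sqrt{\frac{\left(\alpha m^{1-\frac{1}{\alpha}}+(\alpha-1)\Gamma\left(1-\frac{1}{\alpha}\right)\right)(d+1)^{\frac{1}{\alpha}}}{4\alpha^2\left(m+\frac{1}{\alpha}\right)^{\frac{1}{\alpha}}d^{1-1/\alpha}T}},$$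 then $$\mathcal{R}(T)\le\frac{4\alpha}{(\alpha-1)^{1/2}}\left(\left(m+\frac{1}{\alpha}\right)^{\frac{1}{\alpha}}\left(\frac{\alpha}{\alpha-1}m^{1-\frac{1}{\alpha}}+\Gamma\left(1-\frac{1}{\alpha}\right)\right)d^{1-1/\alpha}(d+1)^{\frac{1}{\alpha}}T\right)^{1/2},$$ which is of order $O(\sqrt{mdT})$.
   Context: Size-invariant semi-bandit: action set $\mathcal{A}=\{a\in\{0,1\}^d:\|a\|_1=m\}$. In each round $t\in[T]=\{1,\dots,T\}$ an adversary chooses $\ell_t\in[0,1]^d$ arbitrarily (possibly depending on the past history $\{(\ell_s,a_s)\}_{s<t}$), the learner chooses $a_t\in\mathcal{A}$, incurs loss $\langle \ell_t,a_t\rangle$ and observes $\ell_{t,i}$ exactly for those $i$ with $a_{t,i}=1$. The pseudo-regret is $\mathcal{R}(T)=\mathbb{E}[\sum_{t=1}^T\langle\ell_t,a_t-a^*\rangle]$ with $a^*\in\arg\min_{a\in\mathcal{A}}\mathbb{E}[\sum_{t=1}^T\langle\ell_t,a\rangle]$. Perturbation distributions ($\alpha>1$): Fréchet $\mathcal{F}_\alpha$ with CDF $F(x)=e^{-1/x^\alpha}$ and density $\alpha x^{-(\alpha+1)}e^{-1/x^\alpha}$ for $x\ge 0$; Pareto $\mathcal{P}_\alpha$ with CDF $F(x)=1-x^{-\alpha}$ and density $\alpha x^{-(\alpha+1)}$ for $x\ge1$. FTPL with geometric resampling (GR), learning rate $\eta>0$, perturbation distribution $\mathcal{D}$: set $\hat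 L_1=0\in\mathbb{R}^d$. In round $t$: sample $r_t\in\mathbb{R}^d$ with i.i.d. coordinates from $\mathcal{D}$, play $a_t\in\arg\min_{a\in\mathcal{A}}a^\top(\eta\hat L_t-r_t)$, observe $\{\ell_{t,i}:a_{t,i}=1\}$. Then run GR: set $K=0\in\mathbb{R}^d$, $s=a_t$; repeat {$K\leftarrow K+s$; draw a fresh independent $r'$ with i.i.d. coordinates from $\mathcal{D}$; $a'\in\arg\min_{a\in\mathcal{A}}a^\top(\eta\hat L_t-r')$; $s\leftarrow s\circ(\mathbf{1}_d-a')$ (coordinatewise product)} until $s=0$; set $\widehat{w_{t,i}^{-1}}=K_i$ for all $i$ with $a_{t,i}=1$. Finally $\hat\ell_t=\sum_{i:a_{t,i}=1}\ell_{t,i}\widehat{w_{t,i}^{-1}}e_i$ and $\hat L_{t+1}=\hat L_t+\hat\ell_t$. $\Gamma$ is the gamma function. *)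

theory Defs
  imports "HOL-Probability.Probability"
begin

text \<open>Action set of the size-invariant semi-bandit: subsets of the coordinates
  {0..<d} of size m (identified with their indicator vectors in {0,1}^d).\<close>
definition actions :: "nat \<Rightarrow> nat \<Rightarrow> nat set set" where
  "actions d m = {S. S \<subseteq> {..<d} \<and> card S = m}"

definition frechet :: "real \<Rightarrow> real measure" where
  "frechet \<alpha> = density lborel (\<lambda>x. ennreal
     (if 0 < x then \<alpha> * x powr (-(\<alpha> + 1)) * exp (- (x powr (-\<alpha>))) else 0))"

definition pareto :: "real \<Rightarrow> real measure" where
  "pareto \<alpha> = density lborel (\<lambda>x. ennreal (if 1 \<le> x then \<alpha> * x powr (-(\<alpha> + 1)) else 0))"

text \<open>The leader: an element of argmin over actions of a^T (eta L - r)
  (fixed tie-breaking via arg_min_on; ties have probability zero).\<close>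
definition ftpl_action :: "nat \<Rightarrow> nat \<Rightarrow> real \<Rightarrow> (nat \<Rightarrow> real) \<Rightarrow> (nat \<Rightarrow> real) \<Rightarrow> nat set" where
  "ftpl_action d m \<eta> L r = arg_min_on (\<lambda>a. \<Sum>i\<in>a. \<eta> * L i - r i) (actions d m)"

text \<open>Geometric resampling: rs 0 is the perturbation r_t used to play, rs k (k >= 1)
  is the k-th fresh resample r'. The counter K_i produced by the GR loop equals the
  least k >= 1 such that coordinate i belongs to the k-th resampled action
  (0 on the null event that this never happens).\<close>
definition gr_count :: "nat \<Rightarrow> nat \<Rightarrow> real \<Rightarrow> (nat \<Rightarrow> real) \<Rightarrow> (nat \<Rightarrow> nat \<Rightarrow> real) \<Rightarrow> nat \<Rightarrow> nat" where
  "gr_count d m \<eta> L rs i =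
     (if \<exists>k\<ge>1. i \<in> ftpl_action d m \<eta> L (rs k)
      then LEAST k. 1 \<le> k \<and> i \<in> ftpl_action d m \<eta> L (rs k) else 0)"

type_synonym hist = "((nat \<Rightarrow> real) \<times> nat set) list"

text \<open>All randomness: w (t, k, i) is coordinate i of the k-th perturbation drawn in round t
  (k = 0: r_t; k >= 1: the GR resamples). The adversary adv maps the history
  [(l_s, a_s)]_{s<t} to the loss vector l_t. State before round t: (hat L_t, history).\<close>
fun ftpl_state :: "nat \<Rightarrow> nat \<Rightarrow> real \<Rightarrow> (hist \<Rightarrow> nat \<Rightarrow> real) \<Rightarrow> (nat \<times> nat \<times> nat \<Rightarrow> real)
    \<Rightarrow> nat \<Rightarrow> (nat \<Rightarrow> real) \<times> hist" where
  "ftpl_state d m \<eta> adv w 0 = ((\<lambda>_. 0), [])"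
| "ftpl_state d m \<eta> adv w (Suc t) =
     (let (L, h) = ftpl_state d m \<eta> adv w t;
          lt = adv h;
          rs = (\<lambda>k i. w (t, k, i));
          a = ftpl_action d m \<eta> L (rs 0);
          L' = (\<lambda>i. L i + (if i \<in> a then lt i * real (gr_count d m \<eta> L rs i) else 0))
      in (L', h @ [(lt, a)]))"

definition ftpl_loss :: "nat \<Rightarrow> nat \<Rightarrow> real \<Rightarrow> (hist \<Rightarrow> nat \<Rightarrow> real) \<Rightarrow> (nat \<times> nat \<times> nat \<Rightarrow> real)
    \<Rightarrow> nat \<Rightarrow> nat \<Rightarrow> real" where
  "ftpl_loss d m \<eta> adv w t = adv (snd (ftpl_state d m \<eta> adv w t))"

definition ftpl_play :: "nat \<Rightarrow> nat \<Rightarrow> real \<Rightarrow> (hist \<Rightarrow> nat \<Rightarrow> real) \<Rightarrow> (nat \<times> nat \<times> nat \<Rightarrow> real)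
    \<Rightarrow> nat \<Rightarrow> nat set" where
  "ftpl_play d m \<eta> adv w t = ftpl_action d m \<eta> (fst (ftpl_state d m \<eta> adv w t)) (\<lambda>i. w (t, 0, i))"

definition perturb_space :: "real measure \<Rightarrow> (nat \<times> nat \<times> nat \<Rightarrow> real) measure" where
  "perturb_space D = Pi\<^sub>M UNIV (\<lambda>_. D)"

definition pseudo_regret :: "nat \<Rightarrow> nat \<Rightarrow> real \<Rightarrow> real measure \<Rightarrow> (hist \<Rightarrow> nat \<Rightarrow> real) \<Rightarrow> nat \<Rightarrow> real" where
  "pseudo_regret d m \<eta> D adv T =
     (\<integral>w. (\<Sum>t<T. \<Sum>i\<in>ftpl_play d m \<eta> adv w t. ftpl_loss d m \<eta> adv w t i) \<partial>perturb_space D)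
     - Min ((\<lambda>a. \<integral>w. (\<Sum>t<T. \<Sum>i\<in>a. ftpl_loss d m \<eta> adv w t i) \<partial>perturb_space D) ` actions d m)"

end

theory Submission
  imports Defs
begin

text \<open>
  Histories take only countably many values, so all quantities are measurable although the adversary
  is an arbitrary function. With the potential \<open>\<Phi>(L) = E[min\<^sub>a a\<^sup>T(\<eta>L - r)] / \<eta>\<close>, concavity of the
  minimum and the unbiasedness of geometric resampling bound the regret by a penalty
  \<open>-\<Phi>(0)\<close> plus stability terms \<open>E[U\<^sup>1\<^sup>+\<^sup>1\<^sup>/\<^sup>\<alpha>] / E[U]\<close>, where \<open>U\<close> is the probability that an arm is
  selected given the noise of the other arms. Both noise distributions are treated
  at once: all that is needed is \<open>f \<le> \<alpha> (1 - F)\<^sup>1\<^sup>+\<^sup>1\<^sup>/\<^sup>\<alpha>\<close>, \<open>f(x) \<le> \<alpha> x\<^sup>-\<^sup>(\<^sup>\<alpha>\<^sup>+\<^sup>1\<^sup>)\<close> and that \<open>f / (F (1 - F))\<close> is decreasing.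

  The key estimate is \<open>E[U\<^sup>2] \<le> (2m / \<sigma>) E[U]\<close> for the arm whose estimated loss has rank \<open>\<sigma>\<close>.
  Given the noise of arm \<open>i\<close>, the covariance between selecting \<open>i\<close> and a better arm \<open>j\<close> beating \<open>i\<close>
  is \<open>-F (1 - F)\<close> on the event that \<open>j\<close> is decisive. By monotonicity of \<open>f / (F (1 - F))\<close> the roles of
  \<open>i\<close> and \<open>j\<close> can be exchanged, and then the sum over \<open>j\<close> is at most \<open>E[U (1 - U)]\<close> because at most one
  arm is decisive. The passage to \<open>E[U\<^sup>1\<^sup>+\<^sup>1\<^sup>/\<^sup>\<alpha>]\<close> is a tangent-line bound.
\<close>

section \<open>Resampling coordinates of an infinite product\<close>

text \<open>The rank \<sigma> is what keeps the sum over arms small: bounding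
  \<open>U powr (1 + 1/\<alpha>)\<close> by U would cost order d per round, whereas the sum of
  \<open>min 1 (2m/k) powr (1/\<alpha>)\<close> over k \<le> d is at most of order m^(1/\<alpha>)
  d^(1-1/\<alpha>). The factor 2m/\<sigma> comes from a count. While arm i is selected, fewer than m
  arms beat it. Given \<open>r i\<close>, an arm whose estimated loss is no larger beats it with
  probability at least \<open>tail (r i)\<close>, and the mean of \<open>tail (r i)\<close> over the
  selection of i is exactly half the second moment of U. Were the two events independent given
  \<open>r i\<close>, about \<sigma> such arms would give \<sigma> E[U^2] / 2 \<le> m E[U]; the
  covariance estimate pays for the dependence. Estimated losses are unbounded and selection
  probabilities are not shown to be positive. Hence expectations over rounds are nonnegative
  extended integrals, inequalities are kept free of subtraction, the potential is shifted so as to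
  be nonnegative, and unbiasedness is used after multiplication by the selection
  probability.\<close>

lemma measurable_if_coords:
  fixes D :: "'a measure"
  shows "(\<lambda>(w, v) k. if k \<in> J then v k else w k)
     \<in> measurable (PiM UNIV (\<lambda>_::'i. D) \<Otimes>\<^sub>M PiM UNIV (\<lambda>_::'i. D)) (PiM UNIV (\<lambda>_::'i. D))"
  unfolding case_prod_beta
proof (rule measurable_PiM_single')
  fix k :: 'i
  show "(\<lambda>x. if k \<in> J then snd x k else fst x k)
     \<in> measurable (PiM UNIV (\<lambda>_::'i. D) \<Otimes>\<^sub>M PiM UNIV (\<lambda>_::'i. D)) D"
    by (cases "k \<in> J") measurable
qed (auto simp: space_pair_measure space_PiM PiE_iff)

text \<open>Both laws agree on finite cylinders: the preimage of a cylinder over K is a rectangle,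
  constrained on K - J in the first copy and on K \<inter> J in the second. Expressing independence
  by overwriting coordinates avoids restricted product spaces.\<close>

lemma PiM_resample:
  fixes D :: "'a measure" and J :: "'i set"
  assumes D: "prob_space D"
  defines "P \<equiv> PiM UNIV (\<lambda>_::'i. D)"
  shows "distr (P \<Otimes>\<^sub>M P) P (\<lambda>(w, v) k. if k \<in> J then v k else w k) = P"
proof -
  interpret D: prob_space D by fact
  interpret P: product_prob_space "\<lambda>_. D" UNIV ..
  let ?g = "\<lambda>(w, v) k. if k \<in> J then v k else w k"
  have pP: "prob_space P" unfolding P_def by (rule prob_space_PiM) (rule D)
  interpret pP: prob_space P by (rule pP)
  have g: "?g \<in> measurable (P \<Otimes>\<^sub>M P) P"
    unfolding P_def by (rule measurable_if_coords)
  show ?thesis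
    unfolding P_def
  proof (rule P.PiM_eq, simp)
    fix K and F :: "'i \<Rightarrow> 'a set" assume K: "finite K" "K \<subseteq> UNIV" and F: "\<And>j. j \<in> K \<Longrightarrow> F j \<in> sets D"
    let ?E = "\<lambda>L. {x \<in> space P. \<forall>i\<in>L. x i \<in> F i}"
    have E: "emeasure P (?E L) = (\<Prod>i\<in>L. emeasure D (F i))" if "L \<subseteq> K" for L
      unfolding P_def using that K F by (subst P.emeasure_PiM_Collect) (auto intro: finite_subset)
    have Es: "?E L \<in> sets P" if "L \<subseteq> K" for L
    proof -
      have [measurable]: "finite L" "\<And>i. i \<in> L \<Longrightarrow> F i \<in> sets D"
        using that K F by (auto intro: finite_subset)
      show ?thesis unfolding P_def by measurable
    qed
    have emb: "prod_emb UNIV (\<lambda>_. D) K (Pi\<^sub>E K F) = ?E K"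
      unfolding P_def prod_emb_def by (auto simp: space_PiM PiE_iff)
    have "emeasure (distr (P \<Otimes>\<^sub>M P) P ?g) (?E K) = emeasure (P \<Otimes>\<^sub>M P) (?g -` ?E K \<inter> space (P \<Otimes>\<^sub>M P))"
      by (rule emeasure_distr[OF g Es]) simp
    also have "?g -` ?E K \<inter> space (P \<Otimes>\<^sub>M P) = ?E (K - J) \<times> ?E (K \<inter> J)"
      by (auto simp: space_pair_measure P_def space_PiM PiE_iff split: if_splits)
    also have "emeasure (P \<Otimes>\<^sub>M P) \<dots> = emeasure P (?E (K - J)) * emeasure P (?E (K \<inter> J))"
      by (rule pP.emeasure_pair_measure_Times) (auto intro!: Es)
    also have "\<dots> = (\<Prod>i\<in>K - J. emeasure D (F i)) * (\<Prod>i\<in>K \<inter> J. emeasure D (F i))"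
      by (subst (1 2) E) auto
    also have "\<dots> = (\<Prod>i\<in>K. emeasure D (F i))"
      using prod.Int_Diff[OF K(1), of "\<lambda>i. emeasure D (F i)" J] by (simp add: mult.commute)
    finally show "emeasure (distr (Pi\<^sub>M UNIV (\<lambda>_. D) \<Otimes>\<^sub>M Pi\<^sub>M UNIV (\<lambda>_. D)) (Pi\<^sub>M UNIV (\<lambda>_. D)) ?g)
       (prod_emb UNIV (\<lambda>_. D) K (Pi\<^sub>E K F)) = (\<Prod>j\<in>K. emeasure D (F j))"
      unfolding emb unfolding P_def .
  qed
qed

text \<open>This is the form in which independence is used: J is one perturbation vector or one
  whole round, and everything outside J stays frozen in the inner integral.\<close>

lemma nn_integral_resample:
  fixes D :: "'a measure" and J :: "'i set"
  assumes D: "prob_space D"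
  assumes f: "f \<in> borel_measurable (PiM UNIV (\<lambda>_::'i. D))"
  shows "(\<integral>\<^sup>+w. f w \<partial>PiM UNIV (\<lambda>_. D))
    = (\<integral>\<^sup>+w. (\<integral>\<^sup>+v. f (\<lambda>k. if k \<in> J then v k else w k) \<partial>PiM UNIV (\<lambda>_. D)) \<partial>PiM UNIV (\<lambda>_. D))"
proof -
  let ?P = "PiM UNIV (\<lambda>_::'i. D)" and ?g = "\<lambda>(w, v) k. if k \<in> J then v k else w k"
  interpret P: prob_space ?P by (rule prob_space_PiM) (rule D)
  have g: "?g \<in> measurable (?P \<Otimes>\<^sub>M ?P) ?P"
    by (rule measurable_if_coords)
  have "(\<integral>\<^sup>+w. f w \<partial>?P) = (\<integral>\<^sup>+w. f w \<partial>distr (?P \<Otimes>\<^sub>M ?P) ?P ?g)"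
    by (subst PiM_resample[OF D]) simp
  also have "\<dots> = (\<integral>\<^sup>+z. f (?g z) \<partial>(?P \<Otimes>\<^sub>M ?P))"
    by (rule nn_integral_distr[OF g]) (simp add: f)
  also have "\<dots> = (\<integral>\<^sup>+w. (\<integral>\<^sup>+v. f (?g (w, v)) \<partial>?P) \<partial>?P)"
    using measurable_compose[OF g f] by (subst P.nn_integral_fst[symmetric]) (auto simp: comp_def)
  finally show ?thesis by (simp only: case_prod_conv)
qed

text \<open>Fubini for a single coordinate; the uniform bound C supplies integrability. It stands in
  for conditioning on the noise of all arms but i.\<close>

lemma
  fixes D :: "'a measure" and i :: 'i and f :: "('i \<Rightarrow> 'a) \<Rightarrow> real"
  assumes D: "prob_space D"
  defines "P \<equiv> PiM UNIV (\<lambda>_::'i. D)"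
  assumes f[measurable]: "f \<in> borel_measurable P" and b: "\<And>w. \<bar>f w\<bar> \<le> C"
  shows integral_resample1: "(\<integral>w. f w \<partial>P) = (\<integral>w. (\<integral>x. f (w(i := x)) \<partial>D) \<partial>P)"
    and integrable_resample1: "integrable P (\<lambda>w. \<integral>x. f (w(i := x)) \<partial>D)"
proof -
  interpret D: prob_space D by fact
  interpret P: prob_space P unfolding P_def by (rule prob_space_PiM) (rule D)
  interpret DP: pair_prob_space D P ..
  have g[measurable]: "(\<lambda>(x, w). w(i := x)) \<in> measurable (D \<Otimes>\<^sub>M P) P"
    unfolding P_def case_prod_beta
    by (rule measurable_PiM_single')
       (auto simp: space_pair_measure space_PiM PiE_iff fun_upd_def)
  have eq: "distr (D \<Otimes>\<^sub>M P) P (\<lambda>(x, w). w(i := x)) = P"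
    using distr_pair_PiM_eq_PiM[of UNIV "\<lambda>_. D" i] D by (simp add: P_def)
  have g2[measurable]: "(\<lambda>z. (snd z)(i := fst z)) \<in> measurable (D \<Otimes>\<^sub>M P) P"
    using g by (simp add: case_prod_beta)
  have fg[measurable]: "(\<lambda>z. f ((snd z)(i := fst z))) \<in> borel_measurable (D \<Otimes>\<^sub>M P)"
    by measurable
  have int: "integrable (D \<Otimes>\<^sub>M P) (\<lambda>z. f ((snd z)(i := fst z)))"
    by (rule DP.P.integrable_const_bound[where B = C]) (auto simp: b)
  have "(\<integral>w. f w \<partial>P) = (\<integral>w. f w \<partial>distr (D \<Otimes>\<^sub>M P) P (\<lambda>(x, w). w(i := x)))"
    by (simp add: eq)
  also have "\<dots> = (\<integral>z. f ((snd z)(i := fst z)) \<partial>(D \<Otimes>\<^sub>M P))"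
    by (subst integral_distr) (auto simp: case_prod_beta g2)
  also have "\<dots> = (\<integral>w. (\<integral>x. f (w(i := x)) \<partial>D) \<partial>P)"
    using DP.integral_snd[of "\<lambda>x w. f (w(i := x))"] int by (simp add: case_prod_beta')
  finally show "(\<integral>w. f w \<partial>P) = (\<integral>w. (\<integral>x. f (w(i := x)) \<partial>D) \<partial>P)" .
  show "integrable P (\<lambda>w. \<integral>x. f (w(i := x)) \<partial>D)"
    using DP.integrable_snd[of "\<lambda>x w. f (w(i := x))"] int by (simp add: case_prod_beta')
qed

lemma integral_PiM_component:
  fixes f :: "'a \<Rightarrow> real" and D :: "'a measure" and k :: 'i
  assumes "prob_space D" "f \<in> borel_measurable D"
  shows "(\<integral>w. f (w k) \<partial>PiM UNIV (\<lambda>_. D)) = (\<integral>x. f x \<partial>D)"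
    and "integrable D f \<Longrightarrow> integrable (PiM UNIV (\<lambda>_. D)) (\<lambda>w. f (w k))"
proof -
  show "(\<integral>w. f (w k) \<partial>PiM UNIV (\<lambda>_. D)) = (\<integral>x. f x \<partial>D)"
    using assms
    by (subst distr_PiM_component[of UNIV "\<lambda>_. D" k, symmetric]) (auto simp: integral_distr)
  have "integrable (distr (PiM UNIV (\<lambda>_. D)) D (\<lambda>w. w k)) f \<Longrightarrow> integrable (PiM UNIV (\<lambda>_. D)) (\<lambda>w. f (w k))"
    by (rule integrable_distr[rotated]) auto
  then show "integrable D f \<Longrightarrow> integrable (PiM UNIV (\<lambda>_. D)) (\<lambda>w. f (w k))"
    using assms by (subst (asm) distr_PiM_component) auto
qed

lemma nn_integral_PiM_slice:
  fixes D :: "'a measure" and g :: "'j \<Rightarrow> 'i"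
  assumes D: "prob_space D" and g: "inj g"
    and f: "f \<in> borel_measurable (PiM UNIV (\<lambda>_. D))"
  shows "(\<integral>\<^sup>+w. f (\<lambda>j. w (g j)) \<partial>PiM UNIV (\<lambda>_. D)) = (\<integral>\<^sup>+r. f r \<partial>PiM UNIV (\<lambda>_. D))"
proof -
  have "distr (PiM UNIV (\<lambda>_. D)) (PiM UNIV (\<lambda>_. D)) (\<lambda>w j. w (g j)) = PiM UNIV (\<lambda>_. D)"
    using distr_PiM_reindex[of UNIV "\<lambda>_. D" g UNIV] D g by (simp add: restrict_def)
  moreover have "(\<lambda>w j. w (g j)) \<in> measurable (PiM UNIV (\<lambda>_. D)) (PiM UNIV (\<lambda>_. D))"
    by (rule measurable_PiM_single') (auto simp: space_PiM PiE_iff)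
  ultimately show ?thesis
    using f by (metis nn_integral_distr measurable_distr_eq1)
qed

section \<open>Perturbation distributions\<close>

text \<open>With the noise of the other arms fixed, the values that get an arm selected form such a
  set, so the distributional estimates are stated for these sets.\<close>

definition upset :: "real set \<Rightarrow> bool" where
  "upset I \<longleftrightarrow> (\<forall>x\<in>I. \<forall>y\<ge>x. y \<in> I)"

lemma upset_cases:
  assumes "upset I"
  obtains "I = {}" | "I = UNIV" | c where "I = {c..}" | c where "I = {c<..}"
proof (cases "I = {} \<or> I = UNIV")
  case True
  then show ?thesis using that by auto
next
  case False
  then obtain a b where a: "a \<in> I" and b: "b \<notin> I" by auto
  have lb: "b \<le> x" if "x \<in> I" for x
    using assms that b unfolding upset_def by (meson linear)
  have bdd: "bdd_below I" using lb by (auto simp: bdd_below_def)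
  define c where "c = Inf I"
  have gt: "x \<in> I" if "c < x" for x
    using that assms cInf_less_iff[OF _ bdd, of x] a unfolding c_def upset_def
    by (metis empty_iff less_imp_le)
  have ge: "c \<le> x" if "x \<in> I" for x
    unfolding c_def using that bdd by (rule cInf_lower)
  show ?thesis
  proof (cases "c \<in> I")
    case True
    then have "I = {c..}" using gt ge by (auto simp: order.order_iff_strict)
    then show ?thesis using that by blast
  next
    case False
    then have "I = {c<..}" using gt ge by (auto simp: order.order_iff_strict)
    then show ?thesis using that by blast
  qed
qed

lemma upset_borel: "upset I \<Longrightarrow> I \<in> sets borel"
  by (erule upset_cases) auto

text \<open>\<open>hazard\<close> serves stability, \<open>heavy\<close> the penalty and
  \<open>odds\<close> the exchange of two arms. \<open>odds\<close> is the monotonicity of f / (F (1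
  - F)) with denominators cleared, so that it makes sense where F is 0 or 1.\<close>

locale perturbation =
  fixes \<alpha> :: real and f :: "real \<Rightarrow> real" and D :: "real measure" and tail :: "real \<Rightarrow> real"
  assumes alpha: "1 < \<alpha>"
    and f_borel[measurable]: "f \<in> borel_measurable borel"
    and f_nonneg: "0 \<le> f x"
    and D_eq: "D = density lborel (\<lambda>x. ennreal (f x))"
    and prob_D: "prob_space D"
    and tail_eq: "tail x = measure D {x..}"
    and hazard: "f x \<le> \<alpha> * tail x powr (1 + 1/\<alpha>)"
    and heavy: "f x \<le> (if 0 < x then \<alpha> * x powr (-(\<alpha> + 1)) else 0)"
    and odds: "0 \<le> \<delta> \<Longrightarrow> f x * (tail (x - \<delta>) * (1 - tail (x - \<delta>))) \<le> f (x - \<delta>) * (tail x * (1 - tail x))"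
begin

sublocale D: prob_space D by (rule prob_D)

lemma sets_D[simp, measurable_cong]: "sets D = sets borel"
  by (simp add: D_eq)

lemma space_D[simp]: "space D = UNIV"
  by (simp add: D_eq)

lemma measure_D_singleton: "measure D {x} = 0"
proof -
  have "emeasure D {x} = 0"
    unfolding D_eq
    by (subst emeasure_density)
       (auto simp: nn_integral_0_iff_AE indicator_eq_0_iff intro: eventually_mono[OF AE_lborel_singleton[of x]])
  then show ?thesis by (simp add: measure_def)
qed

lemma tail_Ioi: "measure D {x<..} = tail x"
proof -
  have "{x..} = {x<..} \<union> {x}" by auto
  then have "measure D {x..} = measure D {x<..} + measure D {x}"
    by (simp del: Un_insert_right) (subst D.finite_measure_Union, auto)
  then show ?thesis by (simp add: tail_eq measure_D_singleton)
qed

lemma tail_nonneg: "0 \<le> tail x" and tail_le_1: "tail x \<le> 1"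
  by (simp_all add: tail_eq)

lemma tail_antimono: "x \<le> y \<Longrightarrow> tail y \<le> tail x"
  unfolding tail_eq by (intro D.finite_measure_mono) auto

lemma tail_borel[measurable]: "tail \<in> borel_measurable borel"
proof -
  have "(\<lambda>x. - tail x) \<in> borel_measurable borel"
    by (rule borel_measurable_mono) (auto intro!: monoI tail_antimono)
  then show ?thesis by simp
qed

text \<open>Shifting a half-line with end point c by h loses the mass of [c, c + h). There the
  density is at most \<open>\<alpha> * tail c powr (1 + 1/\<alpha>)\<close>, as \<open>tail\<close>
  decreases, and \<open>tail c\<close> is the mass of the half-line whether or not it contains
  c.\<close>

lemma measure_upset_shift:
  assumes I: "upset I" and h: "0 \<le> h"
  shows "measure D I - measure D {x. x - h \<in> I} \<le> \<alpha> * h * measure D I powr (1 + 1/\<alpha>)"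
proof -
  have Ico: "measure D {c..<c + h} \<le> \<alpha> * h * tail c powr (1 + 1/\<alpha>)" for c
  proof -
    have "emeasure D {c..<c + h} = (\<integral>\<^sup>+x. ennreal (f x) * indicator {c..<c + h} x \<partial>lborel)"
      unfolding D_eq by (rule emeasure_density) auto
    also have "\<dots> \<le> (\<integral>\<^sup>+x. ennreal (\<alpha> * tail c powr (1 + 1/\<alpha>)) * indicator {c..<c + h} x \<partial>lborel)"
    proof (rule nn_integral_mono)
      fix x
      show "ennreal (f x) * indicator {c..<c + h} x
          \<le> ennreal (\<alpha> * tail c powr (1 + 1/\<alpha>)) * indicator {c..<c + h} x"
      proof (cases "c \<le> x")
        case True
        have "f x \<le> \<alpha> * tail x powr (1 + 1/\<alpha>)" by (rule hazard)
        also have "\<dots> \<le> \<alpha> * tail c powr (1 + 1/\<alpha>)"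
          using alpha True by (intro mult_left_mono powr_mono2 tail_antimono) (auto simp: tail_nonneg)
        finally show ?thesis by (intro mult_right_mono ennreal_leI) auto
      qed auto
    qed
    also have "\<dots> = ennreal (\<alpha> * tail c powr (1 + 1/\<alpha>)) * ennreal h"
      using h by (simp add: nn_integral_cmult_indicator)
    also have "\<dots> = ennreal (\<alpha> * h * tail c powr (1 + 1/\<alpha>))"
      using h alpha by (simp add: ennreal_mult[symmetric] mult_ac)
    finally show ?thesis
      using h alpha unfolding D.emeasure_eq_measure by (subst (asm) ennreal_le_iff) auto
  qed
  from I show ?thesis
  proof (cases rule: upset_cases)
    case (3 c)
    have "{c..} = {c..<c + h} \<union> {c + h..}" using h by auto
    then have "measure D {c..} = measure D {c..<c + h} + measure D {c + h..}"
      by (simp only:) (subst D.finite_measure_Union, auto)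
    moreover have "{x. x - h \<in> I} = {c + h..}" using 3 by auto
    ultimately show ?thesis using Ico[of c] 3 by (simp add: tail_eq)
  next
    case (4 c)
    have "{c..} = {c..<c + h} \<union> {c + h..}" using h by auto
    then have "measure D {c..} = measure D {c..<c + h} + measure D {c + h..}"
      by (simp only:) (subst D.finite_measure_Union, auto)
    moreover have "{x. x - h \<in> I} = {c + h<..}" using 4 by auto
    ultimately show ?thesis using Ico[of c] 4 by (simp add: tail_Ioi tail_eq[symmetric])
  qed (use h alpha in auto)
qed

text \<open>For x in I the whole ray above x lies in I, so the integral is the probability that two
  independent draws both lie in I and come in a prescribed order. By symmetry and absence of atoms
  this is half of the squared mass.\<close>

lemma integral_tail_upset:
  assumes I: "upset I"
  shows "(\<integral>x. tail x * indicator I x \<partial>D) = (measure D I)\<^sup>2 / 2"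
proof -
  interpret DD: pair_prob_space D D ..
  have [measurable]: "I \<in> sets borel" by (rule upset_borel[OF I])
  define g :: "real \<Rightarrow> real \<Rightarrow> real" where
    "g x y = indicator I x * indicator I y * indicator {p. fst p \<le> snd p} (x, y)" for x y
  have gm[measurable]: "(\<lambda>(x, y). g x y) \<in> borel_measurable (D \<Otimes>\<^sub>M D)"
    unfolding g_def by measurable
  have gi: "integrable (D \<Otimes>\<^sub>M D) (\<lambda>(x, y). g x y)"
    by (rule DD.P.integrable_const_bound[where B = 1]) (auto simp: g_def indicator_def)
  have gy: "(\<lambda>y. g x y) \<in> borel_measurable D" "(\<lambda>y. g y x) \<in> borel_measurable D" for x
    unfolding g_def by measurable
  have gyi: "integrable D (\<lambda>y. g x y)" "integrable D (\<lambda>y. g y x)" for x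
    by (rule D.integrable_const_bound[where B = 1], auto simp: g_def indicator_def gy[unfolded g_def])+
  have inner: "(\<integral>y. g x y \<partial>D) = tail x * indicator I x" for x
  proof -
    have "g x y = indicator I x * indicator {x..} y" for y
      using I by (auto simp: g_def upset_def indicator_def)
    then show ?thesis by (simp add: tail_eq)
  qed
  have sum: "(\<integral>y. g x y \<partial>D) + (\<integral>y. g y x \<partial>D) = indicator I x * measure D I" for x
  proof -
    have "(\<integral>y. g x y \<partial>D) + (\<integral>y. g y x \<partial>D) = (\<integral>y. g x y + g y x \<partial>D)"
      by (rule Bochner_Integration.integral_add[symmetric]) (rule gyi)+
    also have "\<dots> = (\<integral>y. indicator I x * indicator I y + indicator I x * indicator {x} y \<partial>D)"
      by (rule Bochner_Integration.integral_cong) (auto simp: g_def indicator_def)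
    also have "\<dots> = indicator I x * measure D I"
      by (subst Bochner_Integration.integral_add) (auto simp: measure_D_singleton D.emeasure_eq_measure)
    finally show ?thesis .
  qed
  have swap: "(\<integral>x. (\<integral>y. g x y \<partial>D) \<partial>D) = (\<integral>x. (\<integral>y. g y x \<partial>D) \<partial>D)"
    using DD.Fubini_integral[OF gi] by simp
  have i1: "integrable D (\<lambda>x. \<integral>y. g x y \<partial>D)" "integrable D (\<lambda>x. \<integral>y. g y x \<partial>D)"
    using DD.integrable_fst[OF gi] DD.integrable_snd[OF gi] by simp_all
  have "2 * (\<integral>x. (\<integral>y. g x y \<partial>D) \<partial>D) = (\<integral>x. indicator I x * measure D I \<partial>D)"
    using Bochner_Integration.integral_add[OF i1] swap by (simp add: sum)
  also have "\<dots> = measure D I * measure D I"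
    by simp
  finally show ?thesis by (simp add: inner power2_eq_square)
qed

text \<open>Write q for \<open>tail * (1 - tail)\<close>. Against Lebesgue measure the left
  integrand is f(x) W(x) q(x - \<delta>); translating the right one by \<delta> gives f(x -
  \<delta>) W(x) q(x), and \<open>odds\<close> compares them pointwise.\<close>

lemma integral_odds_shift:
  assumes [measurable]: "W \<in> borel_measurable borel" and W: "\<And>x. 0 \<le> W x" "\<And>x. W x \<le> 1" and \<delta>: "0 \<le> \<delta>"
  shows "(\<integral>x. W x * (tail (x - \<delta>) * (1 - tail (x - \<delta>))) \<partial>D)
    \<le> (\<integral>x. W (x + \<delta>) * (tail (x + \<delta>) * (1 - tail (x + \<delta>))) \<partial>D)"
proof -
  define G1 where "G1 x = W x * (tail (x - \<delta>) * (1 - tail (x - \<delta>)))" for x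
  define G2 where "G2 x = W (x + \<delta>) * (tail (x + \<delta>) * (1 - tail (x + \<delta>)))" for x
  have [measurable]: "G1 \<in> borel_measurable borel" "G2 \<in> borel_measurable borel"
    unfolding G1_def G2_def by measurable
  have bd: "0 \<le> W x * (tail y * (1 - tail y))" "W x * (tail y * (1 - tail y)) \<le> 1" for x y
    using W[of x] tail_nonneg[of y] tail_le_1[of y] by (auto intro!: mult_le_one)
  have int: "integrable D G1" "integrable D G2"
    by (rule D.integrable_const_bound[where B = 1]; use bd in \<open>auto simp: G1_def G2_def abs_le_iff intro: order_trans[of _ 0]\<close>)+
  have i1: "integrable lborel (\<lambda>x. f x * G1 x)" and i2: "integrable lborel (\<lambda>x. f x * G2 x)"
    using int integrable_density[of G1 lborel f] integrable_density[of G2 lborel f]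
    by (simp_all add: D_eq[symmetric] f_nonneg)
  have e1: "(\<integral>x. G1 x \<partial>D) = (\<integral>x. f x * G1 x \<partial>lborel)" and e2: "(\<integral>x. G2 x \<partial>D) = (\<integral>x. f x * G2 x \<partial>lborel)"
    using integral_density[of G1 lborel f] integral_density[of G2 lborel f]
    by (simp_all add: D_eq[symmetric] f_nonneg)
  have e3: "(\<integral>x. f x * G2 x \<partial>lborel) = (\<integral>x. f (x - \<delta>) * G2 (x - \<delta>) \<partial>lborel)"
    using lborel_integral_real_affine[of 1 "\<lambda>x. f x * G2 x" "-\<delta>"] by (simp add: algebra_simps)
  have i3: "integrable lborel (\<lambda>x. f (x - \<delta>) * G2 (x - \<delta>))"
    using lborel_integrable_real_affine[OF i2, of 1 "-\<delta>"] by (simp add: algebra_simps)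
  have "(\<integral>x. f x * G1 x \<partial>lborel) \<le> (\<integral>x. f (x - \<delta>) * G2 (x - \<delta>) \<partial>lborel)"
    using mult_left_mono[OF odds[OF \<delta>] W(1)]
    by (intro integral_mono i1 i3) (auto simp: G1_def G2_def mult_ac)
  then show ?thesis using e1 e2 e3 by (simp add: G1_def G2_def)
qed

section \<open>Excess of the noise over a threshold\<close>

lemma nn_integral_excess:
  assumes c: "0 < c"
  shows "(\<integral>\<^sup>+x. ennreal (max 0 (x - c)) \<partial>D) \<le> ennreal (c powr (1 - \<alpha>) / (\<alpha> - 1))"
proof -
  define g where "g x = \<alpha> * x powr (-(\<alpha> + 1)) * (x - c)" for x
  \<comment> \<open>An antiderivative of g that vanishes at infinity because 1 < \<alpha>; its value
    at c is \<open>- (c powr (1 - \<alpha>) / (\<alpha> - 1))\<close>.\<close>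
  define G where "G x = - (\<alpha> / (\<alpha> - 1)) * x powr (1 - \<alpha>) + c * x powr (-\<alpha>)" for x
  have "(\<integral>\<^sup>+x. ennreal (max 0 (x - c)) \<partial>D) = (\<integral>\<^sup>+x. ennreal (f x) * ennreal (max 0 (x - c)) \<partial>lborel)"
    unfolding D_eq by (rule nn_integral_density) auto
  also have "\<dots> \<le> (\<integral>\<^sup>+x. ennreal (g x) * indicator {c..} x \<partial>lborel)"
  proof (rule nn_integral_mono)
    fix x
    show "ennreal (f x) * ennreal (max 0 (x - c)) \<le> ennreal (g x) * indicator {c..} x"
    proof (cases "c \<le> x")
      case True
      then have "f x * max 0 (x - c) \<le> g x"
        using c alpha heavy[of x] unfolding g_def by (intro mult_mono) auto
      then show ?thesis using True by (simp add: ennreal_mult[symmetric] f_nonneg ennreal_leI)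
    qed (auto simp: max_def)
  qed
  also have "\<dots> = ennreal (0 - G c)"
  proof (rule nn_integral_FTC_atLeast)
    show "g \<in> borel_measurable borel" unfolding g_def by measurable
    show "DERIV G x :> g x" if "c \<le> x" for x
    proof -
      have x: "0 < x" using that c by simp
      have "DERIV G x :> - (\<alpha> / (\<alpha> - 1)) * ((1 - \<alpha>) * x powr (1 - \<alpha> - 1)) + c * (-\<alpha> * x powr (-\<alpha> - 1))"
        unfolding G_def by (rule derivative_eq_intros refl | use x in simp)+
      moreover have "- (\<alpha> / (\<alpha> - 1)) * ((1 - \<alpha>) * x powr (1 - \<alpha> - 1)) + c * (-\<alpha> * x powr (-\<alpha> - 1)) = g x"
      proof -
        have p: "x powr (1 - \<alpha> - 1) = x * x powr (-(\<alpha> + 1))"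
          using x by (simp add: powr_mult_base)
        have "- (\<alpha> / (\<alpha> - 1)) * (1 - \<alpha>) = \<alpha>" using alpha by (simp add: field_simps)
        then have e1: "- (\<alpha> / (\<alpha> - 1)) * ((1 - \<alpha>) * x powr (1 - \<alpha> - 1)) = \<alpha> * x powr (1 - \<alpha> - 1)"
          by (metis mult.assoc)
        have e2: "x powr (-\<alpha> - 1) = x powr (-(\<alpha> + 1))"
          by (rule arg_cong[where f = "(powr) x"]) simp
        show ?thesis
          unfolding g_def e1 unfolding e2 p by (simp only: right_diff_distrib mult_minus_left mult_minus_right mult.assoc) simp
      qed
      ultimately show ?thesis by simp
    qed
    show "0 \<le> g x" if "c \<le> x" for x
      using that alpha c by (simp add: g_def)
    have "((\<lambda>x. - (\<alpha> / (\<alpha> - 1)) * x powr (1 - \<alpha>) + c * x powr (-\<alpha>))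
        \<longlongrightarrow> - (\<alpha> / (\<alpha> - 1)) * 0 + c * 0) at_top"
      using alpha
      by (intro tendsto_add tendsto_mult tendsto_const tendsto_neg_powr filterlim_ident) auto
    then show "(G \<longlongrightarrow> 0) at_top"
      by (simp add: G_def[abs_def])
  qed
  also have "0 - G c = c powr (1 - \<alpha>) / (\<alpha> - 1)"
  proof -
    have "c * c powr (-\<alpha>) = c powr (1 - \<alpha>)" using c by (simp add: powr_mult_base)
    then show ?thesis using alpha by (simp add: G_def field_simps)
  qed
  finally show ?thesis .
qed

lemma AE_pos: "AE x in D. 0 < x"
proof -
  have "f x = 0" if "x \<le> 0" for x using heavy[of x] f_nonneg[of x] that by simp
  then show ?thesis
    unfolding D_eq by (subst AE_density, simp) (rule AE_I2, metis ennreal_0 less_irrefl not_le)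
qed

lemma integrable_id: "integrable D (\<lambda>x. x)"
proof -
  have "(\<integral>\<^sup>+x. ennreal (norm x) \<partial>D) \<le> (\<integral>\<^sup>+x. 1 + ennreal (max 0 (x - 1)) \<partial>D)"
  proof (intro nn_integral_mono_AE)
    show "AE x in D. ennreal (norm x) \<le> 1 + ennreal (max 0 (x - 1))"
      using AE_pos
    proof eventually_elim
      case (elim x)
      then show ?case
        by (cases "x \<le> 1") (auto simp flip: ennreal_1 ennreal_plus intro!: ennreal_leI simp del: ennreal_1)
    qed
  qed
  also have "\<dots> = 1 + (\<integral>\<^sup>+x. ennreal (max 0 (x - 1)) \<partial>D)"
    by (subst nn_integral_add) (auto simp: D.emeasure_space_1[simplified])
  also have "\<dots> < \<infinity>"
    using nn_integral_excess[of 1] by (simp add: ennreal_add_less_top) (meson ennreal_less_top le_less_trans)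
  finally show ?thesis by (intro integrableI_bounded) auto
qed

lemma integral_excess:
  assumes "0 < c"
  shows "integrable D (\<lambda>x. max 0 (x - c))" "(\<integral>x. max 0 (x - c) \<partial>D) \<le> c powr (1 - \<alpha>) / (\<alpha> - 1)"
proof -
  show i: "integrable D (\<lambda>x. max 0 (x - c))"
    using integrable_id by (intro integrable_max) auto
  have "ennreal (\<integral>x. max 0 (x - c) \<partial>D) = (\<integral>\<^sup>+x. ennreal (max 0 (x - c)) \<partial>D)"
    by (rule nn_integral_eq_integral[symmetric]) (use i in auto)
  then have "ennreal (\<integral>x. max 0 (x - c) \<partial>D) \<le> ennreal (c powr (1 - \<alpha>) / (\<alpha> - 1))"
    using nn_integral_excess[OF assms] by simp
  then show "(\<integral>x. max 0 (x - c) \<partial>D) \<le> c powr (1 - \<alpha>) / (\<alpha> - 1)"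
    using alpha by (subst (asm) ennreal_le_iff) auto
qed

end

section \<open>The leader\<close>

text \<open>\<open>r k - \<theta> k\<close> is the score of arm k. With z the score of i and A the
  other arms, this counts the arms that strictly beat i.\<close>

definition above :: "(nat \<Rightarrow> real) \<Rightarrow> nat set \<Rightarrow> (nat \<Rightarrow> real) \<Rightarrow> real \<Rightarrow> nat" where
  "above \<theta> A r z = card {k \<in> A. z < r k - \<theta> k}"

lemma above_antimono: "finite A \<Longrightarrow> z \<le> z' \<Longrightarrow> above \<theta> A r z' \<le> above \<theta> A r z"
  unfolding above_def by (intro card_mono) auto

lemma above_cong: "(\<And>k. k \<in> A \<Longrightarrow> r k = r' k) \<Longrightarrow> above \<theta> A r z = above \<theta> A r' z"
  unfolding above_def by (intro arg_cong[where f = card]) auto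

lemma above_remove:
  assumes "finite A" "j \<in> A"
  shows "above \<theta> A r z = (if z < r j - \<theta> j then 1 else 0) + above \<theta> (A - {j}) r z"
proof -
  have "{k \<in> A. z < r k - \<theta> k} = (if z < r j - \<theta> j then {j} else {}) \<union> {k \<in> A - {j}. z < r k - \<theta> k}"
    using assms by auto
  then show ?thesis
    using assms unfolding above_def by (simp del: Un_insert_left) (subst card_Un_disjoint, auto)
qed

lemma measurable_above[measurable (raw)]:
  assumes "finite A" and [measurable]: "\<And>i. (\<lambda>x. r x i) \<in> borel_measurable M" "z \<in> borel_measurable M"
  shows "(\<lambda>x. above \<theta> A (r x) (z x)) \<in> measurable M (count_space UNIV)"
  unfolding above_def
proof (rule measurable_card)
  fix i
  show "{x \<in> space M. i \<in> {k \<in> A. z x < r x k - \<theta> k}} \<in> sets M"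
    by (cases "i \<in> A") simp_all
qed

lemma finite_actions: "finite (actions d m)"
  by (rule finite_subset[of _ "Pow {..<d}"]) (auto simp: actions_def)

lemma actions_nonempty: "m \<le> d \<Longrightarrow> actions d m \<noteq> {}"
  by (rule ex_in_conv[THEN iffD1], rule exI[of _ "{..<m}"]) (auto simp: actions_def)

lemma actionsD: "a \<in> actions d m \<Longrightarrow> a \<subseteq> {..<d}" "a \<in> actions d m \<Longrightarrow> card a = m"
    "a \<in> actions d m \<Longrightarrow> finite a"
  by (auto simp: actions_def intro: finite_subset)

lemma ftpl_action_in: "m \<le> d \<Longrightarrow> ftpl_action d m \<eta> L r \<in> actions d m"
  unfolding ftpl_action_def
  by (rule arg_min_if_finite) (simp_all add: finite_actions actions_nonempty)

lemma ftpl_action_le: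
  assumes "m \<le> d" "a \<in> actions d m"
  shows "(\<Sum>i\<in>ftpl_action d m \<eta> L r. \<eta> * L i - r i) \<le> (\<Sum>i\<in>a. \<eta> * L i - r i)"
  unfolding ftpl_action_def
  by (rule arg_min_least[of "actions d m" a "\<lambda>a. \<Sum>i\<in>a. \<eta> * L i - r i"])
     (use assms in \<open>simp_all add: finite_actions actions_nonempty\<close>)

text \<open>The tie-breaking choice depends only on which actions attain the minimum, hence on
  finitely many comparisons.\<close>
lemma measurable_ftpl_action:
  assumes m: "m \<le> d" and [measurable]: "\<And>i. (\<lambda>x. r x i) \<in> borel_measurable M"
  shows "(\<lambda>x. ftpl_action d m \<eta> L (r x)) \<in> measurable M (count_space (actions d m))"
proof -
  define F where "F x a = (\<Sum>i\<in>a. \<eta> * L i - r x i)" for x a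
  have [measurable]: "(\<lambda>x. F x a) \<in> borel_measurable M" for a
    unfolding F_def by measurable
  define Z where "Z x = {a \<in> actions d m. \<forall>b\<in>actions d m. \<not> F x b < F x a}" for x
  have eq: "ftpl_action d m \<eta> L (r x) = (SOME a. a \<in> Z x)" for x
    unfolding ftpl_action_def arg_min_on_def arg_min_def is_arg_min_def Z_def F_def by (simp add: Ball_def)
  have fin: "finite (actions d m)" by (rule finite_actions)
  have "Z \<in> measurable M (count_space (Pow (actions d m)))"
  proof (subst measurable_count_space_eq2, simp add: fin, intro conjI ballI)
    show "Z \<in> space M \<rightarrow> Pow (actions d m)" unfolding Z_def by auto
    fix A assume A: "A \<in> Pow (actions d m)"
    have "Z -` {A} \<inter> space M = {x \<in> space M. \<forall>a\<in>actions d m. (a \<in> A) = (\<forall>b\<in>actions d m. \<not> F x b < F x a)}"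
      using A unfolding Z_def by auto
    also have "\<dots> \<in> sets M"
      using fin by measurable
    finally show "Z -` {A} \<inter> space M \<in> sets M" .
  qed
  then have "(\<lambda>x. SOME a. a \<in> Z x) \<in> measurable M (count_space UNIV)"
    by (rule measurable_compose) simp
  then have "(\<lambda>x. ftpl_action d m \<eta> L (r x)) \<in> measurable M (count_space UNIV)"
    by (simp add: eq)
  then show ?thesis
    using ftpl_action_in[OF m]
    by (subst measurable_count_space_eq2[OF fin]) (auto intro: measurable_sets)
qed

text \<open>Replacing i by k in the leader is again an action, and it cannot be cheaper.\<close>

lemma ftpl_action_exchange:
  assumes m: "m \<le> d" and i: "i \<in> ftpl_action d m \<eta> L r" and k: "k < d" "k \<notin> ftpl_action d m \<eta> L r"
  shows "r k - \<eta> * L k \<le> r i - \<eta> * L i"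
proof -
  let ?a = "ftpl_action d m \<eta> L r"
  note a = ftpl_action_in[OF m, of \<eta> L r]
  have fin: "finite ?a" using actionsD(3)[OF a] .
  have "insert k (?a - {i}) \<in> actions d m"
    using actionsD[OF a] i k card_Suc_Diff1[OF fin i] by (auto simp: actions_def card_insert_if)
  from ftpl_action_le[OF m this, of \<eta> L r]
  have "(\<Sum>i\<in>?a. \<eta> * L i - r i) \<le> (\<eta> * L k - r k) + (\<Sum>i\<in>?a - {i}. \<eta> * L i - r i)"
    using fin k by simp
  then show ?thesis
    using sum.remove[OF fin i, of "\<lambda>i. \<eta> * L i - r i"] by simp
qed

text \<open>By exchange, arms that beat a selected arm are selected too, and there are at most m - 1
  of them. Conversely, if i is left out then, by exchange and absence of ties, all m selected arms
  beat it.\<close>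

lemma ftpl_action_iff:
  assumes m: "m \<le> d" and i: "i < d"
    and ties: "\<And>k. k < d \<Longrightarrow> k \<noteq> i \<Longrightarrow> r k - \<eta> * L k \<noteq> r i - \<eta> * L i"
  shows "i \<in> ftpl_action d m \<eta> L r \<longleftrightarrow> above (\<lambda>i. \<eta> * L i) ({..<d} - {i}) r (r i - \<eta> * L i) < m"
proof -
  let ?a = "ftpl_action d m \<eta> L r"
  let ?S = "{k \<in> {..<d} - {i}. r i - \<eta> * L i < r k - \<eta> * L k}"
  note a = ftpl_action_in[OF m, of \<eta> L r]
  show ?thesis
  proof
    assume ia: "i \<in> ?a"
    have "?S \<subseteq> ?a - {i}"
    proof
      fix k assume "k \<in> ?S"
      then show "k \<in> ?a - {i}"
        using ftpl_action_exchange[OF m ia, of k] by force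
    qed
    then have "card ?S \<le> card (?a - {i})"
      using actionsD(3)[OF a] by (intro card_mono) auto
    also have "\<dots> < m"
      using actionsD[OF a] ia by (metis card_Diff1_less)
    finally show "above (\<lambda>i. \<eta> * L i) ({..<d} - {i}) r (r i - \<eta> * L i) < m"
      unfolding above_def .
  next
    assume "above (\<lambda>i. \<eta> * L i) ({..<d} - {i}) r (r i - \<eta> * L i) < m"
    then have less: "card ?S < m" unfolding above_def .
    show "i \<in> ?a"
    proof (rule ccontr)
      assume ia: "i \<notin> ?a"
      have "?a \<subseteq> ?S"
      proof
        fix k assume k: "k \<in> ?a"
        then have "k < d" "k \<noteq> i" using actionsD(1)[OF a] ia by auto
        then show "k \<in> ?S"
          using ftpl_action_exchange[OF m k i ia] ties[of k] by force
      qed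
      then have "card ?a \<le> card ?S" by (intro card_mono) auto
      then show False using less actionsD(2)[OF a] by simp
    qed
  qed
qed

section \<open>Selection probabilities\<close>

text \<open>The value \<open>r i\<close> is not consulted, so this is the section of the selection
  event over coordinate i. Its measure is the conditional probability of selection given the other
  coordinates.\<close>

definition sel :: "nat \<Rightarrow> nat \<Rightarrow> (nat \<Rightarrow> real) \<Rightarrow> nat \<Rightarrow> (nat \<Rightarrow> real) \<Rightarrow> real set" where
  "sel d m \<theta> i r = {x. above \<theta> ({..<d} - {i}) r (x - \<theta> i) < m}"

lemma upset_sel: "upset (sel d m \<theta> i r)"
  unfolding upset_def sel_def
proof clarify
  fix x y assume "above \<theta> ({..<d} - {i}) r (x - \<theta> i) < m" "x \<le> y"
  then show "above \<theta> ({..<d} - {i}) r (y - \<theta> i) < m"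
    using above_antimono[of "{..<d} - {i}" "x - \<theta> i" "y - \<theta> i" \<theta> r] by simp
qed

lemma sel_fun_upd: "sel d m \<theta> i (r(i := x)) = sel d m \<theta> i r"
  unfolding sel_def by (intro Collect_cong arg_cong[where f = "\<lambda>n. n < m"] above_cong) auto

text \<open>Growing estimates lower the scores of the competitors, which can only help i; the one
  thing that hurts is the increment h of its own estimate, a shift by h.\<close>

lemma sel_shift:
  assumes le: "\<And>k. \<theta> k \<le> \<theta>' k" and eq: "\<theta>' i = \<theta> i + h"
  shows "{x. x - h \<in> sel d m \<theta> i r} \<subseteq> sel d m \<theta>' i r"
proof -
  have "above \<theta>' ({..<d} - {i}) r (x - \<theta>' i) \<le> above \<theta> ({..<d} - {i}) r (x - h - \<theta> i)" for x
    unfolding above_def eq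
    by (intro card_mono, simp) (use le in \<open>auto simp: algebra_simps intro: less_le_trans\<close>,
        smt (verit) le)
  then show ?thesis
    unfolding sel_def by (auto intro: le_less_trans)
qed

context perturbation
begin

abbreviation noise :: "(nat \<Rightarrow> real) measure" where
  "noise \<equiv> Pi\<^sub>M UNIV (\<lambda>_. D)"

sublocale noise: prob_space noise
  by (rule prob_space_PiM) (rule prob_D)

lemma measurable_noise_component[measurable]: "(\<lambda>r. r k) \<in> borel_measurable noise"
  using measurable_component_singleton[of k UNIV "\<lambda>_. D"] by (simp cong: measurable_cong_sets)

lemma integrable_noise_bounded:
  fixes g :: "(nat \<Rightarrow> real) \<Rightarrow> real"
  assumes "g \<in> borel_measurable noise" "\<And>r. \<bar>g r\<bar> \<le> C"
  shows "integrable noise g"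
  by (rule noise.integrable_const_bound[where B = C]) (use assms in auto)

lemma integrable_noise_unit:
  fixes g :: "(nat \<Rightarrow> real) \<Rightarrow> real"
  assumes "g \<in> borel_measurable noise" "\<And>r. 0 \<le> g r" "\<And>r. g r \<le> 1"
  shows "integrable noise g"
  by (rule integrable_noise_bounded[where C = 1]) (use assms in auto)

definition U :: "nat \<Rightarrow> nat \<Rightarrow> (nat \<Rightarrow> real) \<Rightarrow> nat \<Rightarrow> (nat \<Rightarrow> real) \<Rightarrow> real" where
  "U d m \<theta> i r = measure D (sel d m \<theta> i r)"

lemma U_nonneg: "0 \<le> U d m \<theta> i r" and U_le_1: "U d m \<theta> i r \<le> 1"
  by (simp_all add: U_def)

lemma
  shows measurable_U[measurable]: "U d m \<theta> i \<in> borel_measurable noise"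
    and integral_sel: "(\<integral>r. of_bool (r i \<in> sel d m \<theta> i r) \<partial>noise) = (\<integral>r. U d m \<theta> i r \<partial>noise)"
    and measurable_sel: "(\<lambda>r. of_bool (r i \<in> sel d m \<theta> i r) :: real) \<in> borel_measurable noise"
proof -
  show m: "(\<lambda>r. of_bool (r i \<in> sel d m \<theta> i r) :: real) \<in> borel_measurable noise"
    unfolding sel_def mem_Collect_eq by measurable
  have eq: "(\<integral>x. of_bool ((r(i := x)) i \<in> sel d m \<theta> i (r(i := x))) \<partial>D) = U d m \<theta> i r" for r
  proof -
    have "(\<integral>x. of_bool ((r(i := x)) i \<in> sel d m \<theta> i (r(i := x))) \<partial>D)
        = (\<integral>x. indicator (sel d m \<theta> i r) x \<partial>D)"
      by (rule Bochner_Integration.integral_cong) (simp_all add: sel_fun_upd indicator_def)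
    also have "\<dots> = U d m \<theta> i r"
      using upset_borel[OF upset_sel] by (simp add: U_def)
    finally show ?thesis .
  qed
  show "U d m \<theta> i \<in> borel_measurable noise"
    using integrable_resample1[OF prob_D m, of 1 i, THEN borel_measurable_integrable] unfolding eq by simp
  show "(\<integral>r. of_bool (r i \<in> sel d m \<theta> i r) \<partial>noise) = (\<integral>r. U d m \<theta> i r \<partial>noise)"
    using integral_resample1[OF prob_D m, of 1 i] unfolding eq by simp
qed

text \<open>Integrating out \<open>r i\<close> first reduces this to
  \<open>integral_tail_upset\<close> on each section. The identity is why the second moment of U,
  rather than the power 1 + 1/\<alpha>, is the quantity that a count can control.\<close>

lemma integral_tail_sel:
  "(\<integral>r. tail (r i) * of_bool (r i \<in> sel d m \<theta> i r) \<partial>noise) = (\<integral>r. (U d m \<theta> i r)\<^sup>2 \<partial>noise) / 2"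
proof -
  note [measurable] = measurable_sel
  have "(\<integral>r. tail (r i) * of_bool (r i \<in> sel d m \<theta> i r) \<partial>noise)
     = (\<integral>r. (\<integral>x. tail ((r(i := x)) i) * of_bool ((r(i := x)) i \<in> sel d m \<theta> i (r(i := x))) \<partial>D) \<partial>noise)"
    by (rule integral_resample1[OF prob_D, where C = 1])
       (measurable, auto simp: tail_nonneg tail_le_1 abs_le_iff intro: order_trans[OF _ tail_nonneg])
  also have "\<dots> = (\<integral>r. (\<integral>x. tail x * indicator (sel d m \<theta> i r) x \<partial>D) \<partial>noise)"
    by (intro Bochner_Integration.integral_cong refl) (simp add: sel_fun_upd indicator_def)
  also have "\<dots> = (\<integral>r. (U d m \<theta> i r)\<^sup>2 / 2 \<partial>noise)"
    by (subst integral_tail_upset[OF upset_sel]) (simp add: U_def)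
  finally show ?thesis by simp
qed

text \<open>With all other coordinates fixed, a tie pins \<open>r i\<close> to one point, and D has
  no atoms.\<close>

lemma AE_no_ties: "AE r in noise. \<forall>i<d. \<forall>k<d. i \<noteq> k \<longrightarrow> r i - \<theta> i \<noteq> r k - \<theta> k"
proof -
  have pair: "AE r in noise. r i - \<theta> i \<noteq> r k - \<theta> k" if "i \<noteq> k" for i k
  proof -
    have [measurable]: "{r. r i - \<theta> i = r k - \<theta> k} \<in> sets noise"
    proof -
      have "{r \<in> space noise. r i - \<theta> i = r k - \<theta> k} \<in> sets noise" by measurable
      then show ?thesis by (simp add: space_PiM)
    qed
    have "measure noise {r. r i - \<theta> i = r k - \<theta> k} = (\<integral>r. indicator {r. r i - \<theta> i = r k - \<theta> k} r \<partial>noise)"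
      by simp
    also have "\<dots> = (\<integral>r. (\<integral>x. indicator {r. r i - \<theta> i = r k - \<theta> k} (r(i := x)) \<partial>D) \<partial>noise)"
    proof (rule integral_resample1[OF prob_D])
      show "indicator {r. r i - \<theta> i = r k - \<theta> k} \<in> borel_measurable noise"
        by (rule borel_measurable_indicator) fact
      show "\<bar>indicator {r. r i - \<theta> i = r k - \<theta> k} r\<bar> \<le> (1::real)" for r
        by (simp add: indicator_def)
    qed
    also have "(\<lambda>r. \<integral>x. indicator {r. r i - \<theta> i = r k - \<theta> k} (r(i := x)) \<partial>D) = (\<lambda>r. 0::real)"
    proof
      fix r :: "nat \<Rightarrow> real"
      have "(\<integral>x. indicator {r. r i - \<theta> i = r k - \<theta> k} (r(i := x)) \<partial>D)
          = (\<integral>x. indicator {r k - \<theta> k + \<theta> i} x \<partial>D :: real)"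
        using that by (intro Bochner_Integration.integral_cong refl) (auto simp: indicator_def)
      then show "(\<integral>x. indicator {r. r i - \<theta> i = r k - \<theta> k} (r(i := x)) \<partial>D) = (0::real)"
        by (simp add: measure_D_singleton)
    qed
    finally have "measure noise {r. r i - \<theta> i = r k - \<theta> k} = 0" by simp
    then show ?thesis
      by (intro AE_I[where N = "{r. r i - \<theta> i = r k - \<theta> k}"]) (auto simp: noise.emeasure_eq_measure)
  qed
  have "AE r in noise. \<forall>i\<in>{..<d}. \<forall>k\<in>{..<d}. i \<noteq> k \<longrightarrow> r i - \<theta> i \<noteq> r k - \<theta> k"
    by (intro AE_finite_allI finite_lessThan) (auto intro: pair)
  then show ?thesis by (rule eventually_mono) simp
qed

text \<open>Integrating out the noise of arm \<open>j\<close>: its membership in the top matters only if exactly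
  \<open>m - 1\<close> of the remaining arms beat arm \<open>i\<close>.\<close>
lemma integral_cov_above:
  assumes m: "1 \<le> m" and j: "j < d" "j \<noteq> i"
  shows "(\<integral>r. (tail (r i - (\<theta> i - \<theta> j)) - of_bool (r i - \<theta> i < r j - \<theta> j))
            * of_bool (r i \<in> sel d m \<theta> i r) \<partial>noise)
      = (\<integral>r. of_bool (above \<theta> ({..<d} - {i} - {j}) r (r i - \<theta> i) = m - 1)
            * (tail (r i - (\<theta> i - \<theta> j)) * (1 - tail (r i - (\<theta> i - \<theta> j)))) \<partial>noise)"
    (is "(\<integral>r. ?f r \<partial>noise) = (\<integral>r. ?g r \<partial>noise)")
proof -
  note [measurable] = measurable_sel
  have resample: "(\<integral>r. ?f r \<partial>noise) = (\<integral>r. (\<integral>y. ?f (r(j := y)) \<partial>D) \<partial>noise)"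
  proof (rule integral_resample1[OF prob_D, where C = 1])
    show "?f \<in> borel_measurable noise" by measurable
    show "\<bar>?f r\<bar> \<le> 1" for r
      using tail_nonneg[of "r i - (\<theta> i - \<theta> j)"] tail_le_1[of "r i - (\<theta> i - \<theta> j)"] by auto
  qed
  have inner: "(\<integral>y. ?f (r(j := y)) \<partial>D) = ?g r" for r
  proof -
    define z where "z = r i - \<theta> i"
    define p where "p = tail (r i - (\<theta> i - \<theta> j))"
    define J where "J = {r i - (\<theta> i - \<theta> j)<..}"
    define a where "a = above \<theta> ({..<d} - {i} - {j}) r z"
    have J: "measure D J = p" "J \<in> sets borel" unfolding J_def p_def by (simp_all add: tail_Ioi)
    have Ji: "integrable D (indicator J :: real \<Rightarrow> real)"
      using J(2) by (simp add: D.emeasure_eq_measure)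
    have ab: "above \<theta> ({..<d} - {i}) (r(j := y)) z = (if y \<in> J then 1 else 0) + a" for y
    proof -
      have "above \<theta> ({..<d} - {i} - {j}) (r(j := y)) z = a"
        unfolding a_def by (rule above_cong) auto
      then show ?thesis
        using j by (subst above_remove[where j = j]) (auto simp: J_def z_def algebra_simps)
    qed
    have f: "?f (r(j := y)) = (p - indicator J y) * of_bool ((if y \<in> J then 1 else 0) + a < m)" for y
      using j ab[of y] by (auto simp: sel_def z_def p_def J_def indicator_def algebra_simps)
    have pi: "(\<integral>y. p - indicator J y \<partial>D) = 0"
      using Ji J D.prob_space by (subst Bochner_Integration.integral_diff) auto
    \<comment> \<open>Here a counts the arms other than j that beat i. If a + 1 < m, arm i is
      selected whatever j does and the difference has mean zero; if a \<ge> m it is never selected.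
      If a + 1 = m it is selected iff j does not beat it, which leaves the value p on an event of
      probability 1 - p.\<close>
    consider "a + 1 < m" | "a + 1 = m" | "m \<le> a" using m by linarith
    then have "(\<integral>y. ?f (r(j := y)) \<partial>D) = of_bool (a = m - 1) * (p * (1 - p))"
    proof cases
      case 1
      then have "(\<lambda>y. ?f (r(j := y))) = (\<lambda>y. p - indicator J y)" unfolding f by (auto simp: fun_eq_iff)
      then show ?thesis using pi 1 by simp
    next
      case 2
      then have "(\<lambda>y. ?f (r(j := y))) = (\<lambda>y. p * (1 - indicator J y))"
        unfolding f by (auto simp: fun_eq_iff indicator_def)
      moreover have "(\<integral>y. p * (1 - indicator J y) \<partial>D) = p * (1 - p)"
        using Ji J D.prob_space by (subst integral_mult_right_zero, subst Bochner_Integration.integral_diff) auto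
      ultimately show ?thesis using 2 by auto
    next
      case 3
      then have "(\<lambda>y. ?f (r(j := y))) = (\<lambda>y. 0)" unfolding f by (auto simp: fun_eq_iff)
      then show ?thesis using 3 m by auto
    qed
    then show ?thesis unfolding a_def z_def p_def .
  qed
  show ?thesis
    by (rule trans[OF resample Bochner_Integration.integral_cong[OF refl inner]])
qed

text \<open>The event fixes a score z against the arms other than i and j, so z may be the score of
  either. Passing from i to j, by \<open>integral_odds_shift\<close> with shift \<theta> i -
  \<theta> j, removes \<open>r i\<close> from the integrand; U does not depend on \<open>r i\<close>
  either, which makes a pointwise comparison possible.\<close>

lemma integral_odds_sel:
  assumes A: "finite A" and ij: "i \<noteq> j" and le: "\<theta> j \<le> \<theta> i"
  shows "(\<integral>r. of_bool (above \<theta> (A - {i} - {j}) r (r i - \<theta> i) = n)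
            * (tail (r i - (\<theta> i - \<theta> j)) * (1 - tail (r i - (\<theta> i - \<theta> j)))) \<partial>noise)
    \<le> (\<integral>r. of_bool (above \<theta> (A - {i} - {j}) r (r j - \<theta> j) = n)
            * (tail (r j + (\<theta> i - \<theta> j)) * (1 - tail (r j + (\<theta> i - \<theta> j)))) \<partial>noise)"
    (is "(\<integral>r. ?f r \<partial>noise) \<le> (\<integral>r. ?g r \<partial>noise)")
proof -
  have bd: "\<bar>of_bool b * (tail y * (1 - tail y))\<bar> \<le> 1" for b y
    using tail_nonneg[of y] tail_le_1[of y] by (auto simp: abs_mult intro!: mult_le_one)
  have [measurable]: "(\<lambda>r. above \<theta> (A - {i} - {j}) r (r k - \<theta> k)) \<in> measurable noise (count_space UNIV)" for k
    by (rule measurable_above) (simp_all add: A)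
  have [measurable]: "?f \<in> borel_measurable noise" "?g \<in> borel_measurable noise"
    by measurable
  have "(\<integral>r. ?f r \<partial>noise) = (\<integral>r. (\<integral>x. ?f (r(i := x)) \<partial>D) \<partial>noise)"
    by (rule integral_resample1[OF prob_D _ bd]) simp
  also have "\<dots> \<le> (\<integral>r. (\<integral>x. ?g (r(j := x)) \<partial>D) \<partial>noise)"
  proof (rule integral_mono)
    show "integrable noise (\<lambda>r. \<integral>x. ?f (r(i := x)) \<partial>D)"
      by (rule integrable_resample1[OF prob_D _ bd]) simp
    show "integrable noise (\<lambda>r. \<integral>x. ?g (r(j := x)) \<partial>D)"
      by (rule integrable_resample1[OF prob_D _ bd]) simp
    fix r :: "nat \<Rightarrow> real"
    define W :: "real \<Rightarrow> real" where "W x = of_bool (above \<theta> (A - {i} - {j}) r (x - \<theta> i) = n)" for x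
    have Wm: "W \<in> borel_measurable borel"
    proof -
      have [measurable]: "(\<lambda>x. above \<theta> (A - {i} - {j}) r (x - \<theta> i)) \<in> measurable borel (count_space UNIV)"
        by (rule measurable_above) (simp_all add: A)
      show ?thesis unfolding W_def by measurable
    qed
    have ab: "above \<theta> (A - {i} - {j}) (r(i := x)) y = above \<theta> (A - {i} - {j}) r y"
      "above \<theta> (A - {i} - {j}) (r(j := x)) y = above \<theta> (A - {i} - {j}) r y" for x y
      by (rule above_cong, simp)+
    have "(\<integral>x. W x * (tail (x - (\<theta> i - \<theta> j)) * (1 - tail (x - (\<theta> i - \<theta> j)))) \<partial>D)
       \<le> (\<integral>x. W (x + (\<theta> i - \<theta> j)) * (tail (x + (\<theta> i - \<theta> j)) * (1 - tail (x + (\<theta> i - \<theta> j)))) \<partial>D)"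
      by (rule integral_odds_shift[OF Wm]) (use le in \<open>auto simp: W_def\<close>)
    then show "(\<integral>x. ?f (r(i := x)) \<partial>D) \<le> (\<integral>x. ?g (r(j := x)) \<partial>D)"
      using ij unfolding ab by (simp add: W_def)
  qed
  also have "\<dots> = (\<integral>r. ?g r \<partial>noise)"
    by (rule integral_resample1[OF prob_D _ bd, symmetric]) simp
  finally show ?thesis .
qed

text \<open>The hypothesis \<open>e\<close> makes j the m-th best competitor of i, so the score of j
  is the threshold that i has to reach.\<close>

lemma U_pivot:
  assumes m: "1 \<le> m" and j: "j < d" "j \<noteq> i"
    and e: "above \<theta> ({..<d} - {i} - {j}) r (r j - \<theta> j) = m - 1"
  shows "U d m \<theta> i r = tail (r j + (\<theta> i - \<theta> j))"
    and "above \<theta> ({..<d} - {i}) r (r j - \<theta> j) = m - 1"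
proof -
  let ?A = "{..<d} - {i}"
  have rem: "above \<theta> ?A r z = (if z < r j - \<theta> j then 1 else 0) + above \<theta> (?A - {j}) r z" for z
    using j by (intro above_remove) auto
  show eq: "above \<theta> ?A r (r j - \<theta> j) = m - 1"
    using rem[of "r j - \<theta> j"] e by simp
  have "x \<in> sel d m \<theta> i r \<longleftrightarrow> r j + (\<theta> i - \<theta> j) \<le> x" for x
  proof
    assume "r j + (\<theta> i - \<theta> j) \<le> x"
    then have "above \<theta> ?A r (x - \<theta> i) \<le> above \<theta> ?A r (r j - \<theta> j)"
      by (intro above_antimono) auto
    then show "x \<in> sel d m \<theta> i r" using eq m by (simp add: sel_def)
  next
    assume x: "x \<in> sel d m \<theta> i r"
    show "r j + (\<theta> i - \<theta> j) \<le> x"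
    proof (rule ccontr)
      assume "\<not> ?thesis"
      then have lt: "x - \<theta> i < r j - \<theta> j" by simp
      then have "above \<theta> (?A - {j}) r (r j - \<theta> j) \<le> above \<theta> (?A - {j}) r (x - \<theta> i)"
        by (intro above_antimono) auto
      then show False using x rem[of "x - \<theta> i"] lt e m by (simp add: sel_def)
    qed
  qed
  then have "sel d m \<theta> i r = {r j + (\<theta> i - \<theta> j)..}" by auto
  then show "U d m \<theta> i r = tail (r j + (\<theta> i - \<theta> j))" by (simp add: U_def tail_eq)
qed

text \<open>At most one summand is nonzero: of two such arms the one with the higher score would be
  beaten by strictly fewer arms, yet both counts are m - 1. For the remaining arm,
  \<open>U_pivot\<close> turns the summand into U (1 - U).\<close>

lemma sum_pivot_le:
  assumes m: "1 \<le> m" and B: "B \<subseteq> {..<d} - {i}"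
    and ties: "\<forall>j<d. \<forall>k<d. j \<noteq> k \<longrightarrow> r j - \<theta> j \<noteq> r k - \<theta> k"
  shows "(\<Sum>j\<in>B. of_bool (above \<theta> ({..<d} - {i} - {j}) r (r j - \<theta> j) = m - 1)
      * (tail (r j + (\<theta> i - \<theta> j)) * (1 - tail (r j + (\<theta> i - \<theta> j))))) \<le> U d m \<theta> i r * (1 - U d m \<theta> i r)"
    (is "(\<Sum>j\<in>B. of_bool (?e j) * ?t j) \<le> _")
proof (cases "\<exists>j\<in>B. ?e j")
  case False
  then have "(\<Sum>j\<in>B. of_bool (?e j) * ?t j) = 0" by (intro sum.neutral) auto
  then show ?thesis by (simp add: U_nonneg U_le_1)
next
  case True
  then obtain j where j: "j \<in> B" "?e j" by blast
  have no: "\<not> ?e k" if k: "k \<in> B" "k \<noteq> j" for k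
  proof
    assume ek: "?e k"
    have lt: False if "?e a" "?e b" "a \<in> B" "b \<in> B" "r b - \<theta> b < r a - \<theta> a" for a b
    proof -
      have a: "a < d" "a \<noteq> i" and b: "b < d" "b \<noteq> i" using that B by auto
      have "insert a {k \<in> {..<d} - {i}. r a - \<theta> a < r k - \<theta> k} \<subseteq> {k \<in> {..<d} - {i}. r b - \<theta> b < r k - \<theta> k}"
        using a that by auto
      then have "card (insert a {k \<in> {..<d} - {i}. r a - \<theta> a < r k - \<theta> k})
          \<le> card {k \<in> {..<d} - {i}. r b - \<theta> b < r k - \<theta> k}"
        by (intro card_mono) auto
      then show False
        using U_pivot(2)[OF m a that(1)] U_pivot(2)[OF m b that(2)] by (simp add: above_def)
    qed
    have "r j - \<theta> j \<noteq> r k - \<theta> k" using ties j k B by (metis Diff_iff lessThan_iff subsetD)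
    then show False using lt[OF ek j(2) k(1) j(1)] lt[OF j(2) ek j(1) k(1)] by linarith
  qed
  have fin: "finite B" using B by (rule finite_subset) simp
  have jd: "j < d" "j \<noteq> i" using j(1) B by auto
  have "(\<Sum>j\<in>B. of_bool (?e j) * ?t j) = of_bool (?e j) * ?t j + (\<Sum>k\<in>B - {j}. of_bool (?e k) * ?t k)"
    using fin j by (intro sum.remove) auto
  also have "(\<Sum>k\<in>B - {j}. of_bool (?e k) * ?t k) = 0"
    using no by (intro sum.neutral) auto
  finally show ?thesis
    using U_pivot(1)[OF m _ _ j(2)] jd j(2) by simp
qed

lemma second_moment_U:
  assumes m: "1 \<le> m" and i: "i < d"
  shows "real (card {j \<in> {..<d}. \<theta> j \<le> \<theta> i}) * (\<integral>r. (U d m \<theta> i r)\<^sup>2 \<partial>noise)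
    \<le> 2 * real m * (\<integral>r. U d m \<theta> i r \<partial>noise)"
proof -
  note [measurable] = measurable_sel
  define B where "B = {j \<in> {..<d}. \<theta> j \<le> \<theta> i} - {i}"
  have B: "finite B" "B \<subseteq> {..<d} - {i}" by (auto simp: B_def)
  have cB: "card {j \<in> {..<d}. \<theta> j \<le> \<theta> i} = Suc (card B)"
    unfolding B_def using i by (intro card_Suc_Diff1[symmetric]) auto
  define S :: "(nat \<Rightarrow> real) \<Rightarrow> real" where "S r = of_bool (r i \<in> sel d m \<theta> i r)" for r
  define X :: "nat \<Rightarrow> (nat \<Rightarrow> real) \<Rightarrow> real" where "X j r = of_bool (r i - \<theta> i < r j - \<theta> j)" for j r
  define W :: "nat \<Rightarrow> (nat \<Rightarrow> real) \<Rightarrow> real" where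
    "W j r = of_bool (above \<theta> ({..<d} - {i} - {j}) r (r j - \<theta> j) = m - 1)
      * (tail (r j + (\<theta> i - \<theta> j)) * (1 - tail (r j + (\<theta> i - \<theta> j))))" for j r
  have [measurable]: "S \<in> borel_measurable noise" "X j \<in> borel_measurable noise" "W j \<in> borel_measurable noise" for j
    unfolding S_def X_def W_def by measurable
  have S01: "0 \<le> S r" "S r \<le> 1" and X01: "0 \<le> X j r" "X j r \<le> 1" for j r
    by (auto simp: S_def X_def)
  have W01: "0 \<le> W j r" "W j r \<le> 1" for j r
    using tail_nonneg[of "r j + (\<theta> i - \<theta> j)"] tail_le_1[of "r j + (\<theta> i - \<theta> j)"]
    by (auto simp: W_def intro: mult_le_one)
  define EU where "EU = (\<integral>r. U d m \<theta> i r \<partial>noise)"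
  define E2 where "E2 = (\<integral>r. (U d m \<theta> i r)\<^sup>2 \<partial>noise)"
  have ts01: "0 \<le> tail y * S r" "tail y * S r \<le> 1" for y r
    using S01 tail_nonneg tail_le_1 by (auto intro: mult_le_one)
  have xs01: "0 \<le> X j r * S r" "X j r * S r \<le> 1" for j r
    using S01 X01 by (auto intro: mult_le_one)
  have u01: "0 \<le> U d m \<theta> i r" "U d m \<theta> i r \<le> 1" "0 \<le> (U d m \<theta> i r)\<^sup>2" "(U d m \<theta> i r)\<^sup>2 \<le> 1" for r
    by (auto simp: U_nonneg U_le_1 power_le_one)
  have int: "integrable noise S" "integrable noise (\<lambda>r. tail (r i) * S r)"
      "integrable noise (\<lambda>r. tail (r i - c) * S r)" "integrable noise (\<lambda>r. X j r * S r)"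
      "integrable noise (W j)" "integrable noise (U d m \<theta> i)" "integrable noise (\<lambda>r. (U d m \<theta> i r)\<^sup>2)" for c j
    by (rule integrable_noise_unit; (measurable; fail)?; (rule S01 ts01 xs01 W01 u01)?)+
  \<comment> \<open>Enlarging \<open>tail (r i)\<close> to \<open>tail (r i - \<delta>)\<close>
    turns it into the conditional probability that j beats i, so the difference becomes a
    covariance, which the exchange of i and j bounds.\<close>
  have step: "E2 / 2 - (\<integral>r. X j r * S r \<partial>noise) \<le> (\<integral>r. W j r \<partial>noise)" if "j \<in> B" for j
  proof -
    define \<delta> where "\<delta> = \<theta> i - \<theta> j"
    have j: "j < d" "j \<noteq> i" "\<theta> j \<le> \<theta> i" using that by (auto simp: B_def)
    have "E2 / 2 = (\<integral>r. tail (r i) * S r \<partial>noise)"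
      unfolding E2_def S_def by (rule integral_tail_sel[symmetric])
    also have "\<dots> \<le> (\<integral>r. tail (r i - \<delta>) * S r \<partial>noise)"
      using j by (intro integral_mono int mult_right_mono tail_antimono S01) (simp add: \<delta>_def)
    finally have "E2 / 2 - (\<integral>r. X j r * S r \<partial>noise)
        \<le> (\<integral>r. tail (r i - \<delta>) * S r \<partial>noise) - (\<integral>r. X j r * S r \<partial>noise)" by simp
    also have "\<dots> = (\<integral>r. (tail (r i - \<delta>) - X j r) * S r \<partial>noise)"
      by (simp add: left_diff_distrib int)
    also have "\<dots> = (\<integral>r. of_bool (above \<theta> ({..<d} - {i} - {j}) r (r i - \<theta> i) = m - 1)
            * (tail (r i - (\<theta> i - \<theta> j)) * (1 - tail (r i - (\<theta> i - \<theta> j)))) \<partial>noise)"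
      unfolding \<delta>_def X_def S_def by (rule integral_cov_above[OF m j(1,2)])
    also have "\<dots> \<le> (\<integral>r. W j r \<partial>noise)"
      unfolding W_def using j by (intro integral_odds_sel) auto
    finally show ?thesis .
  qed
  have "real (card B) * (E2 / 2) - (\<Sum>j\<in>B. \<integral>r. X j r * S r \<partial>noise)
      = (\<Sum>j\<in>B. E2 / 2 - (\<integral>r. X j r * S r \<partial>noise))"
    by (simp add: sum_subtractf)
  also have "\<dots> \<le> (\<Sum>j\<in>B. \<integral>r. W j r \<partial>noise)"
    by (intro sum_mono step)
  also have "\<dots> = (\<integral>r. (\<Sum>j\<in>B. W j r) \<partial>noise)"
    by (simp add: int)
  also have "\<dots> \<le> (\<integral>r. U d m \<theta> i r - (U d m \<theta> i r)\<^sup>2 \<partial>noise)"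
  proof (rule integral_mono_AE)
    show "AE r in noise. (\<Sum>j\<in>B. W j r) \<le> U d m \<theta> i r - (U d m \<theta> i r)\<^sup>2"
      using AE_no_ties[of d \<theta>]
    proof eventually_elim
      case (elim r)
      then show ?case
        using sum_pivot_le[OF m B(2) elim] by (simp add: W_def right_diff_distrib power2_eq_square)
    qed
  qed (simp_all add: int)
  also have "\<dots> = EU - E2"
    by (simp add: int EU_def E2_def)
  finally have 1: "real (card B) * (E2 / 2) - (\<Sum>j\<in>B. \<integral>r. X j r * S r \<partial>noise) \<le> EU - E2" .
  \<comment> \<open>While i is selected at most m - 1 arms beat it; this bounds the joint
    probabilities summed over j.\<close>
  have "(\<Sum>j\<in>B. \<integral>r. X j r * S r \<partial>noise) = (\<integral>r. (\<Sum>j\<in>B. X j r * S r) \<partial>noise)"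
    by (simp add: int)
  also have "\<dots> \<le> (\<integral>r. real (m - 1) * S r \<partial>noise)"
  proof (rule integral_mono)
    fix r
    show "(\<Sum>j\<in>B. X j r * S r) \<le> real (m - 1) * S r"
    proof (cases "r i \<in> sel d m \<theta> i r")
      case True
      have "(\<Sum>j\<in>B. X j r) = real (card {j \<in> B. r i - \<theta> i < r j - \<theta> j})"
        using B(1) by (simp add: X_def of_bool_def sum.If_cases Int_def)
      also have "card {j \<in> B. r i - \<theta> i < r j - \<theta> j} \<le> above \<theta> ({..<d} - {i}) r (r i - \<theta> i)"
        unfolding above_def using B by (intro card_mono) auto
      also have "\<dots> \<le> m - 1" using True m by (simp add: sel_def)
      finally show ?thesis using True by (simp add: S_def)
    qed (simp add: S_def)
  qed (simp_all add: int)
  also have "\<dots> = real (m - 1) * EU"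
    using integral_sel[of i d m \<theta>] by (simp add: S_def EU_def)
  finally have "real (card B) * (E2 / 2) \<le> EU - E2 + real (m - 1) * EU" using 1 by simp
  \<comment> \<open>The - E2 contributed by U (1 - U) gives \<open>card B + 2\<close> on the left,
    which dominates the rank \<open>card B + 1\<close>.\<close>
  then have "(real (card B) + 2) * E2 \<le> 2 * real m * EU"
    using m by (simp add: of_nat_diff algebra_simps)
  moreover have "0 \<le> E2" unfolding E2_def by (rule Bochner_Integration.integral_nonneg) simp
  ultimately show ?thesis
    unfolding cB EU_def[symmetric] E2_def[symmetric] by (simp add: algebra_simps)
qed

lemma moment_U:
  fixes \<theta> :: "nat \<Rightarrow> real"
  assumes m: "1 \<le> m" and i: "i < d"
  defines "\<sigma> \<equiv> real (card {j \<in> {..<d}. \<theta> j \<le> \<theta> i})"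
  shows "(\<integral>r. U d m \<theta> i r powr (1 + 1/\<alpha>) \<partial>noise)
    \<le> min 1 (2 * real m / \<sigma>) powr (1/\<alpha>) * (\<integral>r. U d m \<theta> i r \<partial>noise)"
proof -
  define s where "s = 1/\<alpha>"
  have s: "0 < s" "s < 1" using alpha by (auto simp: s_def)
  have u01: "0 \<le> U d m \<theta> i r" "U d m \<theta> i r \<le> 1" for r
    by (auto simp: U_nonneg U_le_1)
  have pw: "U d m \<theta> i r powr (1 + s) \<le> 1" for r
    using u01 s by (intro powr_le1) auto
  have int: "integrable noise (U d m \<theta> i)" "integrable noise (\<lambda>r. (U d m \<theta> i r)\<^sup>2)"
      "integrable noise (\<lambda>r. U d m \<theta> i r powr (1 + s))"
    by (rule integrable_noise_bounded[where C = 1]; measurable; use u01 pw in \<open>simp add: power_le_one\<close>)+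
  define EU where "EU = (\<integral>r. U d m \<theta> i r \<partial>noise)"
  define E2 where "E2 = (\<integral>r. (U d m \<theta> i r)\<^sup>2 \<partial>noise)"
  define Es where "Es = (\<integral>r. U d m \<theta> i r powr (1 + s) \<partial>noise)"
  have EU0: "0 \<le> EU" unfolding EU_def by (rule Bochner_Integration.integral_nonneg) (simp add: u01)
  have "0 < \<sigma>" unfolding \<sigma>_def using i by (auto simp: card_gt_0_iff)
  define \<kappa> where "\<kappa> = 2 * real m / \<sigma>"
  have \<kappa>: "0 < \<kappa>" using m \<open>0 < \<sigma>\<close> by (simp add: \<kappa>_def)
  have E2: "E2 \<le> \<kappa> * EU"
  proof -
    have "\<sigma> * E2 \<le> 2 * real m * EU"
      unfolding \<sigma>_def E2_def EU_def by (rule second_moment_U[OF m i])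
    then show ?thesis using \<open>0 < \<sigma>\<close> by (simp add: \<kappa>_def field_simps)
  qed
  have le1: "Es \<le> EU"
    unfolding Es_def EU_def
  proof (intro integral_mono int)
    fix r
    show "U d m \<theta> i r powr (1 + s) \<le> U d m \<theta> i r"
      using powr_mono'[of 1 "1 + s" "U d m \<theta> i r"] u01[of r] s by simp
  qed
  \<comment> \<open>The tangent to the concave power s at \<kappa>, multiplied by x. As E2 \<le>
    \<kappa> * EU, touching at \<kappa> makes the linear and quadratic parts contribute at most 1 -
    s and s times \<open>\<kappa> powr s * EU\<close>.\<close>
  have tangent: "x powr (1 + s) \<le> \<kappa> powr s * ((1 - s) * x + s / \<kappa> * x\<^sup>2)" if x: "0 \<le> x" for x
  proof (cases "x = 0")
    case False
    then have x: "0 < x" using x by simp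
    have "(x / \<kappa>) powr s * 1 powr (1 - s) \<le> s * (x / \<kappa>) + (1 - s) * 1"
      using x \<kappa> s by (intro Youngs_inequality_0) auto
    then have "x powr s \<le> \<kappa> powr s * ((1 - s) + s / \<kappa> * x)"
      using x \<kappa> by (simp add: powr_divide field_simps)
    then have "x * x powr s \<le> x * (\<kappa> powr s * ((1 - s) + s / \<kappa> * x))"
      using x by (intro mult_left_mono) auto
    then show ?thesis
      using x by (simp add: powr_add power2_eq_square algebra_simps)
  qed auto
  have "Es \<le> (\<integral>r. \<kappa> powr s * ((1 - s) * U d m \<theta> i r + s / \<kappa> * (U d m \<theta> i r)\<^sup>2) \<partial>noise)"
    unfolding Es_def
    by (intro integral_mono tangent u01 int) (intro integrable_mult_right Bochner_Integration.integrable_add int)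
  also have "\<dots> = \<kappa> powr s * ((1 - s) * EU + s / \<kappa> * E2)"
    using int(1,2)
    by (subst integral_mult_right_zero, subst Bochner_Integration.integral_add) (auto simp: EU_def E2_def)
  also have "\<dots> \<le> \<kappa> powr s * ((1 - s) * EU + s / \<kappa> * (\<kappa> * EU))"
    using E2 \<kappa> s by (intro mult_left_mono add_left_mono) auto
  also have "\<dots> = \<kappa> powr s * EU"
    using \<kappa> by (simp add: field_simps)
  finally have le2: "Es \<le> \<kappa> powr s * EU" .
  have "Es \<le> min 1 \<kappa> powr s * EU"
    using le1 le2 by (cases "1 \<le> \<kappa>") (auto simp: min_def)
  then show ?thesis unfolding Es_def EU_def \<kappa>_def s_def .
qed

end

section \<open>Geometric resampling\<close>

text \<open>By induction the left side is 1 + z minus a nonnegative term; 1 + z is the rescaled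
  second moment of a geometric variable. Working with partial sums makes the bound valid at z = 1 as
  well.\<close>

lemma sum_squares_geometric_le:
  fixes z :: real
  assumes "0 \<le> z" "z \<le> 1"
  shows "(1 - z) ^ 3 * (\<Sum>n<N. (real n + 1)\<^sup>2 * z ^ n) \<le> 2"
proof -
  have "(1 - z) ^ 3 * (\<Sum>n<N. (real n + 1)\<^sup>2 * z ^ n)
      = 1 + z - z ^ N * ((real N + 1 - real N * z)\<^sup>2 + z)"
  proof (induction N)
    case (Suc N)
    have "(1 - z) ^ 3 * (\<Sum>n<Suc N. (real n + 1)\<^sup>2 * z ^ n)
        = 1 + z - z ^ N * ((real N + 1 - real N * z)\<^sup>2 + z) + (1 - z) ^ 3 * ((real N + 1)\<^sup>2 * z ^ N)"
      by (simp add: distrib_left Suc.IH)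
    also have "\<dots> = 1 + z - z ^ Suc N * ((real (Suc N) + 1 - real (Suc N) * z)\<^sup>2 + z)"
      by (simp add: power2_eq_square power3_eq_cube algebra_simps)
    finally show ?case .
  qed simp
  also have "\<dots> \<le> 2"
    using assms by (smt (verit) mult_nonneg_nonneg zero_le_power zero_le_power2)
  finally show ?thesis .
qed

lemma suminf_single_ennreal:
  fixes f :: "nat \<Rightarrow> ennreal"
  assumes "\<And>n. n \<noteq> k \<Longrightarrow> f n = 0"
  shows "(\<Sum>n. f n) = f k"
  using suminf_finite[of "{k}" f] assms by auto

context perturbation
begin

lemma space_perturb[simp]: "space (perturb_space D) = UNIV"
  by (simp add: perturb_space_def space_PiM)

sublocale pert: prob_space "perturb_space D"
  unfolding perturb_space_def by (rule prob_space_PiM) (rule prob_D)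

lemma measurable_perturb_component[measurable]: "(\<lambda>w. w k) \<in> borel_measurable (perturb_space D)"
  unfolding perturb_space_def
  using measurable_component_singleton[of k UNIV "\<lambda>_. D"] by (simp cong: measurable_cong_sets)

lemma measurable_perturb_slice[measurable]: "(\<lambda>w i. w (t, k, i)) \<in> measurable (perturb_space D) noise"
  by (rule measurable_PiM_single') (auto simp: space_PiM cong: measurable_cong_sets)

lemma nn_integral_slice:
  assumes "g \<in> borel_measurable noise"
  shows "(\<integral>\<^sup>+w. g (\<lambda>i. w (t, k, i)) \<partial>perturb_space D) = (\<integral>\<^sup>+r. g r \<partial>noise)"
  unfolding perturb_space_def
  by (rule nn_integral_PiM_slice[OF prob_D _ assms, of "\<lambda>i. (t, k, i)"]) (auto simp: inj_on_def)

text \<open>The perturbations drawn within a round are independent: in the induction only the n-th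
  of them is resampled, on which the earlier factors do not depend.\<close>

lemma nn_integral_prod_slices:
  fixes g :: "nat \<Rightarrow> (nat \<Rightarrow> real) \<Rightarrow> ennreal"
  assumes [measurable]: "\<And>k. g k \<in> borel_measurable noise"
  shows "(\<integral>\<^sup>+w. (\<Prod>k<n. g k (\<lambda>i. w (t, k, i))) \<partial>perturb_space D) = (\<Prod>k<n. \<integral>\<^sup>+r. g k r \<partial>noise)"
proof (induction n)
  case 0
  show ?case by (simp add: pert.emeasure_space_1[simplified])
next
  case (Suc n)
  let ?F = "\<lambda>n w. \<Prod>k<n. g k (\<lambda>i. w (t, k, i))"
  have Fm[measurable]: "?F n \<in> borel_measurable (perturb_space D)" for n
    by measurable
  have "(\<integral>\<^sup>+w. ?F (Suc n) w \<partial>perturb_space D)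
    = (\<integral>\<^sup>+w. (\<integral>\<^sup>+v. ?F (Suc n) (\<lambda>k. if k \<in> {t} \<times> {n} \<times> UNIV then v k else w k)
        \<partial>perturb_space D) \<partial>perturb_space D)"
    unfolding perturb_space_def
    by (rule nn_integral_resample[OF prob_D]) (use Fm[of "Suc n"] in \<open>simp add: perturb_space_def\<close>)
  also have "\<dots> = (\<integral>\<^sup>+w. (\<integral>\<^sup>+v. ?F n w * g n (\<lambda>i. v (t, n, i)) \<partial>perturb_space D) \<partial>perturb_space D)"
    by (intro nn_integral_cong) (simp add: prod.lessThan_Suc)
  also have "\<dots> = (\<integral>\<^sup>+w. ?F n w * (\<integral>\<^sup>+r. g n r \<partial>noise) \<partial>perturb_space D)"
    by (subst nn_integral_cmult) (measurable, subst nn_integral_slice, auto)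
  also have "\<dots> = (\<Prod>k<Suc n. \<integral>\<^sup>+r. g k r \<partial>noise)"
    by (subst nn_integral_multc) (auto simp: Suc.IH prod.lessThan_Suc)
  finally show ?case .
qed

section \<open>Marginal selection probabilities and the law of the resampling counter\<close>

definition phi :: "nat \<Rightarrow> nat \<Rightarrow> real \<Rightarrow> (nat \<Rightarrow> real) \<Rightarrow> nat \<Rightarrow> real" where
  "phi d m \<eta> L i = (\<integral>r. U d m (\<lambda>i. \<eta> * L i) i r \<partial>noise)"

lemma phi_nonneg: "0 \<le> phi d m \<eta> L i"
  unfolding phi_def by (rule Bochner_Integration.integral_nonneg) (rule U_nonneg)

lemma integrable_U: "integrable noise (U d m \<theta> i)"
  by (rule integrable_noise_unit) (auto simp: U_nonneg U_le_1)

lemma phi_le_1: "phi d m \<eta> L i \<le> 1"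
proof -
  have "phi d m \<eta> L i \<le> (\<integral>r. 1 \<partial>noise)"
    unfolding phi_def by (intro integral_mono integrable_U) (auto simp: U_le_1)
  then show ?thesis by (simp add: noise.prob_space)
qed

lemma measurable_action_mem:
  assumes m: "m \<le> d" and [measurable]: "\<And>i. (\<lambda>x. r x i) \<in> borel_measurable M"
  shows "Measurable.pred M (\<lambda>x. i \<in> ftpl_action d m \<eta> L (r x))"
  by (rule measurable_compose[OF measurable_ftpl_action[OF assms]]) simp

lemma integral_action_mem:
  assumes m: "m \<le> d" and i: "i < d"
  shows "(\<integral>r. of_bool (i \<in> ftpl_action d m \<eta> L r) \<partial>noise) = phi d m \<eta> L i"
proof -
  note [measurable] = measurable_action_mem[OF m] measurable_sel
  have "(\<integral>r. of_bool (i \<in> ftpl_action d m \<eta> L r) \<partial>noise)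
    = (\<integral>r. of_bool (r i \<in> sel d m (\<lambda>i. \<eta> * L i) i r) \<partial>noise :: real)"
  proof (rule integral_cong_AE)
    show "AE r in noise. of_bool (i \<in> ftpl_action d m \<eta> L r) = (of_bool (r i \<in> sel d m (\<lambda>i. \<eta> * L i) i r) :: real)"
      using AE_no_ties[of d "\<lambda>i. \<eta> * L i"]
    proof eventually_elim
      case (elim r)
      show ?case
        unfolding sel_def mem_Collect_eq
        by (subst ftpl_action_iff[OF m i]) (use elim i in auto)
    qed
  qed measurable
  then show ?thesis by (simp add: integral_sel phi_def)
qed

lemma
  assumes m: "m \<le> d" and i: "i < d"
  shows nn_integral_action_mem: "(\<integral>\<^sup>+r. of_bool (i \<in> ftpl_action d m \<eta> L r) \<partial>noise) = ennreal (phi d m \<eta> L i)"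
    and nn_integral_action_not_mem: "(\<integral>\<^sup>+r. of_bool (i \<notin> ftpl_action d m \<eta> L r) \<partial>noise) = ennreal (1 - phi d m \<eta> L i)"
proof -
  note [measurable] = measurable_action_mem[OF m]
  have int: "integrable noise (\<lambda>r. of_bool (i \<in> ftpl_action d m \<eta> L r) :: real)"
    by (rule integrable_noise_unit) auto
  have "(\<integral>\<^sup>+r. ennreal (of_bool (i \<in> ftpl_action d m \<eta> L r)) \<partial>noise) = ennreal (phi d m \<eta> L i)"
    using int by (subst nn_integral_eq_integral) (auto simp: integral_action_mem[OF m i])
  moreover have "(\<lambda>r. ennreal (of_bool (i \<in> ftpl_action d m \<eta> L r))) = (\<lambda>r. of_bool (i \<in> ftpl_action d m \<eta> L r))"
    by (auto simp: fun_eq_iff)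
  ultimately show "(\<integral>\<^sup>+r. of_bool (i \<in> ftpl_action d m \<eta> L r) \<partial>noise) = ennreal (phi d m \<eta> L i)"
    by simp
  have "(\<integral>\<^sup>+r. ennreal (1 - of_bool (i \<in> ftpl_action d m \<eta> L r)) \<partial>noise) = ennreal (1 - phi d m \<eta> L i)"
    using int by (subst nn_integral_eq_integral) (auto simp: integral_action_mem[OF m i] noise.prob_space)
  moreover have "(\<lambda>r. ennreal (1 - of_bool (i \<in> ftpl_action d m \<eta> L r))) = (\<lambda>r. of_bool (i \<notin> ftpl_action d m \<eta> L r))"
    by (auto simp: fun_eq_iff)
  ultimately show "(\<integral>\<^sup>+r. of_bool (i \<notin> ftpl_action d m \<eta> L r) \<partial>noise) = ennreal (1 - phi d m \<eta> L i)"
    by simp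
qed

text \<open>Being played and having counter n + 1 means presence in perturbation 0, absence in 1 to
  n and presence in n + 1; independence turns this into the product of the probabilities. The
  default counter 0 contributes nothing because of \<open>h0\<close>, so the event that the arm
  never reappears needs no separate estimate.\<close>

lemma nn_integral_gr_count:
  fixes h :: "nat \<Rightarrow> ennreal" and \<eta> :: real and L :: "nat \<Rightarrow> real"
  assumes m: "m \<le> d" and i: "i < d" and h0: "h 0 = 0"
  defines "p \<equiv> phi d m \<eta> L i"
  shows "(\<integral>\<^sup>+w. of_bool (i \<in> ftpl_action d m \<eta> L (\<lambda>i. w (t, 0, i)))
            * h (gr_count d m \<eta> L (\<lambda>k i. w (t, k, i)) i) \<partial>perturb_space D)
    = (\<Sum>n. ennreal (p * p * (1 - p) ^ n) * h (Suc n))"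
proof -
  let ?A = "\<lambda>k w. i \<in> ftpl_action d m \<eta> L (\<lambda>i. w (t, k, i))"
  let ?K = "\<lambda>w. gr_count d m \<eta> L (\<lambda>k i. w (t, k, i)) i"
  note [measurable] = measurable_action_mem[OF m]
  define G :: "nat \<Rightarrow> nat \<Rightarrow> (nat \<Rightarrow> real) \<Rightarrow> ennreal" where
    "G n k r = of_bool (if k = 0 \<or> k = Suc n then i \<in> ftpl_action d m \<eta> L r else i \<notin> ftpl_action d m \<eta> L r)" for n k r
  have [measurable]: "G n k \<in> borel_measurable noise" for n k
    unfolding G_def by (cases "k = 0 \<or> k = Suc n") simp_all
  have Gp: "(\<Prod>k<Suc (Suc n). G n k (\<lambda>i. w (t, k, i)))
      = of_bool (?A 0 w \<and> (\<forall>k. 1 \<le> k \<and> k \<le> n \<longrightarrow> \<not> ?A k w) \<and> ?A (Suc n) w)" (is "?l = of_bool ?b") for n w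
  proof (cases ?b)
    case True
    then have "G n k (\<lambda>i. w (t, k, i)) = 1" if "k < Suc (Suc n)" for k
      using that by (auto simp: G_def)
    then show ?thesis using True by simp
  next
    case False
    then have "\<exists>k<Suc (Suc n). G n k (\<lambda>i. w (t, k, i)) = 0"
    proof -
      from False consider "\<not> ?A 0 w" | k where "1 \<le> k" "k \<le> n" "?A k w" | "\<not> ?A (Suc n) w" by blast
      then show ?thesis
      proof cases
        case 1 then show ?thesis by (intro exI[of _ 0]) (auto simp: G_def)
      next
        case (2 k) then show ?thesis by (intro exI[of _ k]) (auto simp: G_def)
      next
        case 3 then show ?thesis by (intro exI[of _ "Suc n"]) (auto simp: G_def)
      qed
    qed
    then have l0: "?l = 0" by (intro prod_zero) auto
    have b: "?b = False" using False by blast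
    show ?thesis unfolding l0 b by simp
  qed
  have K: "of_bool (?A 0 w) * h (?K w) = (\<Sum>n. (\<Prod>k<Suc (Suc n). G n k (\<lambda>i. w (t, k, i))) * h (Suc n))" for w
  proof (cases "\<exists>k\<ge>1. ?A k w")
    case True
    define k where "k = (LEAST k. 1 \<le> k \<and> ?A k w)"
    have k: "1 \<le> k" "?A k w" unfolding k_def using LeastI_ex[OF True] by auto
    have lt: "\<not> ?A j w" if "1 \<le> j" "j < k" for j
      using that not_less_Least[of j "\<lambda>k. 1 \<le> k \<and> ?A k w"] unfolding k_def by blast
    have Kk: "?K w = k" using True by (simp add: gr_count_def k_def)
    obtain n where n: "k = Suc n" using k by (cases k) auto
    have "(\<Sum>n. (\<Prod>k<Suc (Suc n). G n k (\<lambda>i. w (t, k, i))) * h (Suc n))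
        = (\<Prod>k<Suc (Suc n). G n k (\<lambda>i. w (t, k, i))) * h (Suc n)"
    proof (rule suminf_single_ennreal)
      fix j assume "j \<noteq> n"
      then have "\<not> (?A 0 w \<and> (\<forall>k. 1 \<le> k \<and> k \<le> j \<longrightarrow> \<not> ?A k w) \<and> ?A (Suc j) w)"
        using k lt[of "Suc j"] n by (metis Suc_le_eq Suc_less_eq less_Suc_eq_le linorder_neqE_nat zero_less_Suc One_nat_def)
      then show "(\<Prod>k<Suc (Suc j). G j k (\<lambda>i. w (t, k, i))) * h (Suc j) = 0"
        unfolding Gp by simp
    qed
    also have "\<dots> = of_bool (?A 0 w) * h (?K w)"
      unfolding Gp using k lt n Kk by auto
    finally show ?thesis by simp
  next
    case False
    then have "?K w = 0" unfolding gr_count_def by (rule if_not_P)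
    moreover have "(\<Prod>k<Suc (Suc n). G n k (\<lambda>i. w (t, k, i))) * h (Suc n) = 0" for n
      unfolding Gp using False by auto
    ultimately show ?thesis by (simp only: h0 mult_zero_right suminf_zero)
  qed
  have p: "0 \<le> p" "p \<le> 1" unfolding p_def by (simp_all add: phi_nonneg phi_le_1)
  have I: "(\<integral>\<^sup>+w. (\<Prod>k<Suc (Suc n). G n k (\<lambda>i. w (t, k, i))) * h (Suc n) \<partial>perturb_space D)
      = ennreal (p * p * (1 - p) ^ n) * h (Suc n)" for n
  proof -
    have Gi: "(\<integral>\<^sup>+r. G n k r \<partial>noise) = (if k = 0 \<or> k = Suc n then ennreal p else ennreal (1 - p))" for k
      by (simp add: G_def p_def nn_integral_action_mem[OF m i] nn_integral_action_not_mem[OF m i])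
    have "(\<integral>\<^sup>+w. (\<Prod>k<Suc (Suc n). G n k (\<lambda>i. w (t, k, i))) * h (Suc n) \<partial>perturb_space D)
      = (\<Prod>k<Suc (Suc n). \<integral>\<^sup>+r. G n k r \<partial>noise) * h (Suc n)"
      by (subst nn_integral_multc) (measurable, subst nn_integral_prod_slices, auto)
    also have "(\<Prod>k<Suc (Suc n). \<integral>\<^sup>+r. G n k r \<partial>noise) = ennreal (p * p * (1 - p) ^ n)"
    proof -
      have "(\<Prod>k<Suc (Suc n). \<integral>\<^sup>+r. G n k r \<partial>noise) = (\<Prod>k<Suc n. \<integral>\<^sup>+r. G n k r \<partial>noise) * ennreal p"
        by (subst prod.lessThan_Suc) (simp add: Gi)
      also have "(\<Prod>k<Suc n. \<integral>\<^sup>+r. G n k r \<partial>noise) = ennreal p * (\<Prod>k<n. ennreal (1 - p))"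
        by (subst prod.lessThan_Suc_shift) (simp add: Gi)
      finally show ?thesis
        using p by (simp add: ennreal_power ennreal_mult[symmetric] mult_ac)
    qed
    finally show ?thesis .
  qed
  show ?thesis
    unfolding K by (subst nn_integral_suminf) (measurable, simp only: I)
qed

text \<open>The counter is geometric with success probability p, restricted to the event of being
  played. The first moment is 1 if p > 0 but 0 if p = 0, hence an inequality and an identity
  weighted by p. For p > 0 the second moment is (2 - p) / p, so weighting by p gives at most
  2.\<close>

lemma
  fixes \<eta> :: real and L :: "nat \<Rightarrow> real"
  assumes m: "m \<le> d" and i: "i < d"
  defines "p \<equiv> phi d m \<eta> L i"
  shows nn_integral_gr_count_le:
      "(\<integral>\<^sup>+w. of_bool (i \<in> ftpl_action d m \<eta> L (\<lambda>i. w (t, 0, i)))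
            * of_nat (gr_count d m \<eta> L (\<lambda>k i. w (t, k, i)) i) \<partial>perturb_space D) \<le> 1"
    and nn_integral_gr_count_phi:
      "ennreal p * (\<integral>\<^sup>+w. of_bool (i \<in> ftpl_action d m \<eta> L (\<lambda>i. w (t, 0, i)))
            * of_nat (gr_count d m \<eta> L (\<lambda>k i. w (t, k, i)) i) \<partial>perturb_space D) = ennreal p"
    and nn_integral_gr_count_sq:
      "ennreal p * (\<integral>\<^sup>+w. of_bool (i \<in> ftpl_action d m \<eta> L (\<lambda>i. w (t, 0, i)))
            * (of_nat (gr_count d m \<eta> L (\<lambda>k i. w (t, k, i)) i))\<^sup>2 \<partial>perturb_space D) \<le> 2"
proof -
  have p: "0 \<le> p" "p \<le> 1" unfolding p_def by (simp_all add: phi_nonneg phi_le_1)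
  let ?I1 = "\<integral>\<^sup>+w. of_bool (i \<in> ftpl_action d m \<eta> L (\<lambda>i. w (t, 0, i)))
            * of_nat (gr_count d m \<eta> L (\<lambda>k i. w (t, k, i)) i) \<partial>perturb_space D"
  have I1: "?I1 = (\<Sum>n. ennreal (p * p * (1 - p) ^ n) * of_nat (Suc n))"
    unfolding p_def by (rule nn_integral_gr_count[OF m i]) simp
  have I1': "?I1 = (if p = 0 then 0 else 1)"
  proof (cases "p = 0")
    case False
    then have "(\<lambda>n. of_nat (Suc n) * (1 - p) ^ n) sums (1 / (1 - (1 - p))\<^sup>2)"
      using p by (intro geometric_deriv_sums) auto
    then have "(\<lambda>n. p * p * (of_nat (Suc n) * (1 - p) ^ n)) sums (p * p * (1 / (1 - (1 - p))\<^sup>2))"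
      by (rule sums_mult)
    then have s: "(\<lambda>n. p * p * (1 - p) ^ n * of_nat (Suc n)) sums 1"
      using False by (simp add: power2_eq_square mult_ac)
    have "?I1 = (\<Sum>n. ennreal (p * p * (1 - p) ^ n * of_nat (Suc n)))"
      unfolding I1 using p by (intro arg_cong[where f = suminf] ext) (subst ennreal_mult, auto simp del: of_nat_Suc simp: ennreal_of_nat_eq_real_of_nat)
    also have "\<dots> = ennreal 1"
      using s p by (intro suminf_ennreal_eq) auto
    finally show ?thesis using False by simp
  qed (simp add: I1)
  show "?I1 \<le> 1" by (simp add: I1')
  show "ennreal p * ?I1 = ennreal p" by (simp add: I1')
  let ?I2 = "\<integral>\<^sup>+w. of_bool (i \<in> ftpl_action d m \<eta> L (\<lambda>i. w (t, 0, i)))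
            * (of_nat (gr_count d m \<eta> L (\<lambda>k i. w (t, k, i)) i))\<^sup>2 \<partial>perturb_space D"
  have I2: "?I2 = (\<Sum>n. ennreal (p * p * (1 - p) ^ n) * (of_nat (Suc n))\<^sup>2)"
    unfolding p_def by (rule nn_integral_gr_count[OF m i, where h = "\<lambda>n. (of_nat n)\<^sup>2"]) simp
  have "ennreal p * ?I2 = (\<Sum>n. ennreal (p ^ 3 * ((real n + 1)\<^sup>2 * (1 - p) ^ n)))"
    unfolding I2 ennreal_suminf_cmult[symmetric]
  proof (intro arg_cong[where f = suminf] ext)
    fix n
    have e: "(of_nat (Suc n) :: ennreal)\<^sup>2 = ennreal ((real n + 1)\<^sup>2)"
      by (simp only: ennreal_of_nat_eq_real_of_nat ennreal_power[OF of_nat_0_le_iff]) (simp add: add.commute)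
    have "ennreal p * (ennreal (p * p * (1 - p) ^ n) * (of_nat (Suc n))\<^sup>2)
        = ennreal (p * (p * p * (1 - p) ^ n * (real n + 1)\<^sup>2))"
      unfolding e using p by (simp add: ennreal_mult)
    then show "ennreal p * (ennreal (p * p * (1 - p) ^ n) * (of_nat (Suc n))\<^sup>2)
        = ennreal (p ^ 3 * ((real n + 1)\<^sup>2 * (1 - p) ^ n))"
      by (simp add: power3_eq_cube mult_ac)
  qed
  also have "\<dots> \<le> 2"
  proof (rule suminf_le_const)
    fix N
    have "(\<Sum>n<N. ennreal (p ^ 3 * ((real n + 1)\<^sup>2 * (1 - p) ^ n)))
        = ennreal ((1 - (1 - p)) ^ 3 * (\<Sum>n<N. (real n + 1)\<^sup>2 * (1 - p) ^ n))"
      using p by (subst sum_ennreal) (auto simp: sum_distrib_left)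
    also have "\<dots> \<le> ennreal 2"
      using p by (intro ennreal_leI sum_squares_geometric_le) auto
    finally show "(\<Sum>n<N. ennreal (p ^ 3 * ((real n + 1)\<^sup>2 * (1 - p) ^ n))) \<le> 2" by simp
  qed simp
  finally show "ennreal p * ?I2 \<le> 2" .
qed

end

section \<open>The potential\<close>

definition loss_est :: "nat \<Rightarrow> nat \<Rightarrow> real \<Rightarrow> (nat \<Rightarrow> real) \<Rightarrow> (nat \<Rightarrow> real) \<Rightarrow> (nat \<Rightarrow> nat \<Rightarrow> real) \<Rightarrow> nat \<Rightarrow> real" where
  "loss_est d m \<eta> L l rs i = (if i \<in> ftpl_action d m \<eta> L (rs 0) then l i * real (gr_count d m \<eta> L rs i) else 0)"

lemma ftpl_state_Suc:
  "ftpl_state d m \<eta> adv w (Suc t) =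
    (\<lambda>i. fst (ftpl_state d m \<eta> adv w t) i
        + loss_est d m \<eta> (fst (ftpl_state d m \<eta> adv w t)) (adv (snd (ftpl_state d m \<eta> adv w t))) (\<lambda>k i. w (t, k, i)) i,
     snd (ftpl_state d m \<eta> adv w t)
        @ [(adv (snd (ftpl_state d m \<eta> adv w t)), ftpl_action d m \<eta> (fst (ftpl_state d m \<eta> adv w t)) (\<lambda>i. w (t, 0, i)))])"
  by (simp add: case_prod_beta Let_def loss_est_def fun_eq_iff)

text \<open>This is what makes the randomness of round t fresh: redrawing it does not affect the
  state before that round.\<close>

lemma ftpl_state_cong:
  assumes "\<And>s k i. s < t \<Longrightarrow> w (s, k, i) = w' (s, k, i)"
  shows "ftpl_state d m \<eta> adv w t = ftpl_state d m \<eta> adv w' t"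
  using assms
proof (induction t)
  case (Suc t)
  have "ftpl_state d m \<eta> adv w t = ftpl_state d m \<eta> adv w' t"
    by (rule Suc.IH) (simp add: Suc.prems)
  moreover have "(\<lambda>k i. w (t, k, i)) = (\<lambda>k i. w' (t, k, i))" "(\<lambda>i. w (t, 0, i)) = (\<lambda>i. w' (t, 0, i))"
    by (simp_all add: Suc.prems)
  ultimately show ?case unfolding ftpl_state_Suc by simp
qed simp

lemma loss_est_nonneg:
  assumes "m \<le> d" "\<And>i. i < d \<Longrightarrow> 0 \<le> l i"
  shows "0 \<le> loss_est d m \<eta> L l rs i"
  using actionsD(1)[OF ftpl_action_in[OF assms(1), of \<eta> L "rs 0"]] assms(2)
  by (auto simp: loss_est_def)

lemma ftpl_state_nonneg:
  assumes "m \<le> d" "\<And>h i. i < d \<Longrightarrow> 0 \<le> adv h i"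
  shows "0 \<le> fst (ftpl_state d m \<eta> adv w t) i"
proof (induction t)
  case (Suc t)
  then show ?case unfolding ftpl_state_Suc by (simp add: loss_est_nonneg[OF assms])
qed simp

text \<open>Remove an element of largest \<theta>: its rank is the cardinality. The ranks of the
  others within the smaller set are no larger, and g is antitone. Ties only push ranks above the
  sorted positions 1, 2, ..., which cannot increase g.\<close>

lemma sum_rank_le:
  fixes \<theta> :: "nat \<Rightarrow> real" and g :: "nat \<Rightarrow> real"
  assumes "finite A" and g: "\<And>a b. 1 \<le> a \<Longrightarrow> a \<le> b \<Longrightarrow> g b \<le> g a"
  shows "(\<Sum>i\<in>A. g (card {j \<in> A. \<theta> j \<le> \<theta> i})) \<le> (\<Sum>k=1..card A. g k)"
  using \<open>finite A\<close>
proof (induction "card A" arbitrary: A)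
  case 0
  then show ?case by simp
next
  case (Suc n A)
  then have ne: "A \<noteq> {}" and fin: "finite A" by auto
  have "Max (\<theta> ` A) \<in> \<theta> ` A" using fin ne by (intro Max_in) auto
  then obtain x where x0: "x \<in> A" "\<theta> x = Max (\<theta> ` A)" by (metis imageE)
  have x: "x \<in> A" "\<And>j. j \<in> A \<Longrightarrow> \<theta> j \<le> \<theta> x"
    using x0 fin by auto
  have cA: "card (A - {x}) = n" using Suc.hyps(2) x fin by simp
  have "(\<Sum>i\<in>A. g (card {j \<in> A. \<theta> j \<le> \<theta> i}))
      = g (card {j \<in> A. \<theta> j \<le> \<theta> x}) + (\<Sum>i\<in>A - {x}. g (card {j \<in> A. \<theta> j \<le> \<theta> i}))"
    using fin x(1) by (rule sum.remove)
  also have "{j \<in> A. \<theta> j \<le> \<theta> x} = A" using x by auto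
  also have "(\<Sum>i\<in>A - {x}. g (card {j \<in> A. \<theta> j \<le> \<theta> i}))
      \<le> (\<Sum>i\<in>A - {x}. g (card {j \<in> A - {x}. \<theta> j \<le> \<theta> i}))"
  proof (intro sum_mono g)
    fix i assume i: "i \<in> A - {x}"
    then have "{j \<in> A - {x}. \<theta> j \<le> \<theta> i} \<noteq> {}" by auto
    then show "1 \<le> card {j \<in> A - {x}. \<theta> j \<le> \<theta> i}"
      using fin by (simp add: Suc_le_eq card_gt_0_iff)
    show "card {j \<in> A - {x}. \<theta> j \<le> \<theta> i} \<le> card {j \<in> A. \<theta> j \<le> \<theta> i}"
      using fin by (intro card_mono) auto
  qed
  also have "\<dots> \<le> (\<Sum>k=1..card (A - {x}). g k)"
    by (rule Suc.hyps(1)) (use cA fin in auto)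
  finally show ?case
    using Suc.hyps(2)[symmetric] cA by simp
qed

context perturbation
begin

section \<open>The expected minimum as a function of the estimates\<close>

definition best :: "nat \<Rightarrow> nat \<Rightarrow> real \<Rightarrow> (nat \<Rightarrow> real) \<Rightarrow> (nat \<Rightarrow> real) \<Rightarrow> real" where
  "best d m \<eta> L r = (\<Sum>i\<in>ftpl_action d m \<eta> L r. \<eta> * L i - r i)"

definition expected_best :: "nat \<Rightarrow> nat \<Rightarrow> real \<Rightarrow> (nat \<Rightarrow> real) \<Rightarrow> real" where
  "expected_best d m \<eta> L = (\<integral>r. best d m \<eta> L r \<partial>noise)"

lemma best_le:
  assumes "m \<le> d" "a \<in> actions d m"
  shows "best d m \<eta> L r \<le> (\<Sum>i\<in>a. \<eta> * L i - r i)"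
  unfolding best_def by (rule ftpl_action_le[OF assms])

lemma integrable_noise_component:
  fixes g :: "real \<Rightarrow> real"
  assumes "integrable D g"
  shows "integrable noise (\<lambda>r. g (r i))"
  using assms by (intro integral_PiM_component(2)[OF prob_D]) auto

lemma integrable_best:
  assumes m: "m \<le> d"
  shows "integrable noise (best d m \<eta> L)"
proof (rule Bochner_Integration.integrable_bound)
  show "integrable noise (\<lambda>r. \<Sum>i<d. \<bar>\<eta> * L i\<bar> + \<bar>r i\<bar>)"
    using integrable_noise_component[OF integrable_abs[OF integrable_id]]
    by (intro Bochner_Integration.integrable_sum Bochner_Integration.integrable_add) auto
  show "best d m \<eta> L \<in> borel_measurable noise"
    unfolding best_def
    by (rule measurable_compose_countable'[OF _ measurable_ftpl_action[OF m]])
       (auto intro: countable_finite finite_actions)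
  show "AE r in noise. norm (best d m \<eta> L r) \<le> norm (\<Sum>i<d. \<bar>\<eta> * L i\<bar> + \<bar>r i\<bar>)"
  proof (rule AE_I2)
    fix r
    note a = actionsD[OF ftpl_action_in[OF m, of \<eta> L r]]
    have "\<bar>best d m \<eta> L r\<bar> \<le> (\<Sum>i\<in>ftpl_action d m \<eta> L r. \<bar>\<eta> * L i - r i\<bar>)"
      unfolding best_def by (rule sum_abs)
    also have "\<dots> \<le> (\<Sum>i\<in>ftpl_action d m \<eta> L r. \<bar>\<eta> * L i\<bar> + \<bar>r i\<bar>)"
      by (intro sum_mono) (simp add: abs_triangle_ineq4)
    also have "\<dots> \<le> (\<Sum>i<d. \<bar>\<eta> * L i\<bar> + \<bar>r i\<bar>)"
      using a by (intro sum_mono2) auto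
    finally show "norm (best d m \<eta> L r) \<le> norm (\<Sum>i<d. \<bar>\<eta> * L i\<bar> + \<bar>r i\<bar>)" by simp
  qed
qed

text \<open>The noise is almost surely positive, so dropping it from the cost of a fixed action only
  increases that cost.\<close>

lemma expected_best_le:
  assumes m: "m \<le> d" and a: "a \<in> actions d m"
  shows "expected_best d m \<eta> L \<le> \<eta> * (\<Sum>i\<in>a. L i)"
proof -
  have "AE r in noise. 0 < r i" for i
    by (rule AE_PiM_component[of UNIV "\<lambda>_. D"]) (auto intro: prob_D AE_pos)
  then have pos: "AE r in noise. \<forall>i\<in>a. 0 < r i"
    using actionsD(3)[OF a] by (intro AE_finite_allI) auto
  have "expected_best d m \<eta> L \<le> (\<integral>r. \<eta> * (\<Sum>i\<in>a. L i) \<partial>noise)"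
    unfolding expected_best_def
  proof (rule integral_mono_AE)
    show "AE r in noise. best d m \<eta> L r \<le> \<eta> * (\<Sum>i\<in>a. L i)"
      using pos
    proof eventually_elim
      case (elim r)
      have "best d m \<eta> L r \<le> (\<Sum>i\<in>a. \<eta> * L i - r i)" by (rule best_le[OF m a])
      also have "\<dots> \<le> (\<Sum>i\<in>a. \<eta> * L i)" using elim by (intro sum_mono) force
      finally show ?case by (simp add: sum_distrib_left)
    qed
  qed (auto intro: integrable_best m)
  then show ?thesis by (simp add: noise.prob_space)
qed

text \<open>A chosen coordinate is at most c plus its excess over c; there are m of them, and their
  excesses are bounded by those of all d coordinates. This avoids computing expectations of order
  statistics and leaves c to be optimised later.\<close>

lemma expected_best_0_ge:
  assumes m: "m \<le> d" and c: "0 < c"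
  shows "- (real m * c + real d * (c powr (1 - \<alpha>) / (\<alpha> - 1))) \<le> expected_best d m \<eta> (\<lambda>_. 0)"
proof -
  note i = integrable_noise_component[OF integral_excess(1)[OF c]]
  have e: "(\<integral>r. max 0 (r i - c) \<partial>noise) \<le> c powr (1 - \<alpha>) / (\<alpha> - 1)" for i
    by (subst integral_PiM_component(1)[OF prob_D, of "\<lambda>x. max 0 (x - c)"]) (use integral_excess[OF c] in \<open>simp_all add: borel_measurable_integrable\<close>)
  have "- (real m * c + real d * (c powr (1 - \<alpha>) / (\<alpha> - 1)))
      \<le> - (real m * c + (\<Sum>i<d. \<integral>r. max 0 (r i - c) \<partial>noise))"
    using sum_mono[of "{..<d}", OF e] by simp
  also have "\<dots> = (\<integral>r. - (real m * c + (\<Sum>i<d. max 0 (r i - c))) \<partial>noise)"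
    using i by (simp add: noise.prob_space)
  also have "\<dots> \<le> expected_best d m \<eta> (\<lambda>_. 0)"
    unfolding expected_best_def
  proof (intro integral_mono integrable_best m)
    show "integrable noise (\<lambda>r. - (real m * c + (\<Sum>i<d. max 0 (r i - c))))"
      using i by (intro Bochner_Integration.integrable_minus Bochner_Integration.integrable_add
          Bochner_Integration.integrable_sum) auto
    fix r
    let ?a = "ftpl_action d m \<eta> (\<lambda>_. 0) r"
    note a = actionsD[OF ftpl_action_in[OF m, of \<eta> "\<lambda>_. 0" r]]
    have "- (real m * c + (\<Sum>i<d. max 0 (r i - c))) \<le> - (real m * c + (\<Sum>i\<in>?a. max 0 (r i - c)))"
      using sum_mono2[of "{..<d}" ?a "\<lambda>i. max 0 (r i - c)"] a by simp
    also have "\<dots> = (\<Sum>i\<in>?a. - (c + max 0 (r i - c)))"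
      using a by (simp add: sum_negf sum.distrib sum_subtractf)
    also have "\<dots> \<le> best d m \<eta> (\<lambda>_. 0) r"
      unfolding best_def by (intro sum_mono) auto
    finally show "- (real m * c + (\<Sum>i<d. max 0 (r i - c))) \<le> best d m \<eta> (\<lambda>_. 0) r" .
  qed
  finally show ?thesis .
qed

lemma sum_action:
  fixes g :: "nat \<Rightarrow> 'b::comm_semiring_1"
  assumes m: "m \<le> d"
  shows "(\<Sum>i\<in>ftpl_action d m \<eta> L r. g i) = (\<Sum>i<d. g i * of_bool (i \<in> ftpl_action d m \<eta> L r))"
proof -
  note a = actionsD[OF ftpl_action_in[OF m, of \<eta> L r]]
  have "(\<Sum>i\<in>ftpl_action d m \<eta> L r. g i) = (\<Sum>i\<in>ftpl_action d m \<eta> L r. g i * of_bool (i \<in> ftpl_action d m \<eta> L r))"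
    by (intro sum.cong) auto
  also have "\<dots> = (\<Sum>i<d. g i * of_bool (i \<in> ftpl_action d m \<eta> L r))"
    using a by (intro sum.mono_neutral_left) auto
  finally show ?thesis .
qed

text \<open>Supergradient inequality for a minimum of affine functions, with slope at the new point:
  the leader for the new estimates is one candidate among the actions at the old ones.\<close>

lemma expected_best_add_ge:
  assumes m: "m \<le> d" and e: "\<And>i. 0 \<le> e i"
  shows "expected_best d m \<eta> L + \<eta> * (\<Sum>i<d. e i * phi d m \<eta> (\<lambda>i. L i + e i) i) \<le> expected_best d m \<eta> (\<lambda>i. L i + e i)"
proof -
  let ?L' = "\<lambda>i. L i + e i"
  note [measurable] = measurable_action_mem[OF m]
  define b :: "nat \<Rightarrow> (nat \<Rightarrow> real) \<Rightarrow> real" where "b i r = of_bool (i \<in> ftpl_action d m \<eta> ?L' r)" for i r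
  have int: "integrable noise (b i)" for i
    unfolding b_def by (rule integrable_noise_unit) auto
  have phi: "(\<integral>r. b i r \<partial>noise) = phi d m \<eta> ?L' i" if "i < d" for i
    unfolding b_def by (rule integral_action_mem[OF m that])
  have "expected_best d m \<eta> L + \<eta> * (\<Sum>i<d. e i * phi d m \<eta> ?L' i)
    = (\<integral>r. best d m \<eta> L r + \<eta> * (\<Sum>i<d. e i * b i r) \<partial>noise)"
    unfolding expected_best_def using int integrable_best[OF m]
    by (subst Bochner_Integration.integral_add) (auto simp: phi)
  also have "\<dots> \<le> expected_best d m \<eta> ?L'"
    unfolding expected_best_def
  proof (intro integral_mono integrable_best m Bochner_Integration.integrable_add integrable_mult_right
      Bochner_Integration.integrable_sum int)
    fix r
    have "best d m \<eta> L r + \<eta> * (\<Sum>i<d. e i * b i r)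
      = best d m \<eta> L r + (\<Sum>i\<in>ftpl_action d m \<eta> ?L' r. \<eta> * e i)"
      by (simp add: sum_action[OF m, of e] b_def flip: sum_distrib_left)
    also have "\<dots> \<le> (\<Sum>i\<in>ftpl_action d m \<eta> ?L' r. \<eta> * L i - r i) + (\<Sum>i\<in>ftpl_action d m \<eta> ?L' r. \<eta> * e i)"
      using best_le[OF m ftpl_action_in[OF m]] by simp
    also have "\<dots> = best d m \<eta> ?L' r"
      unfolding best_def by (simp add: sum.distrib[symmetric] algebra_simps)
    finally show "best d m \<eta> L r + \<eta> * (\<Sum>i<d. e i * b i r) \<le> best d m \<eta> ?L' r" .
  qed
  finally show ?thesis .
qed

text \<open>For fixed noise the larger competing estimates help arm i, and its own increment loses
  at most the mass bounded in \<open>measure_upset_shift\<close>.\<close>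

lemma phi_stable:
  assumes e: "\<And>i. 0 \<le> e i" and \<eta>: "0 \<le> \<eta>"
  shows "phi d m \<eta> L i \<le> phi d m \<eta> (\<lambda>i. L i + e i) i
    + \<alpha> * (\<eta> * e i) * (\<integral>r. U d m (\<lambda>i. \<eta> * L i) i r powr (1 + 1/\<alpha>) \<partial>noise)"
proof -
  let ?U = "U d m (\<lambda>i. \<eta> * L i) i" and ?U' = "U d m (\<lambda>i. \<eta> * (L i + e i)) i"
  have ip: "integrable noise (\<lambda>r. ?U r powr (1 + 1/\<alpha>))"
    using alpha by (intro integrable_noise_unit powr_le1) (auto simp: U_nonneg U_le_1)
  have "phi d m \<eta> L i \<le> (\<integral>r. ?U' r + \<alpha> * (\<eta> * e i) * ?U r powr (1 + 1/\<alpha>) \<partial>noise)"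
    unfolding phi_def
  proof (intro integral_mono integrable_U Bochner_Integration.integrable_add integrable_mult_right ip)
    fix r
    let ?I = "sel d m (\<lambda>i. \<eta> * L i) i r"
    have "measure D ?I - measure D {x. x - \<eta> * e i \<in> ?I} \<le> \<alpha> * (\<eta> * e i) * measure D ?I powr (1 + 1/\<alpha>)"
      using e \<eta> by (intro measure_upset_shift upset_sel) auto
    moreover have "measure D {x. x - \<eta> * e i \<in> ?I} \<le> ?U' r"
      unfolding U_def using e \<eta>
      by (intro D.finite_measure_mono sel_shift)
         (auto intro!: mult_left_mono upset_borel upset_sel simp: distrib_left)
    ultimately show "?U r \<le> ?U' r + \<alpha> * (\<eta> * e i) * ?U r powr (1 + 1/\<alpha>)"
      by (simp add: U_def)
  qed
  also have "\<dots> = phi d m \<eta> (\<lambda>i. L i + e i) i + \<alpha> * (\<eta> * e i) * (\<integral>r. ?U r powr (1 + 1/\<alpha>) \<partial>noise)"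
    unfolding phi_def using ip integrable_U by (subst Bochner_Integration.integral_add) auto
  finally show ?thesis .
qed

text \<open>Subtracting the value at zero estimates makes the potential nonnegative at nonnegative
  estimates; the penalty then surfaces only in the upper bound \<open>potential_le\<close>.\<close>

definition potential :: "nat \<Rightarrow> nat \<Rightarrow> real \<Rightarrow> (nat \<Rightarrow> real) \<Rightarrow> real" where
  "potential d m \<eta> L = (expected_best d m \<eta> L - expected_best d m \<eta> (\<lambda>_. 0)) / \<eta>"

definition rank_coeff :: "nat \<Rightarrow> nat \<Rightarrow> real" where
  "rank_coeff m k = min 1 (2 * real m / real k) powr (1/\<alpha>)"

lemma potential_nonneg:
  assumes m: "m \<le> d" and \<eta>: "0 < \<eta>" and L: "\<And>i. 0 \<le> L i"
  shows "0 \<le> potential d m \<eta> L"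
proof -
  have "0 \<le> \<eta> * (\<Sum>i<d. L i * phi d m \<eta> (\<lambda>i. 0 + L i) i)"
    using \<eta> L phi_nonneg by (intro mult_nonneg_nonneg sum_nonneg) auto
  then have "expected_best d m \<eta> (\<lambda>_. 0) \<le> expected_best d m \<eta> L"
    using expected_best_add_ge[of m d L \<eta> "\<lambda>_. 0", OF m L] by simp
  then show ?thesis using \<eta> by (simp add: potential_def)
qed

text \<open>The supergradient inequality yields selection probabilities at the new estimates.
  Returning to the old ones costs \<open>e i\<close> times a drop that is linear in
  \<open>e i\<close>, hence the quadratic term. By \<open>moment_U\<close> it carries a factor
  \<open>phi d m \<eta> L i\<close>, which cancels the reciprocal in the second moment of the
  estimated loss.\<close>

lemma potential_add_ge:
  assumes m: "1 \<le> m" "m \<le> d" and \<eta>: "0 < \<eta>" and e: "\<And>i. 0 \<le> e i"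
  shows "potential d m \<eta> L + (\<Sum>i<d. e i * phi d m \<eta> L i) \<le> potential d m \<eta> (\<lambda>i. L i + e i)
    + (\<Sum>i<d. \<alpha> * \<eta> * rank_coeff m (card {j \<in> {..<d}. \<eta> * L j \<le> \<eta> * L i}) * (phi d m \<eta> L i * (e i)\<^sup>2))"
proof -
  let ?c = "\<lambda>i. rank_coeff m (card {j \<in> {..<d}. \<eta> * L j \<le> \<eta> * L i})"
  have "potential d m \<eta> L + (\<Sum>i<d. e i * phi d m \<eta> (\<lambda>i. L i + e i) i) \<le> potential d m \<eta> (\<lambda>i. L i + e i)"
  proof -
    let ?S = "\<Sum>i<d. e i * phi d m \<eta> (\<lambda>i. L i + e i) i"
    have "potential d m \<eta> L + ?S = (expected_best d m \<eta> L + \<eta> * ?S - expected_best d m \<eta> (\<lambda>_. 0)) / \<eta>"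
      using \<eta> by (simp add: potential_def field_simps)
    also have "\<dots> \<le> potential d m \<eta> (\<lambda>i. L i + e i)"
      unfolding potential_def using \<eta> expected_best_add_ge[of m d e \<eta> L, OF m(2) e] by (intro divide_right_mono) auto
    finally show ?thesis .
  qed
  moreover have "(\<Sum>i<d. e i * phi d m \<eta> L i)
      \<le> (\<Sum>i<d. e i * phi d m \<eta> (\<lambda>i. L i + e i) i) + (\<Sum>i<d. \<alpha> * \<eta> * ?c i * (phi d m \<eta> L i * (e i)\<^sup>2))"
    unfolding sum.distrib[symmetric]
  proof (rule sum_mono)
    fix i assume i: "i \<in> {..<d}"
    let ?M = "\<integral>r. U d m (\<lambda>i. \<eta> * L i) i r powr (1 + 1/\<alpha>) \<partial>noise"
    have "phi d m \<eta> L i \<le> phi d m \<eta> (\<lambda>i. L i + e i) i + \<alpha> * (\<eta> * e i) * ?M"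
      by (rule phi_stable[OF e]) (use \<eta> in simp)
    also have "\<alpha> * (\<eta> * e i) * ?M \<le> \<alpha> * (\<eta> * e i) * (?c i * phi d m \<eta> L i)"
      using moment_U[OF m(1), of i d "\<lambda>i. \<eta> * L i"] i e[of i] \<eta> alpha
      by (intro mult_left_mono) (auto simp: phi_def rank_coeff_def)
    finally have "e i * phi d m \<eta> L i
        \<le> e i * (phi d m \<eta> (\<lambda>i. L i + e i) i + \<alpha> * (\<eta> * e i) * (?c i * phi d m \<eta> L i))"
      using e[of i] by (intro mult_left_mono) auto
    then show "e i * phi d m \<eta> L i \<le> e i * phi d m \<eta> (\<lambda>i. L i + e i) i + \<alpha> * \<eta> * ?c i * (phi d m \<eta> L i * (e i)\<^sup>2)"
      by (simp add: algebra_simps power2_eq_square)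
  qed
  ultimately show ?thesis by linarith
qed

lemma potential_le:
  assumes m: "m \<le> d" and a: "a \<in> actions d m" and c: "0 < c" and \<eta>: "0 < \<eta>"
  shows "potential d m \<eta> L \<le> (\<Sum>i\<in>a. L i) + (real m * c + real d * (c powr (1 - \<alpha>) / (\<alpha> - 1))) / \<eta>"
proof -
  let ?A = "real m * c + real d * (c powr (1 - \<alpha>) / (\<alpha> - 1))"
  have "potential d m \<eta> L \<le> (\<eta> * (\<Sum>i\<in>a. L i) + ?A) / \<eta>"
    unfolding potential_def using expected_best_le[OF m a, of \<eta> L] expected_best_0_ge[OF m c, of \<eta>] \<eta>
    by (intro divide_right_mono) linarith+
  also have "\<dots> = (\<Sum>i\<in>a. L i) + ?A / \<eta>"
    using \<eta> by (simp add: add_divide_distrib)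
  finally show ?thesis .
qed

end

section \<open>The regret bound\<close>

context perturbation
begin

abbreviation round_noise :: "(nat \<times> nat \<times> nat \<Rightarrow> real) \<Rightarrow> nat \<Rightarrow> nat \<Rightarrow> nat \<Rightarrow> real" where
  "round_noise w t \<equiv> \<lambda>k i. w (t, k, i)"

section \<open>Measurability of rounds and states, and conditioning on the past\<close>

lemma measurable_gr_count:
  assumes m: "m \<le> d"
  shows "(\<lambda>w. gr_count d m \<eta> L (round_noise w t) i) \<in> measurable (perturb_space D) (count_space UNIV)"
proof -
  note [measurable] = measurable_action_mem[OF m]
  show ?thesis unfolding gr_count_def by measurable
qed

text \<open>The counters are stored as a list, not as a function, so that a round takes values in a
  countable set; every function of it, such as one involving the adversary, is then
  measurable.\<close>

lemma measurable_round:
  assumes m: "m \<le> d"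
  shows "(\<lambda>w. (ftpl_action d m \<eta> L (round_noise w t 0), map (gr_count d m \<eta> L (round_noise w t)) [0..<d]))
    \<in> measurable (perturb_space D) (count_space (actions d m \<times> UNIV))"
proof -
  note [measurable] = measurable_gr_count[OF m]
  have [measurable]: "(\<lambda>w. ftpl_action d m \<eta> L (round_noise w t 0)) \<in> measurable (perturb_space D) (count_space UNIV)"
    by (rule measurable_compose[OF measurable_ftpl_action[OF m]]) auto
  have cnt: "countable (actions d m \<times> (UNIV :: nat list set))"
    by (intro countable_SIGMA countable_finite[OF finite_actions] countableI_type)
  show ?thesis
  proof (subst measurable_count_space_eq_countable[OF cnt], intro conjI ballI)
    have map_upt_eq: "map f [0..<d] = ks \<longleftrightarrow> length ks = d \<and> (\<forall>i<d. f i = ks ! i)" for f :: "nat \<Rightarrow> nat" and ks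
      unfolding list_eq_iff_nth_eq by auto
    fix p :: "nat set \<times> nat list"
    obtain a ks where p: "p = (a, ks)" by fastforce
    have "(\<lambda>w. (ftpl_action d m \<eta> L (round_noise w t 0), map (gr_count d m \<eta> L (round_noise w t)) [0..<d])) -` {p}
        \<inter> space (perturb_space D)
      = {w \<in> space (perturb_space D). ftpl_action d m \<eta> L (round_noise w t 0) = a \<and> length ks = d
          \<and> (\<forall>i<d. gr_count d m \<eta> L (round_noise w t) i = ks ! i)}"
      by (simp only: p vimage_singleton_eq prod.inject map_upt_eq set_eq_iff Int_iff mem_Collect_eq) blast
    also have "\<dots> \<in> sets (perturb_space D)"
      by measurable
    finally show "(\<lambda>w. (ftpl_action d m \<eta> L (round_noise w t 0), map (gr_count d m \<eta> L (round_noise w t)) [0..<d])) -` {p}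
        \<inter> space (perturb_space D) \<in> sets (perturb_space D)" .
  qed (auto simp: ftpl_action_in[OF m])
qed

lemma loss_est_decode:
  assumes "m \<le> d"
  shows "loss_est d m \<eta> L l rs
    = (\<lambda>i. if i \<in> ftpl_action d m \<eta> L (rs 0) then l i * real (map (gr_count d m \<eta> L rs) [0..<d] ! i) else 0)"
  using actionsD(1)[OF ftpl_action_in[OF assms, of \<eta> L "rs 0"]]
  by (auto simp: loss_est_def fun_eq_iff)

lemma measurable_round_fun:
  assumes m: "m \<le> d" and G: "\<And>a e. a \<in> actions d m \<Longrightarrow> G a e \<in> space N"
  shows "(\<lambda>w. G (ftpl_action d m \<eta> L (round_noise w t 0)) (loss_est d m \<eta> L l (round_noise w t)))
    \<in> measurable (perturb_space D) N"
  unfolding loss_est_decode[OF m]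
  by (rule measurable_compose[OF measurable_round[OF m],
        of "\<lambda>(a, ks). G a (\<lambda>i. if i \<in> a then l i * real (ks ! i) else 0)" N, unfolded prod.case])
     (auto intro: G)

lemma ftpl_state_countable:
  assumes m: "m \<le> d"
  shows "\<exists>C. countable C \<and> (\<lambda>w. ftpl_state d m \<eta> adv w t) \<in> measurable (perturb_space D) (count_space C)"
proof (induction t)
  case 0
  show ?case by (intro exI[of _ "{(\<lambda>_. 0, [])}"]) simp
next
  case (Suc t)
  then obtain C where C: "countable C"
    "(\<lambda>w. ftpl_state d m \<eta> adv w t) \<in> measurable (perturb_space D) (count_space C)" by blast
  define H where "H c a e = ((\<lambda>i. fst c i + e i), snd c @ [(adv (snd c), a)])"
    for c :: "(nat \<Rightarrow> real) \<times> hist" and a e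
  define H' where "H' c p = H c (fst p) (\<lambda>i. if i \<in> fst p then adv (snd c) i * real (snd p ! i) else 0)"
    for c :: "(nat \<Rightarrow> real) \<times> hist" and p
  define C' where "C' = (\<Union>c\<in>C. H' c ` (actions d m \<times> (UNIV :: nat list set)))"
  have "countable C'"
    unfolding C'_def
    by (intro countable_UN C countable_image countable_SIGMA countable_finite[OF finite_actions] countableI_type)
  moreover have "(\<lambda>w. ftpl_state d m \<eta> adv w (Suc t)) \<in> measurable (perturb_space D) (count_space C')"
  proof -
    have "(\<lambda>w. ftpl_state d m \<eta> adv w (Suc t)) = (\<lambda>w. H' (ftpl_state d m \<eta> adv w t)
      (ftpl_action d m \<eta> (fst (ftpl_state d m \<eta> adv w t)) (round_noise w t 0),
       map (gr_count d m \<eta> (fst (ftpl_state d m \<eta> adv w t)) (round_noise w t)) [0..<d]))"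
      unfolding ftpl_state_Suc loss_est_decode[OF m] H'_def H_def fst_conv snd_conv by (rule refl)
    also have "\<dots> \<in> measurable (perturb_space D) (count_space C')"
    proof (rule measurable_compose_countable'[OF _ C(2,1)])
      fix c assume c: "c \<in> C"
      show "(\<lambda>w. H' c (ftpl_action d m \<eta> (fst c) (round_noise w t 0),
          map (gr_count d m \<eta> (fst c) (round_noise w t)) [0..<d])) \<in> measurable (perturb_space D) (count_space C')"
        by (rule measurable_compose[OF measurable_round[OF m]]) (use c in \<open>auto simp: C'_def\<close>)
    qed
    finally show ?thesis .
  qed
  ultimately show ?case by blast
qed

lemma measurable_state_compose:
  assumes m: "m \<le> d" and F: "\<And>c. (\<lambda>w. F c w) \<in> measurable (perturb_space D) N"
  shows "(\<lambda>w. F (ftpl_state d m \<eta> adv w t) w) \<in> measurable (perturb_space D) N"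
proof -
  obtain C where "countable C"
    "(\<lambda>w. ftpl_state d m \<eta> adv w t) \<in> measurable (perturb_space D) (count_space C)"
    using ftpl_state_countable[OF m] by blast
  then show ?thesis by (intro measurable_compose_countable'[OF F])
qed

lemma measurable_state_fun:
  assumes m: "m \<le> d" and F: "\<And>c. F c \<in> space N"
  shows "(\<lambda>w. F (ftpl_state d m \<eta> adv w t)) \<in> measurable (perturb_space D) N"
  by (rule measurable_state_compose[OF m]) (simp add: F)

text \<open>Conditioning on the past: redrawing all coordinates of round t leaves the state before t
  unchanged, so that state can be held fixed in the inner integral.\<close>

lemma nn_integral_round:
  assumes m: "m \<le> d"
    and G: "\<And>c. (\<lambda>w. G c (round_noise w t)) \<in> borel_measurable (perturb_space D)"
  shows "(\<integral>\<^sup>+w. G (ftpl_state d m \<eta> adv w t) (round_noise w t) \<partial>perturb_space D)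
    = (\<integral>\<^sup>+w. (\<integral>\<^sup>+v. G (ftpl_state d m \<eta> adv w t) (round_noise v t) \<partial>perturb_space D) \<partial>perturb_space D)"
proof -
  define J where "J = {t} \<times> (UNIV :: (nat \<times> nat) set)"
  have st: "ftpl_state d m \<eta> adv (\<lambda>k. if k \<in> J then v k else w k) t = ftpl_state d m \<eta> adv w t" for v w
    by (rule ftpl_state_cong) (auto simp: J_def)
  have rn: "round_noise (\<lambda>k. if k \<in> J then v k else w k) t = round_noise v t" for v w :: "nat \<times> nat \<times> nat \<Rightarrow> real"
    by (auto simp: J_def)
  have "(\<lambda>w. G (ftpl_state d m \<eta> adv w t) (round_noise w t)) \<in> borel_measurable (perturb_space D)"
    by (rule measurable_state_compose[OF m]) (rule G)
  then have "(\<integral>\<^sup>+w. G (ftpl_state d m \<eta> adv w t) (round_noise w t) \<partial>perturb_space D)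
    = (\<integral>\<^sup>+w. (\<integral>\<^sup>+v. G (ftpl_state d m \<eta> adv (\<lambda>k. if k \<in> J then v k else w k) t)
        (round_noise (\<lambda>k. if k \<in> J then v k else w k) t) \<partial>perturb_space D) \<partial>perturb_space D)"
    unfolding perturb_space_def by (rule nn_integral_resample[OF prob_D])
  then show ?thesis unfolding st rn .
qed

section \<open>Conditional expectations within one round\<close>

lemma nn_integral_action_loss:
  assumes m: "m \<le> d" and l: "\<And>i. i < d \<Longrightarrow> 0 \<le> l i"
  shows "(\<integral>\<^sup>+v. (\<Sum>i\<in>ftpl_action d m \<eta> L (round_noise v t 0). ennreal (l i)) \<partial>perturb_space D)
    = ennreal (\<Sum>i<d. l i * phi d m \<eta> L i)"
proof -
  note [measurable] = measurable_action_mem[OF m]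
  have "(\<integral>\<^sup>+v. (\<Sum>i\<in>ftpl_action d m \<eta> L (round_noise v t 0). ennreal (l i)) \<partial>perturb_space D)
    = (\<Sum>i<d. \<integral>\<^sup>+v. ennreal (l i) * of_bool (i \<in> ftpl_action d m \<eta> L (round_noise v t 0)) \<partial>perturb_space D)"
    unfolding sum_action[OF m] by (rule nn_integral_sum) measurable
  also have "\<dots> = (\<Sum>i<d. ennreal (l i * phi d m \<eta> L i))"
  proof (rule sum.cong[OF refl])
    fix i assume i: "i \<in> {..<d}"
    have "(\<integral>\<^sup>+v. ennreal (l i) * of_bool (i \<in> ftpl_action d m \<eta> L (round_noise v t 0)) \<partial>perturb_space D)
      = ennreal (l i) * (\<integral>\<^sup>+v. of_bool (i \<in> ftpl_action d m \<eta> L (round_noise v t 0)) \<partial>perturb_space D)"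
      by (rule nn_integral_cmult) measurable
    also have "(\<integral>\<^sup>+v. of_bool (i \<in> ftpl_action d m \<eta> L (round_noise v t 0)) \<partial>perturb_space D)
        = ennreal (phi d m \<eta> L i)"
      using nn_integral_slice[of "\<lambda>r. of_bool (i \<in> ftpl_action d m \<eta> L r)" t 0]
        nn_integral_action_mem[OF m, of i \<eta> L] i by simp
    finally show "(\<integral>\<^sup>+v. ennreal (l i) * of_bool (i \<in> ftpl_action d m \<eta> L (round_noise v t 0)) \<partial>perturb_space D)
        = ennreal (l i * phi d m \<eta> L i)"
      using i l phi_nonneg by (simp add: ennreal_mult)
  qed
  also have "\<dots> = ennreal (\<Sum>i<d. l i * phi d m \<eta> L i)"
    using l phi_nonneg by (intro sum_ennreal) auto
  finally show ?thesis .
qed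

lemma loss_est_ennreal:
  assumes "0 \<le> l i"
  shows "ennreal (loss_est d m \<eta> L l rs i)
      = ennreal (l i) * (of_bool (i \<in> ftpl_action d m \<eta> L (rs 0)) * of_nat (gr_count d m \<eta> L rs i))"
    and "ennreal ((loss_est d m \<eta> L l rs i)\<^sup>2)
      = ennreal ((l i)\<^sup>2) * (of_bool (i \<in> ftpl_action d m \<eta> L (rs 0)) * (of_nat (gr_count d m \<eta> L rs i))\<^sup>2)"
  using assms
  by (auto simp: loss_est_def ennreal_mult ennreal_of_nat_eq_real_of_nat power_mult_distrib ennreal_power)

lemma measurable_gr_weight:
  assumes m: "m \<le> d"
  shows "(\<lambda>w. of_bool (i \<in> ftpl_action d m \<eta> L (round_noise w t 0))
      * (h (gr_count d m \<eta> L (round_noise w t) i) :: ennreal)) \<in> borel_measurable (perturb_space D)"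
proof -
  note [measurable] = measurable_action_mem[OF m] measurable_gr_count[OF m]
  show ?thesis by measurable
qed

lemma
  assumes m: "m \<le> d" and i: "i < d" and l: "0 \<le> l i" "l i \<le> 1"
  shows nn_integral_loss_est_le: "(\<integral>\<^sup>+v. ennreal (loss_est d m \<eta> L l (round_noise v t) i) \<partial>perturb_space D) \<le> ennreal (l i)"
    and nn_integral_loss_est_phi:
      "ennreal (phi d m \<eta> L i) * (\<integral>\<^sup>+v. ennreal (loss_est d m \<eta> L l (round_noise v t) i) \<partial>perturb_space D)
        = ennreal (l i * phi d m \<eta> L i)"
    and nn_integral_loss_est_sq:
      "ennreal (phi d m \<eta> L i) * (\<integral>\<^sup>+v. ennreal ((loss_est d m \<eta> L l (round_noise v t) i)\<^sup>2) \<partial>perturb_space D) \<le> 2"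
proof -
  let ?I1 = "\<integral>\<^sup>+v. of_bool (i \<in> ftpl_action d m \<eta> L (round_noise v t 0))
      * of_nat (gr_count d m \<eta> L (round_noise v t) i) \<partial>perturb_space D"
  have e1: "(\<integral>\<^sup>+v. ennreal (loss_est d m \<eta> L l (round_noise v t) i) \<partial>perturb_space D) = ennreal (l i) * ?I1"
    unfolding loss_est_ennreal(1)[of l i, OF l(1)] by (rule nn_integral_cmult) (rule measurable_gr_weight[OF m])
  show "(\<integral>\<^sup>+v. ennreal (loss_est d m \<eta> L l (round_noise v t) i) \<partial>perturb_space D) \<le> ennreal (l i)"
    unfolding e1 using mult_left_mono[OF nn_integral_gr_count_le[OF m i, of \<eta> L t], of "ennreal (l i)"] by simp
  show "ennreal (phi d m \<eta> L i) * (\<integral>\<^sup>+v. ennreal (loss_est d m \<eta> L l (round_noise v t) i) \<partial>perturb_space D)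
        = ennreal (l i * phi d m \<eta> L i)"
  proof -
    have "ennreal (phi d m \<eta> L i) * (ennreal (l i) * ?I1) = ennreal (l i) * (ennreal (phi d m \<eta> L i) * ?I1)"
      by (simp only: mult_ac)
    also have "\<dots> = ennreal (l i) * ennreal (phi d m \<eta> L i)"
      by (simp only: nn_integral_gr_count_phi[OF m i])
    also have "\<dots> = ennreal (l i * phi d m \<eta> L i)"
      by (rule ennreal_mult[symmetric]) (auto simp: l phi_nonneg)
    finally show ?thesis unfolding e1 .
  qed
  let ?I2 = "\<integral>\<^sup>+v. of_bool (i \<in> ftpl_action d m \<eta> L (round_noise v t 0))
      * (of_nat (gr_count d m \<eta> L (round_noise v t) i))\<^sup>2 \<partial>perturb_space D"
  have e2: "(\<integral>\<^sup>+v. ennreal ((loss_est d m \<eta> L l (round_noise v t) i)\<^sup>2) \<partial>perturb_space D) = ennreal ((l i)\<^sup>2) * ?I2"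
    unfolding loss_est_ennreal(2)[of l i, OF l(1)] by (rule nn_integral_cmult) (rule measurable_gr_weight[OF m])
  show "ennreal (phi d m \<eta> L i) * (\<integral>\<^sup>+v. ennreal ((loss_est d m \<eta> L l (round_noise v t) i)\<^sup>2) \<partial>perturb_space D) \<le> 2"
  proof -
    have "ennreal (phi d m \<eta> L i) * (ennreal ((l i)\<^sup>2) * ?I2) = ennreal ((l i)\<^sup>2) * (ennreal (phi d m \<eta> L i) * ?I2)"
      by (simp only: mult_ac)
    also have "\<dots> \<le> 1 * 2"
      using l by (intro mult_mono nn_integral_gr_count_sq[OF m i]) (auto simp: power_le_one)
    finally show ?thesis unfolding e2 by simp
  qed
qed

text \<open>Cost of one round divided by the rate: \<alpha> from the shift estimate, 2 from the
  second moment of the estimates weighted by \<open>phi\<close>, and the ranks of the d arms, at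
  worst 1 to d.\<close>

definition stability :: "nat \<Rightarrow> nat \<Rightarrow> real" where
  "stability d m = 2 * \<alpha> * (\<Sum>k=1..d. rank_coeff m k)"

lemma rank_coeff_nonneg: "0 \<le> rank_coeff m k"
  by (simp add: rank_coeff_def)

lemma stability_nonneg: "0 \<le> stability d m"
  unfolding stability_def using alpha by (intro mult_nonneg_nonneg sum_nonneg rank_coeff_nonneg) auto

lemma rank_coeff_antimono: "1 \<le> a \<Longrightarrow> a \<le> b \<Longrightarrow> rank_coeff m b \<le> rank_coeff m a"
  unfolding rank_coeff_def using alpha
  by (intro powr_mono2 min.mono divide_left_mono) auto

text \<open>\<open>potential_add_ge\<close> averaged over the fresh noise of the round: the
  first-order term becomes the expected loss by unbiasedness, and \<open>phi\<close> times the
  second moment of the estimate is at most 2.\<close>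

lemma round_bound:
  assumes m: "1 \<le> m" "m \<le> d" and \<eta>: "0 < \<eta>" and L: "\<And>i. 0 \<le> L i"
    and l: "\<And>i. i < d \<Longrightarrow> 0 \<le> l i" "\<And>i. i < d \<Longrightarrow> l i \<le> 1"
  shows "ennreal (potential d m \<eta> L) + ennreal (\<Sum>i<d. l i * phi d m \<eta> L i)
    \<le> (\<integral>\<^sup>+v. ennreal (potential d m \<eta> (\<lambda>i. L i + loss_est d m \<eta> L l (round_noise v t) i)) \<partial>perturb_space D)
      + ennreal (\<eta> * stability d m)"
proof -
  define e where "e v = loss_est d m \<eta> L l (round_noise v t)" for v
  have e0: "0 \<le> e v i" for v i unfolding e_def by (rule loss_est_nonneg[OF m(2) l(1)])
  define c where "c i = \<alpha> * \<eta> * rank_coeff m (card {j \<in> {..<d}. \<eta> * L j \<le> \<eta> * L i})" for i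
  have c0: "0 \<le> c i" for i unfolding c_def using alpha \<eta> rank_coeff_nonneg by simp
  have em[measurable]: "(\<lambda>v. ennreal (e v i)) \<in> borel_measurable (perturb_space D)"
    "(\<lambda>v. ennreal ((e v i)\<^sup>2)) \<in> borel_measurable (perturb_space D)"
    "(\<lambda>v. ennreal (potential d m \<eta> (\<lambda>i. L i + e v i))) \<in> borel_measurable (perturb_space D)" for i
    unfolding e_def
    by (rule measurable_round_fun[OF m(2), of "\<lambda>a e. ennreal (e i)"], simp,
        rule measurable_round_fun[OF m(2), of "\<lambda>a e. ennreal ((e i)\<^sup>2)"], simp,
        rule measurable_round_fun[OF m(2), of "\<lambda>a e. ennreal (potential d m \<eta> (\<lambda>i. L i + e i))"], simp)
  have pw: "ennreal (potential d m \<eta> L) + (\<Sum>i<d. ennreal (phi d m \<eta> L i) * ennreal (e v i))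
      \<le> ennreal (potential d m \<eta> (\<lambda>i. L i + e v i)) + (\<Sum>i<d. ennreal (c i * phi d m \<eta> L i) * ennreal ((e v i)\<^sup>2))" for v
  proof -
    have "ennreal (potential d m \<eta> L) + (\<Sum>i<d. ennreal (phi d m \<eta> L i) * ennreal (e v i))
        = ennreal (potential d m \<eta> L + (\<Sum>i<d. e v i * phi d m \<eta> L i))"
      using e0 phi_nonneg potential_nonneg[OF m(2) \<eta> L]
      by (simp add: ennreal_mult[symmetric] sum_ennreal ennreal_plus[symmetric] sum_nonneg mult.commute del: ennreal_plus)
    also have "\<dots> \<le> ennreal (potential d m \<eta> (\<lambda>i. L i + e v i) + (\<Sum>i<d. c i * (phi d m \<eta> L i * (e v i)\<^sup>2)))"
      unfolding c_def by (intro ennreal_leI potential_add_ge[OF m \<eta>] e0)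
    also have "\<dots> = ennreal (potential d m \<eta> (\<lambda>i. L i + e v i)) + (\<Sum>i<d. ennreal (c i * phi d m \<eta> L i) * ennreal ((e v i)\<^sup>2))"
      using e0 phi_nonneg c0 potential_nonneg[OF m(2) \<eta>, of "\<lambda>i. L i + e v i"] L
      by (simp add: ennreal_mult[symmetric] sum_ennreal ennreal_plus[symmetric] sum_nonneg mult_ac del: ennreal_plus)
    finally show ?thesis .
  qed
  have "ennreal (potential d m \<eta> L) + ennreal (\<Sum>i<d. l i * phi d m \<eta> L i)
    = ennreal (potential d m \<eta> L) + (\<Sum>i<d. ennreal (phi d m \<eta> L i) * (\<integral>\<^sup>+v. ennreal (e v i) \<partial>perturb_space D))"
  proof -
    have "(\<Sum>i<d. ennreal (phi d m \<eta> L i) * (\<integral>\<^sup>+v. ennreal (e v i) \<partial>perturb_space D)) = (\<Sum>i<d. ennreal (l i * phi d m \<eta> L i))"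
      unfolding e_def using l by (intro sum.cong refl nn_integral_loss_est_phi m) auto
    also have "\<dots> = ennreal (\<Sum>i<d. l i * phi d m \<eta> L i)"
      using l phi_nonneg by (intro sum_ennreal) auto
    finally show ?thesis by simp
  qed
  also have "\<dots> = (\<integral>\<^sup>+v. ennreal (potential d m \<eta> L) + (\<Sum>i<d. ennreal (phi d m \<eta> L i) * ennreal (e v i)) \<partial>perturb_space D)"
    by (simp add: nn_integral_add nn_integral_sum nn_integral_cmult pert.emeasure_space_1[simplified])
  also have "\<dots> \<le> (\<integral>\<^sup>+v. ennreal (potential d m \<eta> (\<lambda>i. L i + e v i))
      + (\<Sum>i<d. ennreal (c i * phi d m \<eta> L i) * ennreal ((e v i)\<^sup>2)) \<partial>perturb_space D)"
    by (intro nn_integral_mono pw)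
  also have "\<dots> = (\<integral>\<^sup>+v. ennreal (potential d m \<eta> (\<lambda>i. L i + e v i)) \<partial>perturb_space D)
      + (\<integral>\<^sup>+v. (\<Sum>i<d. ennreal (c i * phi d m \<eta> L i) * ennreal ((e v i)\<^sup>2)) \<partial>perturb_space D)"
    by (rule nn_integral_add) measurable
  also have "(\<integral>\<^sup>+v. (\<Sum>i<d. ennreal (c i * phi d m \<eta> L i) * ennreal ((e v i)\<^sup>2)) \<partial>perturb_space D)
      = (\<Sum>i<d. \<integral>\<^sup>+v. ennreal (c i * phi d m \<eta> L i) * ennreal ((e v i)\<^sup>2) \<partial>perturb_space D)"
    by (rule nn_integral_sum) measurable
  also have "\<dots> = (\<Sum>i<d. ennreal (c i * phi d m \<eta> L i) * (\<integral>\<^sup>+v. ennreal ((e v i)\<^sup>2) \<partial>perturb_space D))"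
    by (intro sum.cong refl nn_integral_cmult) measurable
  also have "(\<Sum>i<d. ennreal (c i * phi d m \<eta> L i) * (\<integral>\<^sup>+v. ennreal ((e v i)\<^sup>2) \<partial>perturb_space D)) \<le> ennreal (\<eta> * stability d m)"
  proof -
    have "(\<Sum>i<d. ennreal (c i * phi d m \<eta> L i) * (\<integral>\<^sup>+v. ennreal ((e v i)\<^sup>2) \<partial>perturb_space D)) \<le> (\<Sum>i<d. ennreal (c i * 2))"
    proof (rule sum_mono)
      fix i assume i: "i \<in> {..<d}"
      have "ennreal (c i * phi d m \<eta> L i) * (\<integral>\<^sup>+v. ennreal ((e v i)\<^sup>2) \<partial>perturb_space D)
        = ennreal (c i) * (ennreal (phi d m \<eta> L i) * (\<integral>\<^sup>+v. ennreal ((e v i)\<^sup>2) \<partial>perturb_space D))"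
        by (subst ennreal_mult[OF c0 phi_nonneg]) (rule mult.assoc)
      also have "\<dots> \<le> ennreal (c i) * 2"
        unfolding e_def using i l by (intro mult_left_mono nn_integral_loss_est_sq m) auto
      also have "\<dots> = ennreal (c i * 2)" using c0 by (simp add: ennreal_mult)
      finally show "ennreal (c i * phi d m \<eta> L i) * (\<integral>\<^sup>+v. ennreal ((e v i)\<^sup>2) \<partial>perturb_space D) \<le> ennreal (c i * 2)" .
    qed
    also have "\<dots> = ennreal (\<Sum>i<d. c i * 2)"
      using c0 by (intro sum_ennreal) auto
    also have "\<dots> \<le> ennreal (\<eta> * stability d m)"
    proof (rule ennreal_leI)
      have "(\<Sum>i<d. rank_coeff m (card {j \<in> {..<d}. \<eta> * L j \<le> \<eta> * L i})) \<le> (\<Sum>k=1..d. rank_coeff m k)"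
        using sum_rank_le[of "{..<d}" "rank_coeff m" "\<lambda>i. \<eta> * L i"] by (simp add: rank_coeff_antimono)
      then have "\<alpha> * \<eta> * 2 * (\<Sum>i<d. rank_coeff m (card {j \<in> {..<d}. \<eta> * L j \<le> \<eta> * L i}))
          \<le> \<alpha> * \<eta> * 2 * (\<Sum>k=1..d. rank_coeff m k)"
        using alpha \<eta> by (intro mult_left_mono) auto
      then show "(\<Sum>i<d. c i * 2) \<le> \<eta> * stability d m"
        by (simp add: c_def stability_def sum_distrib_left mult_ac)
    qed
    finally show ?thesis .
  qed
  finally show ?thesis unfolding e_def by (simp add: add_left_mono)
qed

section \<open>Summation over the rounds against a fixed adversary\<close>

context
  fixes d m :: nat and \<eta> :: real and adv :: "hist \<Rightarrow> nat \<Rightarrow> real"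
  assumes m: "1 \<le> m" "m \<le> d" and \<eta>: "0 < \<eta>"
    and adv: "\<And>h i. i < d \<Longrightarrow> 0 \<le> adv h i \<and> adv h i \<le> 1"
begin

abbreviation "state w t \<equiv> ftpl_state d m \<eta> adv w t"
abbreviation "loss w t \<equiv> ftpl_loss d m \<eta> adv w t"
abbreviation "play w t \<equiv> ftpl_play d m \<eta> adv w t"

lemma measurable_loss[measurable]: "(\<lambda>w. loss w t i) \<in> borel_measurable (perturb_space D)"
  unfolding ftpl_loss_def by (rule measurable_state_fun[OF m(2)]) simp

lemma measurable_play_sum:
  fixes g :: "(nat \<Rightarrow> real) \<Rightarrow> nat \<Rightarrow> 'b::{second_countable_topology, topological_comm_monoid_add}"
  shows "(\<lambda>w. \<Sum>i\<in>play w t. g (loss w t) i) \<in> borel_measurable (perturb_space D)"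
  unfolding ftpl_loss_def ftpl_play_def
  by (rule measurable_state_compose[OF m(2),
        of "\<lambda>c w. \<Sum>i\<in>ftpl_action d m \<eta> (fst c) (round_noise w t 0). g (adv (snd c)) i"])
     (rule measurable_round_fun[OF m(2), where G = "\<lambda>a e. \<Sum>i\<in>a. g _ i"], simp)

lemma play_bound: "(\<Sum>t<T. \<Sum>i\<in>play w t. ennreal (loss w t i)) = ennreal (\<Sum>t<T. \<Sum>i\<in>play w t. loss w t i)"
  "0 \<le> (\<Sum>t<T. \<Sum>i\<in>play w t. loss w t i)" "(\<Sum>t<T. \<Sum>i\<in>play w t. loss w t i) \<le> real T * real m"
proof -
  have i: "i < d" if "i \<in> play w t" for i t
    using actionsD(1)[OF ftpl_action_in[OF m(2)]] that unfolding ftpl_play_def by blast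
  have l: "0 \<le> loss w t i \<and> loss w t i \<le> 1" if "i \<in> play w t" for i t
    using adv[OF i[OF that]] by (simp add: ftpl_loss_def)
  show "(\<Sum>t<T. \<Sum>i\<in>play w t. ennreal (loss w t i)) = ennreal (\<Sum>t<T. \<Sum>i\<in>play w t. loss w t i)"
    using l by (simp add: sum_ennreal sum_nonneg)
  show "0 \<le> (\<Sum>t<T. \<Sum>i\<in>play w t. loss w t i)"
    using l by (intro sum_nonneg) auto
  have "(\<Sum>i\<in>play w t. loss w t i) \<le> real m" for t
    using sum_bounded_above[of "play w t" "loss w t" 1] l
      actionsD(2)[OF ftpl_action_in[OF m(2)], of \<eta> "fst (state w t)" "\<lambda>i. w (t, 0, i)"]
    by (simp add: ftpl_play_def)
  then show "(\<Sum>t<T. \<Sum>i\<in>play w t. loss w t i) \<le> real T * real m"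
    using sum_bounded_above[of "{..<T}" "\<lambda>t. \<Sum>i\<in>play w t. loss w t i" "real m"] by simp
qed

text \<open>Telescoping: each round moves its expected loss into the potential at a cost of
  \<open>\<eta> * stability d m\<close>. Potentials stay on the right, so no possibly infinite value
  is ever subtracted.\<close>

lemma loss_le_potential:
  "(\<integral>\<^sup>+w. (\<Sum>s<t. \<Sum>i\<in>play w s. ennreal (loss w s i)) \<partial>perturb_space D)
    \<le> (\<integral>\<^sup>+w. ennreal (potential d m \<eta> (fst (state w t))) \<partial>perturb_space D) + ennreal (real t * (\<eta> * stability d m))"
proof (induction t)
  case 0
  show ?case by simp
next
  case (Suc t)
  let ?S = "\<lambda>w. \<Sum>s<t. \<Sum>i\<in>play w s. ennreal (loss w s i)"
  let ?gain = "\<lambda>w. ennreal (\<Sum>i<d. adv (snd (state w t)) i * phi d m \<eta> (fst (state w t)) i)"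
  let ?Pot = "\<lambda>w. ennreal (potential d m \<eta> (fst (state w t)))"
  let ?B = "\<eta> * stability d m"
  have B: "0 \<le> ?B" using \<eta> stability_nonneg by simp
  note [measurable] = measurable_play_sum[of "\<lambda>l i. ennreal (l i)"]
  have [measurable]: "?gain \<in> borel_measurable (perturb_space D)" "?Pot \<in> borel_measurable (perturb_space D)"
    by (rule measurable_state_fun[OF m(2), of "\<lambda>c. ennreal (\<Sum>i<d. adv (snd c) i * phi d m \<eta> (fst c) i)"], simp,
        rule measurable_state_fun[OF m(2), of "\<lambda>c. ennreal (potential d m \<eta> (fst c))"], simp)
  have "(\<integral>\<^sup>+w. (\<Sum>i\<in>play w t. ennreal (loss w t i)) \<partial>perturb_space D)
     = (\<integral>\<^sup>+w. (\<integral>\<^sup>+v. (\<Sum>i\<in>ftpl_action d m \<eta> (fst (state w t)) (round_noise v t 0). ennreal (adv (snd (state w t)) i))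
          \<partial>perturb_space D) \<partial>perturb_space D)"
    unfolding ftpl_loss_def ftpl_play_def
    by (rule nn_integral_round[OF m(2),
          of "\<lambda>c rs. \<Sum>i\<in>ftpl_action d m \<eta> (fst c) (rs 0). ennreal (adv (snd c) i)"])
       (rule measurable_round_fun[OF m(2), where G = "\<lambda>a e. \<Sum>i\<in>a. ennreal (adv _ i)"], simp)
  also have "\<dots> = (\<integral>\<^sup>+w. ?gain w \<partial>perturb_space D)"
    using adv by (subst nn_integral_action_loss[OF m(2)]) auto
  finally have gain: "(\<integral>\<^sup>+w. (\<Sum>i\<in>play w t. ennreal (loss w t i)) \<partial>perturb_space D) = (\<integral>\<^sup>+w. ?gain w \<partial>perturb_space D)" .
  have "(\<integral>\<^sup>+w. ennreal (potential d m \<eta> (fst (state w (Suc t)))) \<partial>perturb_space D)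
      = (\<integral>\<^sup>+w. (\<integral>\<^sup>+v. ennreal (potential d m \<eta> (\<lambda>i. fst (state w t) i
          + loss_est d m \<eta> (fst (state w t)) (adv (snd (state w t))) (round_noise v t) i)) \<partial>perturb_space D) \<partial>perturb_space D)"
    unfolding ftpl_state_Suc fst_conv
    by (rule nn_integral_round[OF m(2),
          of "\<lambda>c rs. ennreal (potential d m \<eta> (\<lambda>i. fst c i + loss_est d m \<eta> (fst c) (adv (snd c)) rs i))"])
       (rule measurable_round_fun[OF m(2), where G = "\<lambda>a e. ennreal (potential d m \<eta> (\<lambda>i. _ i + e i))"], simp)
  then have next_pot: "(\<integral>\<^sup>+w. (\<integral>\<^sup>+v. ennreal (potential d m \<eta> (\<lambda>i. fst (state w t) i
          + loss_est d m \<eta> (fst (state w t)) (adv (snd (state w t))) (round_noise v t) i)) \<partial>perturb_space D) \<partial>perturb_space D)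
      = (\<integral>\<^sup>+w. ennreal (potential d m \<eta> (fst (state w (Suc t)))) \<partial>perturb_space D)" by simp
  have "(\<integral>\<^sup>+w. (\<Sum>s<Suc t. \<Sum>i\<in>play w s. ennreal (loss w s i)) \<partial>perturb_space D)
    = (\<integral>\<^sup>+w. ?S w \<partial>perturb_space D) + (\<integral>\<^sup>+w. ?gain w \<partial>perturb_space D)"
    unfolding sum.lessThan_Suc gain[symmetric] by (rule nn_integral_add) measurable
  also have "\<dots> \<le> (\<integral>\<^sup>+w. ?Pot w \<partial>perturb_space D) + ennreal (real t * ?B) + (\<integral>\<^sup>+w. ?gain w \<partial>perturb_space D)"
    by (intro add_right_mono Suc.IH)
  also have "\<dots> = (\<integral>\<^sup>+w. ?Pot w + ?gain w \<partial>perturb_space D) + ennreal (real t * ?B)"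
    by (subst nn_integral_add) (auto simp: ac_simps)
  also have "(\<integral>\<^sup>+w. ?Pot w + ?gain w \<partial>perturb_space D)
     \<le> (\<integral>\<^sup>+w. (\<integral>\<^sup>+v. ennreal (potential d m \<eta> (\<lambda>i. fst (state w t) i
          + loss_est d m \<eta> (fst (state w t)) (adv (snd (state w t))) (round_noise v t) i)) \<partial>perturb_space D)
       + ennreal ?B \<partial>perturb_space D)"
    using adv by (intro nn_integral_mono round_bound m \<eta> ftpl_state_nonneg) auto
  also have "\<dots> = (\<integral>\<^sup>+w. ennreal (potential d m \<eta> (fst (state w (Suc t)))) \<partial>perturb_space D) + ennreal ?B"
    unfolding next_pot[symmetric]
  proof -
    let ?H = "\<lambda>w. \<integral>\<^sup>+v. ennreal (potential d m \<eta> (\<lambda>i. fst (state w t) i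
          + loss_est d m \<eta> (fst (state w t)) (adv (snd (state w t))) (round_noise v t) i)) \<partial>perturb_space D"
    have H: "?H \<in> borel_measurable (perturb_space D)"
      by (rule measurable_state_fun[OF m(2), of "\<lambda>c. \<integral>\<^sup>+v. ennreal (potential d m \<eta> (\<lambda>i. fst c i
            + loss_est d m \<eta> (fst c) (adv (snd c)) (round_noise v t) i)) \<partial>perturb_space D"]) simp
    have const: "(\<integral>\<^sup>+w. ennreal ?B \<partial>perturb_space D) = ennreal ?B"
      by (simp add: pert.emeasure_space_1[simplified])
    show "(\<integral>\<^sup>+w. ?H w + ennreal ?B \<partial>perturb_space D) = (\<integral>\<^sup>+w. ?H w \<partial>perturb_space D) + ennreal ?B"
      by (rule trans[OF nn_integral_add[OF H measurable_const]]) (simp_all only: const space_borel UNIV_I)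
  qed
  finally have bound: "(\<integral>\<^sup>+w. (\<Sum>s<Suc t. \<Sum>i\<in>play w s. ennreal (loss w s i)) \<partial>perturb_space D)
    \<le> (\<integral>\<^sup>+w. ennreal (potential d m \<eta> (fst (state w (Suc t)))) \<partial>perturb_space D) + ennreal ?B + ennreal (real t * ?B)"
    by (simp only: add_right_mono)
  have B_Suc: "ennreal (real (Suc t) * ?B) = ennreal ?B + ennreal (real t * ?B)"
  proof -
    have "real (Suc t) * ?B = ?B + real t * ?B" by (simp add: distrib_right)
    then show ?thesis using ennreal_plus[OF B mult_nonneg_nonneg[OF of_nat_0_le_iff B, of t]] by (simp only:)
  qed
  show ?case
    unfolding B_Suc using bound by (simp only: add.assoc)
qed

text \<open>On the comparator side an upper bound suffices, and it holds even for an arm of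
  selection probability zero, whose estimate has mean zero instead of the loss.\<close>

lemma estimate_le_loss:
  assumes i: "i < d"
  shows "(\<integral>\<^sup>+w. ennreal (fst (state w t) i) \<partial>perturb_space D)
    \<le> (\<integral>\<^sup>+w. (\<Sum>s<t. ennreal (loss w s i)) \<partial>perturb_space D)"
proof (induction t)
  case 0
  show ?case by simp
next
  case (Suc t)
  let ?e = "\<lambda>c rs. ennreal (loss_est d m \<eta> (fst c) (adv (snd c)) rs i)"
  have st: "0 \<le> fst (state w t) i" for w using adv by (intro ftpl_state_nonneg m) auto
  have em: "(\<lambda>w. ?e c (round_noise w t)) \<in> borel_measurable (perturb_space D)" for c
    by (rule measurable_round_fun[OF m(2), where G = "\<lambda>a e. ennreal (e i)"]) simp
  have [measurable]: "(\<lambda>w. ennreal (fst (state w t) i)) \<in> borel_measurable (perturb_space D)"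
    by (rule measurable_state_fun[OF m(2), of "\<lambda>c. ennreal (fst c i)"]) simp
  have [measurable]: "(\<lambda>w. ?e (state w t) (round_noise w t)) \<in> borel_measurable (perturb_space D)"
    by (rule measurable_state_compose[OF m(2)]) (rule em)
  have split: "(\<integral>\<^sup>+w. ennreal (fst (state w (Suc t)) i) \<partial>perturb_space D)
    = (\<integral>\<^sup>+w. ennreal (fst (state w t) i) \<partial>perturb_space D)
      + (\<integral>\<^sup>+w. ?e (state w t) (round_noise w t) \<partial>perturb_space D)"
  proof -
    have "(\<integral>\<^sup>+w. ennreal (fst (state w (Suc t)) i) \<partial>perturb_space D)
      = (\<integral>\<^sup>+w. ennreal (fst (state w t) i) + ?e (state w t) (round_noise w t) \<partial>perturb_space D)"
      unfolding ftpl_state_Suc fst_conv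
      using adv by (intro nn_integral_cong ennreal_plus st loss_est_nonneg m) auto
    also have "\<dots> = (\<integral>\<^sup>+w. ennreal (fst (state w t) i) \<partial>perturb_space D)
        + (\<integral>\<^sup>+w. ?e (state w t) (round_noise w t) \<partial>perturb_space D)"
      by (rule nn_integral_add) measurable
    finally show ?thesis .
  qed
  have est: "(\<integral>\<^sup>+w. ?e (state w t) (round_noise w t) \<partial>perturb_space D)
      \<le> (\<integral>\<^sup>+w. ennreal (loss w t i) \<partial>perturb_space D)"
  proof -
    have "(\<integral>\<^sup>+w. ?e (state w t) (round_noise w t) \<partial>perturb_space D)
       = (\<integral>\<^sup>+w. (\<integral>\<^sup>+v. ?e (state w t) (round_noise v t) \<partial>perturb_space D) \<partial>perturb_space D)"
      by (rule nn_integral_round[OF m(2)]) (rule em)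
    also have "\<dots> \<le> (\<integral>\<^sup>+w. ennreal (loss w t i) \<partial>perturb_space D)"
      unfolding ftpl_loss_def using adv i by (intro nn_integral_mono nn_integral_loss_est_le m) auto
    finally show ?thesis .
  qed
  have "(\<integral>\<^sup>+w. (\<Sum>s<Suc t. ennreal (loss w s i)) \<partial>perturb_space D)
      = (\<integral>\<^sup>+w. (\<Sum>s<t. ennreal (loss w s i)) \<partial>perturb_space D) + (\<integral>\<^sup>+w. ennreal (loss w t i) \<partial>perturb_space D)"
    unfolding sum.lessThan_Suc by (rule nn_integral_add) measurable
  then show ?case
    unfolding split using add_mono[OF Suc.IH est] by (simp only:)
qed

lemma pseudo_regret_le:
  assumes c: "0 < c"
  shows "pseudo_regret d m \<eta> D adv T
    \<le> (real m * c + real d * (c powr (1 - \<alpha>) / (\<alpha> - 1))) / \<eta> + real T * (\<eta> * stability d m)"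
proof -
  let ?A = "(real m * c + real d * (c powr (1 - \<alpha>) / (\<alpha> - 1))) / \<eta>"
  let ?B = "\<eta> * stability d m"
  have A: "0 \<le> ?A" using alpha c \<eta> by simp
  have B: "0 \<le> ?B" using \<eta> stability_nonneg by simp
  let ?X = "\<lambda>w. \<Sum>t<T. \<Sum>i\<in>play w t. loss w t i"
  have Xint: "integrable (perturb_space D) ?X"
    by (rule pert.integrable_const_bound[where B = "real T * real m"])
       (use play_bound(2,3) measurable_play_sum[of "\<lambda>l i. l i"] in \<open>auto simp: abs_le_iff intro: order_trans[of _ 0]\<close>)
  \<comment> \<open>The minimum over the finite set of actions is attained, so a bound against each
    fixed action is enough.\<close>
  have main: "(\<integral>w. ?X w \<partial>perturb_space D) \<le> (\<integral>w. (\<Sum>t<T. \<Sum>i\<in>a. loss w t i) \<partial>perturb_space D) + (?A + real T * ?B)"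
    if a: "a \<in> actions d m" for a
  proof -
    let ?Y = "\<lambda>w. \<Sum>t<T. \<Sum>i\<in>a. loss w t i"
    have ad: "i < d" if "i \<in> a" for i using actionsD(1)[OF a] that by auto
    have l01: "0 \<le> loss w t i" "loss w t i \<le> 1" if "i \<in> a" for w t i
      using adv[OF ad[OF that]] by (auto simp: ftpl_loss_def)
    have Y0: "0 \<le> ?Y w" for w using l01 by (intro sum_nonneg) auto
    have Yint: "integrable (perturb_space D) ?Y"
      by (intro Bochner_Integration.integrable_sum pert.integrable_const_bound[where B = 1])
         (use l01 in auto)
    have Yens: "ennreal (?Y w) = (\<Sum>i\<in>a. \<Sum>t<T. ennreal (loss w t i))" for w
      using l01 by (subst sum.swap) (simp add: sum_ennreal sum_nonneg)
    have [measurable]: "(\<lambda>w. ennreal (fst (state w T) i)) \<in> borel_measurable (perturb_space D)" for i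
      by (rule measurable_state_fun[OF m(2), of "\<lambda>c. ennreal (fst c i)"]) simp
    have "ennreal (\<integral>w. ?X w \<partial>perturb_space D) = (\<integral>\<^sup>+w. ennreal (?X w) \<partial>perturb_space D)"
      by (rule nn_integral_eq_integral[symmetric, OF Xint]) (simp add: play_bound(2))
    also have "\<dots> = (\<integral>\<^sup>+w. (\<Sum>s<T. \<Sum>i\<in>play w s. ennreal (loss w s i)) \<partial>perturb_space D)"
      by (simp only: play_bound(1))
    also have "\<dots> \<le> (\<integral>\<^sup>+w. ennreal (potential d m \<eta> (fst (state w T))) \<partial>perturb_space D) + ennreal (real T * ?B)"
      by (rule loss_le_potential)
    also have "(\<integral>\<^sup>+w. ennreal (potential d m \<eta> (fst (state w T))) \<partial>perturb_space D)
        \<le> (\<integral>\<^sup>+w. (\<Sum>i\<in>a. ennreal (fst (state w T) i)) + ennreal ?A \<partial>perturb_space D)"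
    proof (rule nn_integral_mono)
      fix w
      have st: "0 \<le> fst (state w T) i" for i using adv by (intro ftpl_state_nonneg m) auto
      have "ennreal (potential d m \<eta> (fst (state w T))) \<le> ennreal ((\<Sum>i\<in>a. fst (state w T) i) + ?A)"
        by (intro ennreal_leI potential_le m a c \<eta>)
      also have "\<dots> = (\<Sum>i\<in>a. ennreal (fst (state w T) i)) + ennreal ?A"
        using st A by (subst ennreal_plus) (auto simp: sum_ennreal sum_nonneg)
      finally show "ennreal (potential d m \<eta> (fst (state w T))) \<le> (\<Sum>i\<in>a. ennreal (fst (state w T) i)) + ennreal ?A" .
    qed
    also have "\<dots> = (\<Sum>i\<in>a. \<integral>\<^sup>+w. ennreal (fst (state w T) i) \<partial>perturb_space D) + ennreal ?A"
      by (simp add: nn_integral_add nn_integral_sum pert.emeasure_space_1[simplified])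
    also have "(\<Sum>i\<in>a. \<integral>\<^sup>+w. ennreal (fst (state w T) i) \<partial>perturb_space D)
       \<le> (\<Sum>i\<in>a. \<integral>\<^sup>+w. (\<Sum>t<T. ennreal (loss w t i)) \<partial>perturb_space D)"
      by (intro sum_mono estimate_le_loss ad)
    also have "\<dots> = (\<integral>\<^sup>+w. ennreal (?Y w) \<partial>perturb_space D)"
      unfolding Yens by (rule nn_integral_sum[symmetric]) measurable
    also have "\<dots> = ennreal (\<integral>w. ?Y w \<partial>perturb_space D)"
      by (rule nn_integral_eq_integral[OF Yint]) (simp add: Y0)
    finally have "ennreal (\<integral>w. ?X w \<partial>perturb_space D)
        \<le> ennreal (\<integral>w. ?Y w \<partial>perturb_space D) + ennreal ?A + ennreal (real T * ?B)"
      by (simp add: add_right_mono)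
    also have "\<dots> = ennreal ((\<integral>w. ?Y w \<partial>perturb_space D) + (?A + real T * ?B))"
      using A B Bochner_Integration.integral_nonneg[of "perturb_space D" ?Y] Y0
      by (simp add: ennreal_plus[symmetric] add.assoc del: ennreal_plus)
    finally show ?thesis
      using A B Bochner_Integration.integral_nonneg[of "perturb_space D" ?Y] Y0
      by (subst (asm) ennreal_le_iff) auto
  qed
  have "Min ((\<lambda>a. \<integral>w. (\<Sum>t<T. \<Sum>i\<in>a. loss w t i) \<partial>perturb_space D) ` actions d m)
      \<in> (\<lambda>a. \<integral>w. (\<Sum>t<T. \<Sum>i\<in>a. loss w t i) \<partial>perturb_space D) ` actions d m"
    using finite_actions actions_nonempty[OF m(2)] by (intro Min_in) auto
  then obtain a where "a \<in> actions d m"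
    "Min ((\<lambda>a. \<integral>w. (\<Sum>t<T. \<Sum>i\<in>a. loss w t i) \<partial>perturb_space D) ` actions d m)
      = (\<integral>w. (\<Sum>t<T. \<Sum>i\<in>a. loss w t i) \<partial>perturb_space D)" by blast
  then show ?thesis
    unfolding pseudo_regret_def using main[of a] by simp
qed

end

end

section \<open>Tuning, and the Pareto and Frechet distributions\<close>

text \<open>Induction in place of an integral comparison: weighted AM-GM gives n^(1-s) (n+1)^s \<le>
  n + s, which is the increment needed.\<close>

lemma sum_powr_le:
  fixes s :: real
  assumes s: "0 < s" "s < 1"
  shows "(\<Sum>k=1..n. real k powr (-s)) \<le> real n powr (1 - s) / (1 - s)"
proof (induction n)
  case (Suc n)
  have step: "real n powr (1 - s) + (1 - s) * real (Suc n) powr (-s) \<le> real (Suc n) powr (1 - s)"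
  proof (cases "n = 0")
    case False
    have "real n powr (1 - s) * real (Suc n) powr s \<le> (1 - s) * real n + s * real (Suc n)"
      using False s by (intro Youngs_inequality_0) auto
    then have "real n powr (1 - s) * real (Suc n) powr s * real (Suc n) powr (-s)
        \<le> (real n + s) * real (Suc n) powr (-s)"
      by (intro mult_right_mono) (auto simp: algebra_simps)
    moreover have "real (Suc n) powr s * real (Suc n) powr (-s) = 1"
      by (simp flip: powr_add)
    moreover have "real (Suc n) powr (1 - s) = real (Suc n) * real (Suc n) powr (-s)"
      by (simp add: powr_mult_base)
    ultimately show ?thesis by (simp add: mult.assoc algebra_simps)
  qed (use s in auto)
  have "(\<Sum>k=1..Suc n. real k powr (-s)) \<le> real n powr (1 - s) / (1 - s) + real (Suc n) powr (-s)"
    using Suc.IH by simp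
  also have "\<dots> = (real n powr (1 - s) + (1 - s) * real (Suc n) powr (-s)) / (1 - s)"
    using s by (simp add: field_simps)
  also have "\<dots> \<le> real (Suc n) powr (1 - s) / (1 - s)"
    using s step by (intro divide_right_mono) auto
  finally show ?case .
qed simp

lemma two_powr_le:
  fixes s :: real
  assumes "0 < s" "s < 1"
  shows "2 powr s \<le> 1 + s"
  using Youngs_inequality_0[of s "1 - s" 2 1] assms by simp

text \<open>At the given rate both summands, computed with A' and B', equal the same square root.
  Allowing A \<le> A' and B \<le> B' covers rates prescribed by larger constants.\<close>

lemma tuned_rate_bound:
  fixes A B A' B' T \<eta> :: real
  assumes "A \<le> A'" "B \<le> B'" "0 < A'" "0 < B'" "0 < T" and \<eta>: "\<eta> = sqrt (A' / (B' * T))"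
  shows "A / \<eta> + T * (\<eta> * B) \<le> 2 * sqrt (A' * B' * T)"
proof -
  have pos: "0 < \<eta>" and sq: "\<eta>\<^sup>2 = A' / (B' * T)" using assms by simp_all
  have "A / \<eta> + T * (\<eta> * B) \<le> A' / \<eta> + T * (\<eta> * B')"
    using assms pos by (intro add_mono divide_right_mono mult_left_mono) auto
  also have "A' / \<eta> = sqrt (A' * B' * T)"
  proof (rule real_sqrt_unique[symmetric])
    show "(A' / \<eta>)\<^sup>2 = A' * B' * T"
      using assms by (simp add: power_divide sq power2_eq_square[of A'])
  qed (use assms pos in auto)
  also have "T * (\<eta> * B') = sqrt (A' * B' * T)"
  proof (rule real_sqrt_unique[symmetric])
    show "(T * (\<eta> * B'))\<^sup>2 = A' * B' * T"
      using assms by (simp add: power_mult_distrib sq power2_eq_square[of B'] power2_eq_square[of T])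
  qed (use assms pos in auto)
  finally show ?thesis by simp
qed

section \<open>Explicit constants and the choice of the threshold\<close>

context perturbation
begin

text \<open>The first bound uses the ratio in the minimum for every rank; the second uses 1 for the
  first m ranks and the ratio afterwards. They lead to the constants for Pareto and Frechet noise
  respectively.\<close>

lemma sum_rank_coeff_le:
  assumes m: "1 \<le> m"
  shows "(\<Sum>k=1..d. rank_coeff m k) \<le> 2 powr (1/\<alpha>) * real m powr (1/\<alpha>) * (\<alpha> / (\<alpha> - 1) * real d powr (1 - 1/\<alpha>))"
    and "m \<le> d \<Longrightarrow> (\<Sum>k=1..d. rank_coeff m k)
      \<le> real m + 2 powr (1/\<alpha>) * real m powr (1/\<alpha>) * (\<alpha> / (\<alpha> - 1) * (real d - real m + 1) powr (1 - 1/\<alpha>))"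
proof -
  define s where "s = 1/\<alpha>"
  have s: "0 < s" "s < 1" using alpha by (auto simp: s_def)
  have r: "1 / (1 - s) = \<alpha> / (\<alpha> - 1)" using alpha by (simp add: s_def field_simps)
  \<comment> \<open>j may be smaller than k: the second bound takes k = m + j, so that the sum of
    powers again starts at 1.\<close>
  have c: "rank_coeff m k \<le> 2 powr s * real m powr s * real j powr (-s)" if "1 \<le> j" "j \<le> k" for j k
  proof -
    have "rank_coeff m k \<le> (2 * real m / real j) powr s"
      unfolding rank_coeff_def s_def using that alpha
      by (intro powr_mono2 min.coboundedI2 divide_left_mono) auto
    also have "\<dots> = 2 powr s * real m powr s * real j powr (-s)"
      using that by (simp add: powr_divide powr_mult powr_minus_divide)
    finally show ?thesis .
  qed
  have sum: "(\<Sum>j=1..n. 2 powr s * real m powr s * real j powr (-s))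
      \<le> 2 powr s * real m powr s * (\<alpha> / (\<alpha> - 1) * real n powr (1 - s))" for n
    using mult_left_mono[OF sum_powr_le[OF s, of n], of "2 powr s * real m powr s"]
    by (simp add: sum_distrib_left[symmetric] r[symmetric])
  show "(\<Sum>k=1..d. rank_coeff m k) \<le> 2 powr (1/\<alpha>) * real m powr (1/\<alpha>) * (\<alpha> / (\<alpha> - 1) * real d powr (1 - 1/\<alpha>))"
    unfolding s_def[symmetric] by (rule order_trans[OF sum_mono sum]) (auto intro: c)
  assume md: "m \<le> d"
  have "(\<Sum>k=1..d. rank_coeff m k) = (\<Sum>k=1..m. rank_coeff m k) + (\<Sum>k=m+1..d. rank_coeff m k)"
    using sum.ub_add_nat[of 1 m "rank_coeff m" "d - m"] md m by simp
  also have "(\<Sum>k=1..m. rank_coeff m k) \<le> real m"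
  proof -
    have "rank_coeff m k \<le> 1" for k
      unfolding rank_coeff_def using alpha by (intro powr_le1) auto
    then show ?thesis using sum_bounded_above[of "{1..m}" "rank_coeff m" 1] by simp
  qed
  also have "(\<Sum>k=m+1..d. rank_coeff m k) = (\<Sum>j=1..d - m. rank_coeff m (m + j))"
    using md by (intro sum.reindex_bij_witness[of _ "\<lambda>j. m + j" "\<lambda>k. k - m"]) auto
  also have "\<dots> \<le> (\<Sum>j=1..d - m. 2 powr s * real m powr s * real j powr (-s))"
    by (intro sum_mono c) auto
  also have "\<dots> \<le> 2 powr s * real m powr s * (\<alpha> / (\<alpha> - 1) * real (d - m) powr (1 - s))"
    by (rule sum)
  also have "\<dots> \<le> 2 powr s * real m powr s * (\<alpha> / (\<alpha> - 1) * (real d - real m + 1) powr (1 - s))"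
    using md alpha s by (intro mult_left_mono powr_mono2) (auto simp: of_nat_diff)
  finally show "(\<Sum>k=1..d. rank_coeff m k)
      \<le> real m + 2 powr (1/\<alpha>) * real m powr (1/\<alpha>) * (\<alpha> / (\<alpha> - 1) * (real d - real m + 1) powr (1 - 1/\<alpha>))"
    by (simp add: s_def)
qed

text \<open>The constant collects 2 * \<alpha> from \<open>stability\<close>, 2 as a bound for
  \<open>2 powr (1/\<alpha>)\<close>, and \<alpha> / (\<alpha> - 1) from the sum of powers.\<close>

lemma stability_le:
  assumes m: "1 \<le> m"
  shows "stability d m \<le> 4 * \<alpha>\<^sup>2 / (\<alpha> - 1) * (real m + 1/\<alpha>) powr (1/\<alpha>) * real d powr (1 - 1/\<alpha>)"
proof -
  have s: "0 < 1/\<alpha>" "1/\<alpha> < 1" using alpha by simp_all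
  have "2 powr (1/\<alpha>) \<le> (2::real)" using two_powr_le[OF s] s by linarith
  then have "2 powr (1/\<alpha>) * real m powr (1/\<alpha>) \<le> 2 * (real m + 1/\<alpha>) powr (1/\<alpha>)"
    using alpha by (intro mult_mono powr_mono2) auto
  then have "2 powr (1/\<alpha>) * real m powr (1/\<alpha>) * (\<alpha> / (\<alpha> - 1) * real d powr (1 - 1/\<alpha>))
      \<le> 2 * (real m + 1/\<alpha>) powr (1/\<alpha>) * (\<alpha> / (\<alpha> - 1) * real d powr (1 - 1/\<alpha>))"
    using alpha by (intro mult_right_mono) auto
  then have "stability d m \<le> 2 * \<alpha> * (2 * (real m + 1/\<alpha>) powr (1/\<alpha>) * (\<alpha> / (\<alpha> - 1) * real d powr (1 - 1/\<alpha>)))"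
    unfolding stability_def using sum_rank_coeff_le(1)[OF m, of d] alpha by (intro mult_left_mono) auto
  then show ?thesis by (simp add: power2_eq_square mult_ac)
qed

text \<open>\<open>2 powr (1/\<alpha>)\<close> is at most 1 + 1/\<alpha>, and \<alpha> times this is
  \<alpha> + 1. As M \<ge> 1, the same factor also covers the first m ranks, where each coefficient
  is at most 1.\<close>

lemma stability_le_split:
  assumes m: "1 \<le> m" "m \<le> d"
  shows "stability d m \<le> 2 * (\<alpha> + 1) * (real m + 1/\<alpha>) powr (1/\<alpha>)
    * (real m + \<alpha> / (\<alpha> - 1) * (real d - real m + 1) powr (1 - 1/\<alpha>))"
proof -
  define M where "M = (real m + 1/\<alpha>) powr (1/\<alpha>)"
  define R where "R = \<alpha> / (\<alpha> - 1) * (real d - real m + 1) powr (1 - 1/\<alpha>)"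
  have R: "0 \<le> R" unfolding R_def using alpha by simp
  have "1 \<le> real m + 1/\<alpha>" using m alpha by (intro add_increasing2) auto
  then have "1 \<le> M" unfolding M_def using alpha by (intro ge_one_powr_ge_zero) auto
  then have 1: "1 \<le> (1 + 1/\<alpha>) * M" using alpha mult_mono[of 1 "1 + 1/\<alpha>" 1 M] by simp
  have 2: "2 powr (1/\<alpha>) * real m powr (1/\<alpha>) \<le> (1 + 1/\<alpha>) * M"
    unfolding M_def using two_powr_le[of "1/\<alpha>"] alpha by (intro mult_mono powr_mono2) auto
  have "(\<Sum>k=1..d. rank_coeff m k) \<le> 1 * real m + 2 powr (1/\<alpha>) * real m powr (1/\<alpha>) * R"
    using sum_rank_coeff_le(2)[OF m] by (simp add: R_def)
  also have "\<dots> \<le> (1 + 1/\<alpha>) * M * real m + (1 + 1/\<alpha>) * M * R"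
    using 1 2 R by (intro add_mono mult_right_mono) auto
  finally have "stability d m \<le> 2 * \<alpha> * ((1 + 1/\<alpha>) * M * real m + (1 + 1/\<alpha>) * M * R)"
    unfolding stability_def using alpha by (intro mult_left_mono) auto
  also have "\<dots> = 2 * (\<alpha> * (1 + 1/\<alpha>)) * M * (real m + R)" by (simp add: algebra_simps)
  also have "\<alpha> * (1 + 1/\<alpha>) = \<alpha> + 1" using alpha by (simp add: field_simps)
  finally show ?thesis unfolding M_def R_def .
qed

lemma pseudo_regret_tuned:
  fixes T :: nat
  assumes m: "1 \<le> m" "m \<le> d" and T: "1 \<le> T"
    and adv: "\<And>h i. i < d \<Longrightarrow> 0 \<le> adv h i \<and> adv h i \<le> 1"
    and A: "\<alpha> / (\<alpha> - 1) * real m powr (1 - 1/\<alpha>) * real d powr (1/\<alpha>) \<le> A"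
    and B: "stability d m \<le> B" "0 < B"
    and \<eta>: "\<eta> = sqrt (A / (B * real T))"
  shows "pseudo_regret d m \<eta> D adv T \<le> 2 * sqrt (A * B * real T)"
proof -
  \<comment> \<open>The minimiser of
    \<open>m * c + d * c powr (1 - \<alpha>) / (\<alpha> - 1)\<close>: a vanishing derivative means
    \<open>c powr \<alpha> = d / m\<close>.\<close>
  define c where "c = (real d / real m) powr (1/\<alpha>)"
  have c: "0 < c" using m by (simp add: c_def)
  have d: "0 < real d" "0 < real m" using m by auto
  have "0 < \<alpha> / (\<alpha> - 1) * real m powr (1 - 1/\<alpha>) * real d powr (1/\<alpha>)"
    using alpha d by (intro mult_pos_pos) auto
  then have A0: "0 < A" using A by linarith
  have "0 < \<eta>" using A0 B T unfolding \<eta> by simp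
  have mc: "real m * c = real m powr (1 - 1/\<alpha>) * real d powr (1/\<alpha>)"
    using d unfolding c_def by (simp add: powr_divide powr_diff)
  have dc: "real d * c powr (1 - \<alpha>) = real m powr (1 - 1/\<alpha>) * real d powr (1/\<alpha>)"
  proof -
    have "c powr (1 - \<alpha>) = (real d / real m) powr (1/\<alpha> - 1)"
      unfolding c_def using alpha by (simp add: powr_powr field_simps)
    also have "\<dots> = real d powr (1/\<alpha>) / real d * (real m powr (1 - 1/\<alpha>))"
      using d by (simp add: powr_divide powr_diff field_simps)
    finally show ?thesis using d by simp
  qed
  have "real m * c + real d * (c powr (1 - \<alpha>) / (\<alpha> - 1))
      = (1 + 1 / (\<alpha> - 1)) * (real m powr (1 - 1/\<alpha>) * real d powr (1/\<alpha>))"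
    unfolding mc using dc by (simp add: distrib_right)
  also have "1 + 1 / (\<alpha> - 1) = \<alpha> / (\<alpha> - 1)" using alpha by (simp add: field_simps)
  finally have "real m * c + real d * (c powr (1 - \<alpha>) / (\<alpha> - 1)) \<le> A"
    using A by (simp add: mult.assoc)
  with B A0 T have "(real m * c + real d * (c powr (1 - \<alpha>) / (\<alpha> - 1))) / \<eta> + real T * (\<eta> * stability d m)
      \<le> 2 * sqrt (A * B * real T)"
    by (intro tuned_rate_bound) (auto simp: \<eta>)
  then show ?thesis
    using pseudo_regret_le[where adv = adv and T = T, OF m \<open>0 < \<eta>\<close> adv c] by linarith
qed

end

lemma powr_neg_Suc:
  fixes x a :: real
  assumes "0 < x"
  shows "x powr (-(a + 1)) = x powr (-a) / x"
  using assms by (simp add: powr_diff[of x "-a" 1, simplified])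

lemma DERIV_powr_neg:
  fixes x a :: real
  assumes "0 < x"
  shows "((\<lambda>x. x powr (-a)) has_real_derivative - (a * x powr (-(a + 1)))) (at x)"
proof -
  have "((\<lambda>x. x powr (-a)) has_real_derivative -a * x powr (-a - 1)) (at x)"
    using assms by (rule has_real_derivative_powr)
  then show ?thesis by simp
qed

section \<open>Verification for the Pareto density\<close>

lemma perturbation_pareto:
  assumes \<alpha>: "1 < \<alpha>"
  shows "perturbation \<alpha> (\<lambda>x. if 1 \<le> x then \<alpha> * x powr (-(\<alpha> + 1)) else 0) (pareto \<alpha>)
    (\<lambda>x. if 1 \<le> x then x powr (-\<alpha>) else 1)"
    (is "perturbation \<alpha> ?f _ ?tail")
proof -
  have fm[measurable]: "?f \<in> borel_measurable borel" by measurable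
  have Ici: "emeasure (pareto \<alpha>) {c..} = ennreal (c powr (-\<alpha>))" if c: "1 \<le> c" for c
  proof -
    have "emeasure (pareto \<alpha>) {c..} = (\<integral>\<^sup>+x. ennreal (?f x) * indicator {c..} x \<partial>lborel)"
      unfolding pareto_def by (rule emeasure_density) auto
    also have "\<dots> = ennreal (0 - (- (c powr (-\<alpha>))))"
    proof (rule nn_integral_FTC_atLeast[OF fm])
      fix x assume "c \<le> x"
      then show "((\<lambda>x. - (x powr (-\<alpha>))) has_real_derivative ?f x) (at x)" "0 \<le> ?f x"
        using c \<alpha> DERIV_minus[OF DERIV_powr_neg[of x \<alpha>]] by auto
    next
      show "((\<lambda>x. - (x powr (-\<alpha>))) \<longlongrightarrow> 0) at_top"
        using tendsto_minus[OF tendsto_neg_powr[OF _ filterlim_ident, of "-\<alpha>"]] \<alpha> by simp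
    qed
    finally show ?thesis by simp
  qed
  have low: "emeasure (pareto \<alpha>) {..<1} = 0"
    unfolding pareto_def by (subst emeasure_density) (auto intro!: nn_integral_zero' simp: indicator_def)
  have sets: "sets (pareto \<alpha>) = sets borel" "space (pareto \<alpha>) = UNIV" by (simp_all add: pareto_def)
  have one: "emeasure (pareto \<alpha>) A = 1" if A: "{1..} \<subseteq> A" "A \<in> sets borel" for A
  proof (rule antisym)
    have "emeasure (pareto \<alpha>) A \<le> emeasure (pareto \<alpha>) ({1..} \<union> {..<1})"
      using A sets by (intro emeasure_mono) auto
    also have "\<dots> \<le> emeasure (pareto \<alpha>) {1..} + emeasure (pareto \<alpha>) {..<1}"
      using sets by (intro emeasure_subadditive) auto
    finally show "emeasure (pareto \<alpha>) A \<le> 1" using Ici[of 1] low by simp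
    have "emeasure (pareto \<alpha>) {1..} \<le> emeasure (pareto \<alpha>) A" using A sets by (intro emeasure_mono) auto
    then show "1 \<le> emeasure (pareto \<alpha>) A" using Ici[of 1] by simp
  qed
  show ?thesis
  proof (rule perturbation.intro)
    show "1 < \<alpha>" by fact
    show "?f \<in> borel_measurable borel" by (rule fm)
    show "pareto \<alpha> = density lborel (\<lambda>x. ennreal (?f x))" by (rule pareto_def)
    show "prob_space (pareto \<alpha>)"
      by (rule prob_spaceI) (simp only: sets(2), rule one, auto)
  next
    fix x
    show "0 \<le> ?f x" using \<alpha> by simp
    show "?tail x = measure (pareto \<alpha>) {x..}"
      using Ici[of x] one[of "{x..}"] by (auto simp: measure_def)
    \<comment> \<open>An equality on the support: \<open>x powr (-\<alpha>)\<close> to the power 1 +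
      1/\<alpha> is \<open>x powr (-(\<alpha> + 1))\<close>.\<close>
    show "?f x \<le> \<alpha> * ?tail x powr (1 + 1/\<alpha>)"
      using \<alpha> by (auto simp: powr_powr algebra_simps)
    show "?f x \<le> (if 0 < x then \<alpha> * x powr (-(\<alpha> + 1)) else 0)"
      using \<alpha> by auto
    fix \<delta> :: real assume \<delta>: "0 \<le> \<delta>"
    show "?f x * (?tail (x - \<delta>) * (1 - ?tail (x - \<delta>))) \<le> ?f (x - \<delta>) * (?tail x * (1 - ?tail x))"
    proof (cases "1 \<le> x - \<delta>")
      case True
      define z where "z = x - \<delta>"
      have z: "1 \<le> z" "z \<le> x" using True \<delta> by (auto simp: z_def)
      have ta: "x powr (-\<alpha>) \<le> z powr (-\<alpha>)" "z powr (-\<alpha>) \<le> 1" "0 \<le> x powr (-\<alpha>)"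
        using z \<alpha> powr_mono2'[of "-\<alpha>" 1 z] by (auto intro: powr_mono2')
      \<comment> \<open>With the density written as
        \<open>\<alpha> * x powr (-\<alpha>) / x\<close>, both sides of \<open>odds\<close> share
        the factor in front; what is left compares a smaller numerator over a larger denominator
        with the reverse.\<close>
      have "\<alpha> * x powr (-\<alpha>) * z powr (-\<alpha>) * ((1 - z powr (-\<alpha>)) / x)
          \<le> \<alpha> * x powr (-\<alpha>) * z powr (-\<alpha>) * ((1 - x powr (-\<alpha>)) / z)"
        using z \<alpha> ta by (intro mult_left_mono frac_le) auto
      then show ?thesis
        using z unfolding z_def[symmetric] by (simp add: powr_neg_Suc del: minus_add_distrib) (simp add: mult_ac)
    qed (use \<delta> in auto)
  qed
qed

section \<open>Verification for the Frechet density\<close>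

lemma le_sinh:
  fixes x :: real
  assumes "0 \<le> x"
  shows "x \<le> sinh x"
proof -
  have "sinh 0 - 0 \<le> sinh x - x"
  proof (rule DERIV_nonneg_imp_nondecreasing[OF assms])
    fix y :: real
    show "\<exists>D. ((\<lambda>x. sinh x - x) has_real_derivative D) (at y) \<and> 0 \<le> D"
      by (rule exI[of _ "cosh y - 1"]) (auto intro!: derivative_eq_intros simp: cosh_real_ge_1)
  qed
  then show ?thesis by simp
qed

text \<open>In terms of \<open>y = x\<^sup>-\<^sup>\<alpha>\<close> the Frechet density is \<open>\<alpha> y\<^sup>1\<^sup>+\<^sup>1\<^sup>/\<^sup>\<alpha> e\<^sup>-\<^sup>y\<close> and the tail is \<open>1 - e\<^sup>-\<^sup>y\<close>.\<close>
lemma powr_exp_le_tail: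
  fixes y s :: real
  assumes y: "0 < y" and s: "0 < s" "s < 1"
  shows "y powr (1 + s) * exp (-y) \<le> (1 - exp (-y)) powr (1 + s)"
proof -
  have e: "exp (y / 2) * exp (- y) = exp (- (y / 2))" by (simp flip: exp_add)
  \<comment> \<open>2 sinh (y/2) equals exp (y/2) (1 - exp (-y)). The halved exponent is the point:
    after raising to 1 + s it is at most y, since (1 + s) / 2 \<le> 1, and exp (-y) absorbs
    it.\<close>
  have "y / 2 \<le> sinh (y / 2)" using y by (intro le_sinh) auto
  then have "y \<le> exp (y / 2) * (1 - exp (-y))"
    by (simp add: sinh_field_def right_diff_distrib e)
  then have "y powr (1 + s) \<le> (exp (y / 2) * (1 - exp (-y))) powr (1 + s)"
    using y s by (intro powr_mono2) auto
  also have "\<dots> = exp (y / 2 * (1 + s)) * (1 - exp (-y)) powr (1 + s)"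
    using y by (simp add: powr_mult exp_powr_real)
  also have "\<dots> \<le> exp y * (1 - exp (-y)) powr (1 + s)"
    using y s by (intro mult_right_mono) (auto simp: field_simps)
  finally have "y powr (1 + s) * exp (-y) \<le> exp y * (1 - exp (-y)) powr (1 + s) * exp (-y)"
    by (intro mult_right_mono) auto
  also have "\<dots> = (1 - exp (-y)) powr (1 + s) * (exp y * exp (-y))" by (simp only: mult_ac)
  also have "exp y * exp (-y) = 1" by (simp flip: exp_add)
  finally show ?thesis by simp
qed

text \<open>1 - exp (-y) is concave and zero at zero, so its quotient by y decreases; the proof is
  weighted AM-GM between exp (-a) and 1.\<close>

lemma one_minus_exp_concave:
  fixes a b :: real
  assumes "0 < b" "b \<le> a"
  shows "b * (1 - exp (-a)) \<le> a * (1 - exp (-b))"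
proof -
  have "exp (-a) powr (b / a) * 1 powr (1 - b / a) \<le> b / a * exp (-a) + (1 - b / a) * 1"
    using assms by (intro Youngs_inequality_0) auto
  then have "exp (-b) \<le> b / a * exp (-a) + (1 - b / a)"
    using assms by (simp add: exp_powr_real)
  then have "a * exp (-b) \<le> a * (b / a * exp (-a) + (1 - b / a))"
    using assms by (intro mult_left_mono) auto
  then show ?thesis using assms by (simp add: algebra_simps)
qed

lemma perturbation_frechet:
  assumes \<alpha>: "1 < \<alpha>"
  shows "perturbation \<alpha> (\<lambda>x. if 0 < x then \<alpha> * x powr (-(\<alpha> + 1)) * exp (- (x powr (-\<alpha>))) else 0)
    (frechet \<alpha>) (\<lambda>x. if 0 < x then 1 - exp (- (x powr (-\<alpha>))) else 1)"
    (is "perturbation \<alpha> ?f _ ?tail")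
proof -
  have fm[measurable]: "?f \<in> borel_measurable borel" by measurable
  have Ici: "emeasure (frechet \<alpha>) {c..} = ennreal (1 - exp (- (c powr (-\<alpha>))))" if c: "0 < c" for c
  proof -
    have "emeasure (frechet \<alpha>) {c..} = (\<integral>\<^sup>+x. ennreal (?f x) * indicator {c..} x \<partial>lborel)"
      unfolding frechet_def by (rule emeasure_density) auto
    also have "\<dots> = ennreal (1 - exp (- (c powr (-\<alpha>))))"
    proof (rule nn_integral_FTC_atLeast[OF fm])
      fix x assume "c \<le> x"
      then have x: "0 < x" using c by simp
      have "((\<lambda>x. exp (- (x powr (-\<alpha>)))) has_real_derivative exp (- (x powr (-\<alpha>))) * - (- (\<alpha> * x powr (-(\<alpha> + 1))))) (at x)"
        by (intro DERIV_fun_exp DERIV_minus DERIV_powr_neg x)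
      then show "((\<lambda>x. exp (- (x powr (-\<alpha>)))) has_real_derivative ?f x) (at x)"
        using x by (simp add: mult_ac)
      show "0 \<le> ?f x" using \<alpha> by simp
    next
      have "((\<lambda>x. exp (- (x powr (-\<alpha>)))) \<longlongrightarrow> exp (- 0)) at_top"
        using \<alpha> by (intro tendsto_exp tendsto_minus tendsto_neg_powr filterlim_ident) auto
      then show "((\<lambda>x. exp (- (x powr (-\<alpha>)))) \<longlongrightarrow> 1) at_top" by simp
    qed
    finally show ?thesis .
  qed
  have sets: "sets (frechet \<alpha>) = sets borel" "space (frechet \<alpha>) = UNIV" by (simp_all add: frechet_def)
  have low: "emeasure (frechet \<alpha>) {..0} = 0"
    unfolding frechet_def by (subst emeasure_density) (auto intro!: nn_integral_zero' simp: indicator_def)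
  \<comment> \<open>The support has no least point, so the full mass is obtained as the limit of the
    tails at 1 / (n + 1).\<close>
  have pos: "emeasure (frechet \<alpha>) {0<..} = 1"
  proof (rule LIMSEQ_unique)
    have "(\<lambda>n. emeasure (frechet \<alpha>) {inverse (real (Suc n))..}) \<longlonglongrightarrow> emeasure (frechet \<alpha>) (\<Union>n. {inverse (real (Suc n))..})"
      using sets by (intro Lim_emeasure_incseq) (auto simp: incseq_def elim!: order_trans[rotated])
    also have "(\<Union>n. {inverse (real (Suc n))..}) = {0<..}"
    proof (intro set_eqI iffI)
      fix x :: real assume "x \<in> (\<Union>n. {inverse (real (Suc n))..})"
      then obtain n where "inverse (real (Suc n)) \<le> x" by auto
      then show "x \<in> {0<..}" by (simp add: less_le_trans[OF _ \<open>inverse (real (Suc n)) \<le> x\<close>])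
    next
      fix x :: real assume "x \<in> {0<..}"
      then obtain n where "inverse (real (Suc n)) < x" using reals_Archimedean[of x] by auto
      then show "x \<in> (\<Union>n. {inverse (real (Suc n))..})" by (auto intro!: exI[of _ n])
    qed
    finally show "(\<lambda>n. emeasure (frechet \<alpha>) {inverse (real (Suc n))..}) \<longlonglongrightarrow> emeasure (frechet \<alpha>) {0<..}" .
    have eq: "inverse (real (Suc n)) powr (-\<alpha>) = real (Suc n) powr \<alpha>" for n
    proof -
      have "inverse (real (Suc n)) = real (Suc n) powr (-1)" by (simp only: powr_minus powr_one of_nat_0_le_iff)
      then show ?thesis by (simp only: powr_powr) simp
    qed
    have "filterlim (\<lambda>n. real (Suc n) powr \<alpha>) at_top sequentially"
    proof (rule filterlim_at_top_mono)
      show "filterlim (\<lambda>n. real (Suc n)) at_top sequentially"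
        by (rule filterlim_compose[OF filterlim_real_sequentially filterlim_Suc])
      show "\<forall>\<^sub>F n in sequentially. real (Suc n) \<le> real (Suc n) powr \<alpha>"
        using \<alpha> powr_mono[of 1 \<alpha>] by (intro always_eventually allI) auto
    qed
    then have "(\<lambda>n. 1 - exp (- (real (Suc n) powr \<alpha>))) \<longlonglongrightarrow> 1 - 0"
      by (intro tendsto_diff tendsto_const filterlim_compose[OF exp_at_bot])
         (simp add: filterlim_uminus_at_bot)
    then have "(\<lambda>n. ennreal (1 - exp (- (real (Suc n) powr \<alpha>)))) \<longlonglongrightarrow> ennreal 1"
      by (intro tendsto_ennrealI) simp
    moreover have "emeasure (frechet \<alpha>) {inverse (real (Suc n))..} = ennreal (1 - exp (- (real (Suc n) powr \<alpha>)))" for n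
      by (subst Ici, simp, simp only: eq)
    ultimately show "(\<lambda>n. emeasure (frechet \<alpha>) {inverse (real (Suc n))..}) \<longlonglongrightarrow> 1" by simp
  qed
  have one: "emeasure (frechet \<alpha>) A = 1" if A: "{0<..} \<subseteq> A" "A \<in> sets borel" for A
  proof (rule antisym)
    have "emeasure (frechet \<alpha>) A \<le> emeasure (frechet \<alpha>) ({0<..} \<union> {..0})"
      using A sets by (intro emeasure_mono) auto
    also have "\<dots> \<le> emeasure (frechet \<alpha>) {0<..} + emeasure (frechet \<alpha>) {..0}"
      using sets by (intro emeasure_subadditive) auto
    finally show "emeasure (frechet \<alpha>) A \<le> 1" using pos low by simp
    have "emeasure (frechet \<alpha>) {0<..} \<le> emeasure (frechet \<alpha>) A" using A sets by (intro emeasure_mono) auto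
    then show "1 \<le> emeasure (frechet \<alpha>) A" using pos by simp
  qed
  show ?thesis
  proof (rule perturbation.intro)
    show "1 < \<alpha>" by fact
    show "?f \<in> borel_measurable borel" by (rule fm)
    show "frechet \<alpha> = density lborel (\<lambda>x. ennreal (?f x))" by (rule frechet_def)
    show "prob_space (frechet \<alpha>)"
      by (rule prob_spaceI) (simp only: sets(2), rule one, auto)
  next
    fix x
    show "0 \<le> ?f x" using \<alpha> by simp
    show "?tail x = measure (frechet \<alpha>) {x..}"
    proof (cases "0 < x")
      case False
      then have "{0<..} \<subseteq> {x..}" by auto
      then show ?thesis using one[of "{x..}"] False by (simp add: measure_def)
    qed (use Ici[of x] in \<open>simp add: measure_def\<close>)
    show "?f x \<le> \<alpha> * ?tail x powr (1 + 1/\<alpha>)"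
    proof (cases "0 < x")
      case True
      have "(x powr (-\<alpha>)) powr (1 + 1/\<alpha>) = x powr (-(\<alpha> + 1))"
        using \<alpha> by (simp add: powr_powr algebra_simps)
      then show ?thesis
        using powr_exp_le_tail[of "x powr (-\<alpha>)" "1/\<alpha>"] True \<alpha>
        by (simp del: minus_add_distrib)
    qed (use \<alpha> in auto)
    show "?f x \<le> (if 0 < x then \<alpha> * x powr (-(\<alpha> + 1)) else 0)"
      using \<alpha> by (auto simp: mult_left_le)
    fix \<delta> :: real assume \<delta>: "0 \<le> \<delta>"
    show "?f x * (?tail (x - \<delta>) * (1 - ?tail (x - \<delta>))) \<le> ?f (x - \<delta>) * (?tail x * (1 - ?tail x))"
    proof (cases "0 < x - \<delta>")
      case True
      define z where "z = x - \<delta>"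
      have z: "0 < z" "z \<le> x" using True \<delta> by (auto simp: z_def)
      define a b where "a = z powr (-\<alpha>)" and "b = x powr (-\<alpha>)"
      have ab: "0 < b" "b \<le> a" unfolding a_def b_def using z \<alpha> by (auto intro: powr_mono2')
      \<comment> \<open>With the density written as \<alpha> b exp (-b) / x, both sides of
        \<open>odds\<close> share the factor \<alpha> exp (-a) exp (-b). The numerators compare by
        concavity, the denominators by z \<le> x.\<close>
      have "b * (1 - exp (-a)) / x \<le> a * (1 - exp (-b)) / z"
        using z ab one_minus_exp_concave[OF ab] by (intro frac_le) auto
      then have "\<alpha> * exp (-a) * exp (-b) * (b * (1 - exp (-a)) / x) \<le> \<alpha> * exp (-a) * exp (-b) * (a * (1 - exp (-b)) / z)"
        using \<alpha> by (intro mult_left_mono) auto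
      then show ?thesis
        using z unfolding z_def[symmetric]
        by (simp add: powr_neg_Suc a_def[symmetric] b_def[symmetric] del: minus_add_distrib) (simp add: mult_ac)
    qed (use \<delta> in auto)
  qed
qed

theorem theorem1:
  fixes d m T :: nat and \<alpha> :: real and adv :: "hist \<Rightarrow> nat \<Rightarrow> real"
  assumes "1 \<le> d" and "1 \<le> m" and "m \<le> d" and "1 \<le> T" and "1 < \<alpha>"
    and "\<And>h i. i < d \<Longrightarrow> 0 \<le> adv h i \<and> adv h i \<le> 1"
  shows
    "pseudo_regret d m
       (sqrt (((\<alpha> / (\<alpha> - 1) * real m powr (1 - 1/\<alpha>) + Gamma (1 - 1/\<alpha>)) * (real d + 1) powr (1/\<alpha>) + real m)
          / (2 * (\<alpha> + 1) * (real m + 1/\<alpha>) powr (1/\<alpha>)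
             * (real m + \<alpha> / (\<alpha> - 1) * (real d - real m + 1) powr (1 - 1/\<alpha>)) * real T)))
       (frechet \<alpha>) adv T
     \<le> 2 * sqrt (2 * (\<alpha> + 1) * (real m + 1/\<alpha>) powr (1/\<alpha>)
             * (real m + \<alpha> / (\<alpha> - 1) * (real d - real m + 1) powr (1 - 1/\<alpha>))
             * ((\<alpha> / (\<alpha> - 1) * real m powr (1 - 1/\<alpha>) + Gamma (1 - 1/\<alpha>)) * (real d + 1) powr (1/\<alpha>) + real m)
             * real T)
   \<and> pseudo_regret d m
       (sqrt ((\<alpha> * real m powr (1 - 1/\<alpha>) + (\<alpha> - 1) * Gamma (1 - 1/\<alpha>)) * (real d + 1) powr (1/\<alpha>)
          / (4 * \<alpha>^2 * (real m + 1/\<alpha>) powr (1/\<alpha>) * real d powr (1 - 1/\<alpha>) * real T)))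
       (pareto \<alpha>) adv T
     \<le> 4 * \<alpha> / sqrt (\<alpha> - 1)
        * sqrt ((real m + 1/\<alpha>) powr (1/\<alpha>)
             * (\<alpha> / (\<alpha> - 1) * real m powr (1 - 1/\<alpha>) + Gamma (1 - 1/\<alpha>))
             * real d powr (1 - 1/\<alpha>) * (real d + 1) powr (1/\<alpha>) * real T)"
proof
  note m = assms(2,3) and T = assms(4) and \<alpha> = assms(5) and adv = assms(6)
  interpret F: perturbation \<alpha> "\<lambda>x. if 0 < x then \<alpha> * x powr (-(\<alpha> + 1)) * exp (- (x powr (-\<alpha>))) else 0"
    "frechet \<alpha>" "\<lambda>x. if 0 < x then 1 - exp (- (x powr (-\<alpha>))) else 1"
    by (rule perturbation_frechet[OF \<alpha>])
  interpret P: perturbation \<alpha> "\<lambda>x. if 1 \<le> x then \<alpha> * x powr (-(\<alpha> + 1)) else 0"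
    "pareto \<alpha>" "\<lambda>x. if 1 \<le> x then x powr (-\<alpha>) else 1"
    by (rule perturbation_pareto[OF \<alpha>])
  define c where "c = \<alpha> / (\<alpha> - 1) * real m powr (1 - 1/\<alpha>)"
  define \<Gamma> where "\<Gamma> = Gamma (1 - 1/\<alpha>)"
  define K where "K = (real m + 1/\<alpha>) powr (1/\<alpha>)"
  define R where "R = real m + \<alpha> / (\<alpha> - 1) * (real d - real m + 1) powr (1 - 1/\<alpha>)"
  define S where "S = real d powr (1 - 1/\<alpha>)"
  define A where "A = (c + \<Gamma>) * (real d + 1) powr (1/\<alpha>)"
  have \<Gamma>: "0 < \<Gamma>" unfolding \<Gamma>_def using \<alpha> by (intro Gamma_real_pos) simp
  have c: "0 \<le> c" unfolding c_def using \<alpha> by simp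
  have "0 < real m + 1/\<alpha>" using m \<alpha> by (intro add_pos_pos) auto
  then have pos: "0 < K" "0 < R" "0 < S"
    unfolding K_def R_def S_def using m \<alpha> by (auto intro!: add_pos_nonneg)
  \<comment> \<open>Positivity of \<Gamma> and d < d + 1 place the penalty constant required for
    tuning below A.\<close>
  have A: "c * real d powr (1/\<alpha>) \<le> A"
    unfolding A_def using c \<Gamma> \<alpha> by (intro mult_mono powr_mono2) auto
  have "pseudo_regret d m (sqrt ((A + real m) / (2 * (\<alpha> + 1) * K * R * real T))) (frechet \<alpha>) adv T
      \<le> 2 * sqrt ((A + real m) * (2 * (\<alpha> + 1) * K * R) * real T)"
  proof (rule F.pseudo_regret_tuned[OF m T adv])
    show "\<alpha> / (\<alpha> - 1) * real m powr (1 - 1/\<alpha>) * real d powr (1/\<alpha>) \<le> A + real m"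
      using A unfolding c_def by simp
    show "F.stability d m \<le> 2 * (\<alpha> + 1) * K * R"
      unfolding K_def R_def by (rule F.stability_le_split[OF m])
    show "0 < 2 * (\<alpha> + 1) * K * R" using pos \<alpha> by simp
  qed auto
  then show "pseudo_regret d m
       (sqrt (((\<alpha> / (\<alpha> - 1) * real m powr (1 - 1/\<alpha>) + Gamma (1 - 1/\<alpha>)) * (real d + 1) powr (1/\<alpha>) + real m)
          / (2 * (\<alpha> + 1) * (real m + 1/\<alpha>) powr (1/\<alpha>)
             * (real m + \<alpha> / (\<alpha> - 1) * (real d - real m + 1) powr (1 - 1/\<alpha>)) * real T)))
       (frechet \<alpha>) adv T
     \<le> 2 * sqrt (2 * (\<alpha> + 1) * (real m + 1/\<alpha>) powr (1/\<alpha>)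
             * (real m + \<alpha> / (\<alpha> - 1) * (real d - real m + 1) powr (1 - 1/\<alpha>))
             * ((\<alpha> / (\<alpha> - 1) * real m powr (1 - 1/\<alpha>) + Gamma (1 - 1/\<alpha>)) * (real d + 1) powr (1/\<alpha>) + real m)
             * real T)"
    unfolding c_def[symmetric] \<Gamma>_def[symmetric] K_def[symmetric] R_def[symmetric] A_def[symmetric]
    by (simp only: mult.commute[of "A + real m"])
  have bound: "pseudo_regret d m (sqrt (A / (4 * \<alpha>\<^sup>2 / (\<alpha> - 1) * K * S * real T))) (pareto \<alpha>) adv T
      \<le> 2 * sqrt (A * (4 * \<alpha>\<^sup>2 / (\<alpha> - 1) * K * S) * real T)"
  proof (rule P.pseudo_regret_tuned[OF m T adv])
    show "\<alpha> / (\<alpha> - 1) * real m powr (1 - 1/\<alpha>) * real d powr (1/\<alpha>) \<le> A"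
      using A unfolding c_def .
    show "P.stability d m \<le> 4 * \<alpha>\<^sup>2 / (\<alpha> - 1) * K * S"
      unfolding K_def S_def by (rule P.stability_le[OF m(1)])
    show "0 < 4 * \<alpha>\<^sup>2 / (\<alpha> - 1) * K * S" using pos \<alpha> by simp
  qed auto
  \<comment> \<open>Numerator and denominator are multiplied by \<alpha> - 1, the denominator inside
    the Pareto stability constant.\<close>
  have rate: "A / (4 * \<alpha>\<^sup>2 / (\<alpha> - 1) * K * S * real T)
      = (\<alpha> * real m powr (1 - 1/\<alpha>) + (\<alpha> - 1) * \<Gamma>) * (real d + 1) powr (1/\<alpha>) / (4 * \<alpha>\<^sup>2 * K * S * real T)"
  proof -
    have e1: "\<alpha> * real m powr (1 - 1/\<alpha>) + (\<alpha> - 1) * \<Gamma> = (\<alpha> - 1) * (c + \<Gamma>)"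
      using \<alpha> by (simp add: c_def distrib_left)
    have e2: "4 * \<alpha>\<^sup>2 / (\<alpha> - 1) * K * S * real T = (4 * \<alpha>\<^sup>2 * K * S * real T) / (\<alpha> - 1)"
      by simp
    show ?thesis unfolding e1 e2 A_def by (simp add: mult_ac)
  qed
  have val: "2 * sqrt (A * (4 * \<alpha>\<^sup>2 / (\<alpha> - 1) * K * S) * real T)
      = 4 * \<alpha> / sqrt (\<alpha> - 1) * sqrt (K * (c + \<Gamma>) * S * (real d + 1) powr (1/\<alpha>) * real T)"
  proof -
    have "A * (4 * \<alpha>\<^sup>2 / (\<alpha> - 1) * K * S) * real T
        = (2 * \<alpha>)\<^sup>2 / (\<alpha> - 1) * (K * (c + \<Gamma>) * S * (real d + 1) powr (1/\<alpha>) * real T)"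
      by (simp add: A_def power_mult_distrib mult_ac)
    then show ?thesis using \<alpha> by (simp only:) (simp add: real_sqrt_mult real_sqrt_divide)
  qed
  show "pseudo_regret d m
       (sqrt ((\<alpha> * real m powr (1 - 1/\<alpha>) + (\<alpha> - 1) * Gamma (1 - 1/\<alpha>)) * (real d + 1) powr (1/\<alpha>)
          / (4 * \<alpha>^2 * (real m + 1/\<alpha>) powr (1/\<alpha>) * real d powr (1 - 1/\<alpha>) * real T)))
       (pareto \<alpha>) adv T
     \<le> 4 * \<alpha> / sqrt (\<alpha> - 1)
        * sqrt ((real m + 1/\<alpha>) powr (1/\<alpha>)
             * (\<alpha> / (\<alpha> - 1) * real m powr (1 - 1/\<alpha>) + Gamma (1 - 1/\<alpha>))
             * real d powr (1 - 1/\<alpha>) * (real d + 1) powr (1/\<alpha>) * real T)"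
    using bound unfolding rate val unfolding \<Gamma>_def K_def S_def c_def .
qed

end
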